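(* Let $G$ be a complex simple algebraic group, $\mathfrak g$ its Lie algebra, $\mathfrak h\subset\mathfrak g$ a Cartan subalgebra in $\mathfrak g$. Let $s\in W$ be an element of the Weyl group of the pair $(\mathfrak g,\mathfrak h)$, $\mathfrak p$ and $\mathfrak b$ the parabolic subalgebra and the Borel subalgebra associated to $s$ (as defined in the context), $\mathfrak n$ the nilradical of $\mathfrak p$, $N\subset G$ the subgroup corresponding to $\mathfrak n$, and $r$ the classical r-matrix $$r=P_{\mathfrak k}-P_{\overline{\mathfrak k}}+\frac{1+s}{1-s}P_{\mathfrak h_0^\perp}$$ on $\mathfrak g$ (as defined in the context). Then $N\subset G$ is an admissible subgroup in the Poisson–Lie group $G$ equipped with the standard Poisson bracket associated to $r$, $$\{\varphi,\psi\}=\tfrac12\langle r\nabla\varphi,\nabla\psi\rangle-\tfrac12\langle r\nabla'\varphi,\nabla'\psi\rangle .$$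
   Context: **The parabolic and Borel subalgebras associated to $s$.** Let $\Delta$ be the root system of $(\mathfrak g,\mathfrak h)$ and $\mathfrak h_{\mathbb R}\subset\mathfrak h$ the real linear span of the simple coroots, so $\Delta\subset\mathfrak h_{\mathbb R}^*$. The element $s\in W$ acts on $\mathfrak h_{\mathbb R}$ as an orthogonal transformation with respect to the scalar product induced by the Killing form. Fix an (ordered) orthogonal decomposition into $s$-invariant subspaces $\mathfrak h_{\mathbb R}=\bigoplus_{i=0}^K\mathfrak h_i$, where $\mathfrak h_0$ is the subspace fixed by $s$, and each $\mathfrak h_i$ with $i\ge1$ is either two-dimensional with $s$ acting as rotation by an angle $\theta_i$, $0<\theta_i<\pi$, or one-dimensional with $s$ acting as reflection with respect to the origin. Choose $h_i\in\mathfrak h_i$, $i=0,\dots,K$, such that $h_i(\alpha)\ne0$ for every root $\alpha$ which is not orthogonal to $\mathfrak h_i$ with respect to the natural pairing between $\mathfrak h_{\mathbb R}$ and $\mathfrak h_{\mathbb R}^*$. Put $\overline\Delta_i=\{\alpha\in\Delta: h_j(\alpha)=0\text{ for }j>i,\ h_i(\alpha)\ne0\}$. Let $i_0<i_1<\dots<i_M$ be the indices $i$ for which $\overline\Delta_i$ is not empty. Assume (this can be achieved by rescaling the $h_{i_k}$) that $$|h_{i_k}(\alpha)|>\Big|\sum_{l\le j<k}h_{i_j}(\alpha)\Big|\quad\text{for any }\alpha\in\overline\Delta_{i_k},\ k=0,\dots,M,\ l<k.$$ Then $\bar h=\sum_{k=0}^Mh_{i_k}$ belongs to a Weyl chamber;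 let $\Delta_+$ and $\Gamma$ be the sets of positive roots and of simple positive roots with respect to that chamber. Let $\bar h_0=\sum_{k=0,\,i_k>0}^Mh_{i_k}$ and $(\mathfrak g)_m=\{x\in\mathfrak g\mid[\bar h_0,x]=mx\}$, $m\in\mathbb R$. Set $\mathfrak p=\bigoplus_{m\le0}(\mathfrak g)_m$, a parabolic subalgebra with nilradical $\mathfrak n=\bigoplus_{m<0}(\mathfrak g)_m$. $\mathfrak b$ is the Borel subalgebra of $\mathfrak g$ containing $\mathfrak h$ and corresponding to the system $-\Gamma$ of simple roots, so $\mathfrak p\supset\mathfrak b\supset\mathfrak n$. $N$ is the unipotent radical of the parabolic subgroup $P\subset G$ corresponding to $\mathfrak p$; its Lie algebra is $\mathfrak n$. **The r-matrix.** $\mathfrak k$ is the nilradical of $\mathfrak b$, $\overline{\mathfrak k}$ the nilradical of the opposite Borel subalgebra; $\mathbb C\mathfrak h_0=\{x\in\mathfrak h: s(x)=x\}$, and $\mathfrak h_0^\perp$ is its orthogonal complement in $\mathfrak h$ with respect to the Killing form. $P_{\mathfrak k},P_{\overline{\mathfrak k}},P_{\mathfrak h_0^\perp}$ are the projection operators onto $\mathfrak k,\overline{\mathfrak k},\mathfrak h_0^\perp$ in the direct vector space decomposition $\mathfrak g=\mathfrak k+\overline{\mathfrak k}+\mathfrak h_0^\perp+\mathbb C\mathfrak h_0$. The operator $r$ is skew-symmetric with respect to the Killing form and satisfies the modified classical Yang–Baxter equation $[rX,rY]-r([rX,Y]+[X,rY])=-[X,Y]$. **Gradients and Poisson–Lie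 structure.** $\langle\cdot,\cdot\rangle$ is the Killing form, by means of which $\mathfrak g^*$ is identified with $\mathfrak g$. For a function $\varphi$ on $G$, $\langle\xi,\nabla\varphi(x)\rangle=\frac{d}{dt}\big|_{t=0}\varphi(e^{t\xi}x)$ and $\langle\xi,\nabla'\varphi(x)\rangle=\frac{d}{dt}\big|_{t=0}\varphi(xe^{t\xi})$, $\xi\in\mathfrak g$. A Poisson–Lie group is a Lie group with a Poisson bracket for which multiplication is a Poisson map; with the bracket in the claim, $G$ is a Poisson–Lie group whose tangent Lie bialgebra $(\mathfrak g,\mathfrak g^* )$ has dual bracket $[X,Y]_*=\frac12([rX,Y]+[X,rY])$ on $\mathfrak g^*\cong\mathfrak g$. **Admissibility.** A Poisson group action of a Poisson–Lie group $A$ on a Poisson manifold $M$ is a group action $A\times M\to M$ which is also a Poisson map, where $A\times M$ carries the product Poisson structure. Given a Poisson group action $A\times M\to M$, a subgroup $K\subset A$ is called admissible if the set $C^\infty(M)^K$ of $K$-invariants is a Poisson subalgebra in $C^\infty(M)$. *)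

theory Defs
  imports "HOL-Analysis.Analysis"
begin

section \<open>Complex matrices\<close>

text \<open>The library has no multiplication of matrices by complex scalars.\<close>

definition cscale :: "complex \<Rightarrow> complex^'n^'n \<Rightarrow> complex^'n^'n" (infixr "*\<^sub>C" 75)
  where "c *\<^sub>C A = (\<chi> i j. c * A $ i $ j)"

global_interpretation cmat: vector_space "cscale :: complex \<Rightarrow> complex^'n^'n \<Rightarrow> complex^'n^'n"
  by unfold_locales (simp_all add: cscale_def vec_eq_iff algebra_simps)

definition matrix_exp :: "complex^'n^'n \<Rightarrow> complex^'n^'n"
  where "matrix_exp A = (\<Sum>k. (1 / fact k) *\<^sub>R ((\<lambda>B. A ** B) ^^ k) (mat 1))"

definition lie_bracket :: "complex^'n^'n \<Rightarrow> complex^'n^'n \<Rightarrow> complex^'n^'n"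
  where "lie_bracket X Y = X ** Y - Y ** X"

text \<open>The trace of a complex linear endomorphism of a complex subspace, computed in an arbitrarily
  chosen basis.\<close>

definition trace_on :: "(complex^'n^'n) set \<Rightarrow> (complex^'n^'n \<Rightarrow> complex^'n^'n) \<Rightarrow> complex"
  where "trace_on V T =
    (let B = (SOME B. B \<subseteq> V \<and> cmat.independent B \<and> cmat.span B = V)
     in \<Sum>b\<in>B. cmat.representation B (T b) b)"

section \<open>Lie algebras of matrices\<close>

definition lie_ideal :: "(complex^'n^'n) set \<Rightarrow> (complex^'n^'n) set \<Rightarrow> bool"
  where "lie_ideal I L \<longleftrightarrow>
    I \<subseteq> L \<and> cmat.subspace I \<and> (\<forall>X\<in>L. \<forall>Y\<in>I. lie_bracket X Y \<in> I)"

definition simple_lie_algebra :: "(complex^'n^'n) set \<Rightarrow> bool"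
  where "simple_lie_algebra L \<longleftrightarrow>
    cmat.subspace L \<and> (\<forall>X\<in>L. \<forall>Y\<in>L. lie_bracket X Y \<in> L) \<and>
    (\<exists>X\<in>L. \<exists>Y\<in>L. lie_bracket X Y \<noteq> 0) \<and>
    (\<forall>I. lie_ideal I L \<longrightarrow> I = {0} \<or> I = L)"

primrec lower_central :: "(complex^'n^'n) set \<Rightarrow> nat \<Rightarrow> (complex^'n^'n) set" where
  "lower_central L 0 = L"
| "lower_central L (Suc k) = cmat.span {lie_bracket X Y |X Y. X \<in> L \<and> Y \<in> lower_central L k}"

definition nilpotent_lie_algebra :: "(complex^'n^'n) set \<Rightarrow> bool"
  where "nilpotent_lie_algebra L \<longleftrightarrow> (\<exists>k. lower_central L k = {0})"

definition nilradical :: "(complex^'n^'n) set \<Rightarrow> (complex^'n^'n) set"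
  where "nilradical L = cmat.span (\<Union>{I. lie_ideal I L \<and> nilpotent_lie_algebra I})"

definition killing_form :: "(complex^'n^'n) set \<Rightarrow> complex^'n^'n \<Rightarrow> complex^'n^'n \<Rightarrow> complex"
  where "killing_form L X Y = trace_on L (\<lambda>Z. lie_bracket X (lie_bracket Y Z))"

section \<open>Simple algebraic groups\<close>

inductive polynomial_fun :: "(complex^'n^'n \<Rightarrow> complex) \<Rightarrow> bool" where
  "polynomial_fun (\<lambda>A. c)"
| "polynomial_fun (\<lambda>A. A $ i $ j)"
| "polynomial_fun f \<Longrightarrow> polynomial_fun g \<Longrightarrow> polynomial_fun (\<lambda>A. f A + g A)"
| "polynomial_fun f \<Longrightarrow> polynomial_fun g \<Longrightarrow> polynomial_fun (\<lambda>A. f A * g A)"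

definition matrix_group :: "(complex^'n^'n) set \<Rightarrow> bool"
  where "matrix_group G \<longleftrightarrow>
    (\<forall>A\<in>G. invertible A) \<and> mat 1 \<in> G \<and> (\<forall>A\<in>G. \<forall>B\<in>G. A ** B \<in> G) \<and>
    (\<forall>A\<in>G. matrix_inv A \<in> G)"

definition algebraic_group :: "(complex^'n^'n) set \<Rightarrow> bool"
  where "algebraic_group G \<longleftrightarrow> matrix_group G \<and>
    (\<exists>F. (\<forall>f\<in>F. polynomial_fun f) \<and> G = {A. invertible A \<and> (\<forall>f\<in>F. f A = 0)})"

definition lie_algebra :: "(complex^'n^'n) set \<Rightarrow> (complex^'n^'n) set"
  where "lie_algebra G = {X. \<forall>t::real. matrix_exp (t *\<^sub>R X) \<in> G}"

text \<open>Simplicity is understood in the Lie-theoretic sense (finite centre allowed). A complex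
  simple algebraic group is affine, so nothing is lost by embedding it in a general linear group;
  connectedness in the Euclidean and in the Zariski topology agree.\<close>

definition simple_algebraic_group :: "(complex^'n^'n) set \<Rightarrow> bool"
  where "simple_algebraic_group G \<longleftrightarrow>
    algebraic_group G \<and> connected G \<and> simple_lie_algebra (lie_algebra G)"

definition generated_subgroup :: "(complex^'n^'n) set \<Rightarrow> (complex^'n^'n) set \<Rightarrow> (complex^'n^'n) set"
  where "generated_subgroup G S = \<Inter>{H. matrix_group H \<and> H \<subseteq> G \<and> S \<subseteq> H}"

text \<open>The connected subgroup with a given Lie algebra is generated by the exponentials.\<close>

definition subgroup_of_subalgebra ::
    "(complex^'n^'n) set \<Rightarrow> (complex^'n^'n) set \<Rightarrow> (complex^'n^'n) set"
  where "subgroup_of_subalgebra G L = generated_subgroup G (matrix_exp ` L)"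

section \<open>Roots and the Weyl group\<close>

text \<open>Cartan subalgebras of a semisimple complex Lie algebra: maximal abelian and acting
  diagonalizably in the adjoint representation.\<close>

definition cartan_subalgebra :: "(complex^'n^'n) set \<Rightarrow> (complex^'n^'n) set \<Rightarrow> bool"
  where "cartan_subalgebra L h \<longleftrightarrow>
    h \<subseteq> L \<and> cmat.subspace h \<and>
    (\<forall>X\<in>h. \<forall>Y\<in>h. lie_bracket X Y = 0) \<and>
    (\<forall>X\<in>L. (\<forall>Y\<in>h. lie_bracket Y X = 0) \<longrightarrow> X \<in> h) \<and>
    (\<forall>Y\<in>h. cmat.span {X \<in> L. \<exists>c. lie_bracket Y X = c *\<^sub>C X} = L)"

definition root_space ::
    "(complex^'n^'n) set \<Rightarrow> (complex^'n^'n) set \<Rightarrow> (complex^'n^'n \<Rightarrow> complex) \<Rightarrow> (complex^'n^'n) set"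
  where "root_space L h \<alpha> = {X \<in> L. \<forall>Y\<in>h. lie_bracket Y X = \<alpha> Y *\<^sub>C X}"

text \<open>Roots are functionals on \<open>h\<close>, represented by functions that vanish outside \<open>h\<close> in order to
  have unique representatives. Linearity on \<open>h\<close> follows from the root space being nonzero.\<close>

definition roots :: "(complex^'n^'n) set \<Rightarrow> (complex^'n^'n) set \<Rightarrow> (complex^'n^'n \<Rightarrow> complex) set"
  where "roots L h =
    {\<alpha>. (\<forall>Y. Y \<notin> h \<longrightarrow> \<alpha> Y = 0) \<and> (\<exists>Y\<in>h. \<alpha> Y \<noteq> 0) \<and> root_space L h \<alpha> \<noteq> {0}}"

text \<open>With \<open>t\<close> the element of \<open>h\<close> dual to \<open>\<alpha>\<close> under the Killing form, the coroot is
  \<open>2 t / (t, t)\<close>, and \<open>(t, t) = \<alpha> t\<close>.\<close>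

definition coroot ::
    "(complex^'n^'n) set \<Rightarrow> (complex^'n^'n) set \<Rightarrow> (complex^'n^'n \<Rightarrow> complex) \<Rightarrow> complex^'n^'n"
  where "coroot L h \<alpha> =
    (let t = (THE t. t \<in> h \<and> (\<forall>Y\<in>h. killing_form L t Y = \<alpha> Y)) in (2 / \<alpha> t) *\<^sub>C t)"

text \<open>The span of the simple coroots, for any choice of simple roots, is the span of all coroots.\<close>

definition real_cartan :: "(complex^'n^'n) set \<Rightarrow> (complex^'n^'n) set \<Rightarrow> (complex^'n^'n) set"
  where "real_cartan L h = span (coroot L h ` roots L h)"

text \<open>The Weyl group acting on \<open>h\<close>; outside \<open>h\<close> its elements are the identity.\<close>

inductive_set weyl_group ::
    "(complex^'n^'n) set \<Rightarrow> (complex^'n^'n) set \<Rightarrow> (complex^'n^'n \<Rightarrow> complex^'n^'n) set"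
  for L h where
  "id \<in> weyl_group L h"
| "w \<in> weyl_group L h \<Longrightarrow> \<alpha> \<in> roots L h \<Longrightarrow>
    (\<lambda>Y. Y - \<alpha> Y *\<^sub>C coroot L h \<alpha>) \<circ> w \<in> weyl_group L h"

section \<open>Subalgebras associated to a Weyl group element\<close>

definition is_plane_rotation ::
    "(complex^'n^'n \<Rightarrow> complex^'n^'n \<Rightarrow> complex) \<Rightarrow> (complex^'n^'n \<Rightarrow> complex^'n^'n) \<Rightarrow>
      (complex^'n^'n) set \<Rightarrow> real \<Rightarrow> bool"
  where "is_plane_rotation B s V \<theta> \<longleftrightarrow>
    (\<exists>e f. B e e = 1 \<and> B f f = 1 \<and> B e f = 0 \<and> V = span {e, f} \<and>
      s e = cos \<theta> *\<^sub>R e + sin \<theta> *\<^sub>R f \<and> s f = - sin \<theta> *\<^sub>R e + cos \<theta> *\<^sub>R f)"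

text \<open>The ordered decomposition of the real Cartan subalgebra into \<open>V 0, \<dots>, V K\<close>.
  Since the Killing form is positive definite there, an orthogonal sum is automatically direct.\<close>

definition weyl_decomposition ::
    "(complex^'n^'n) set \<Rightarrow> (complex^'n^'n) set \<Rightarrow> (complex^'n^'n \<Rightarrow> complex^'n^'n) \<Rightarrow>
      nat \<Rightarrow> (nat \<Rightarrow> (complex^'n^'n) set) \<Rightarrow> bool"
  where "weyl_decomposition L h s K V \<longleftrightarrow>
    (\<forall>i\<le>K. subspace (V i) \<and> V i \<subseteq> real_cartan L h \<and> s ` V i \<subseteq> V i) \<and>
    (\<forall>i\<le>K. \<forall>j\<le>K. i \<noteq> j \<longrightarrow> (\<forall>x\<in>V i. \<forall>y\<in>V j. killing_form L x y = 0)) \<and>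
    real_cartan L h = {\<Sum>i\<le>K. x i |x. \<forall>i\<le>K. x i \<in> V i} \<and>
    V 0 = {x \<in> real_cartan L h. s x = x} \<and>
    (\<forall>i. 1 \<le> i \<and> i \<le> K \<longrightarrow>
      (\<exists>\<theta>. 0 < \<theta> \<and> \<theta> < pi \<and> is_plane_rotation (killing_form L) s (V i) \<theta>) \<or>
      (dim (V i) = 1 \<and> (\<forall>x\<in>V i. s x = - x)))"

text \<open>The sets written \<open>\<Delta>\<close>-bar with index \<open>i\<close>; the value at \<open>\<alpha>\<close> of an element \<open>\<eta> j\<close> of the
  Cartan subalgebra is \<open>\<alpha> (\<eta> j)\<close>.\<close>

definition root_stratum ::
    "(complex^'n^'n) set \<Rightarrow> (complex^'n^'n) set \<Rightarrow> nat \<Rightarrow> (nat \<Rightarrow> complex^'n^'n) \<Rightarrow> nat \<Rightarrow>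
      (complex^'n^'n \<Rightarrow> complex) set"
  where "root_stratum L h K \<eta> i =
    {\<alpha> \<in> roots L h. (\<forall>j. i < j \<and> j \<le> K \<longrightarrow> \<alpha> (\<eta> j) = 0) \<and> \<alpha> (\<eta> i) \<noteq> 0}"

text \<open>Roots are real on the real Cartan subalgebra, so the real part only adjusts the type.\<close>

definition positive_roots ::
    "(complex^'n^'n) set \<Rightarrow> (complex^'n^'n) set \<Rightarrow> complex^'n^'n \<Rightarrow> (complex^'n^'n \<Rightarrow> complex) set"
  where "positive_roots L h z = {\<alpha> \<in> roots L h. Re (\<alpha> z) > 0}"

definition positive_borel ::
    "(complex^'n^'n) set \<Rightarrow> (complex^'n^'n) set \<Rightarrow> complex^'n^'n \<Rightarrow> (complex^'n^'n) set"
  where "positive_borel L h z = cmat.span (h \<union> (\<Union>\<alpha>\<in>positive_roots L h z. root_space L h \<alpha>))"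

definition negative_borel ::
    "(complex^'n^'n) set \<Rightarrow> (complex^'n^'n) set \<Rightarrow> complex^'n^'n \<Rightarrow> (complex^'n^'n) set"
  where "negative_borel L h z =
    cmat.span (h \<union> (\<Union>\<alpha>\<in>positive_roots L h z. root_space L h (\<lambda>Y. - \<alpha> Y)))"

definition grade :: "(complex^'n^'n) set \<Rightarrow> complex^'n^'n \<Rightarrow> real \<Rightarrow> (complex^'n^'n) set"
  where "grade L z m = {X \<in> L. lie_bracket z X = m *\<^sub>R X}"

text \<open>The sum of the nonpositive grades is a parabolic subalgebra; its nilradical is the sum of the
  negative grades.\<close>

definition grade_nilradical :: "(complex^'n^'n) set \<Rightarrow> complex^'n^'n \<Rightarrow> (complex^'n^'n) set"
  where "grade_nilradical L z = cmat.span (\<Union>m\<in>{..<0}. grade L z m)"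

section \<open>The classical r-matrix\<close>

text \<open>The component in \<open>A\<close> along a complement \<open>B\<close>.\<close>

definition projection ::
    "(complex^'n^'n) set \<Rightarrow> (complex^'n^'n) set \<Rightarrow> complex^'n^'n \<Rightarrow> complex^'n^'n"
  where "projection A B X = (THE a. a \<in> A \<and> X - a \<in> B)"

text \<open>The operator \<open>(1 + s) / (1 - s)\<close> on a subspace \<open>V\<close> on which \<open>1 - s\<close> is invertible.\<close>

definition cayley ::
    "(complex^'n^'n \<Rightarrow> complex^'n^'n) \<Rightarrow> (complex^'n^'n) set \<Rightarrow> complex^'n^'n \<Rightarrow> complex^'n^'n"
  where "cayley s V x = (THE z. \<exists>y\<in>V. x = y - s y \<and> z = y + s y)"

definition r_matrix ::
    "(complex^'n^'n) set \<Rightarrow> (complex^'n^'n) set \<Rightarrow> (complex^'n^'n \<Rightarrow> complex^'n^'n) \<Rightarrow>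
      (complex^'n^'n) set \<Rightarrow> (complex^'n^'n) set \<Rightarrow> complex^'n^'n \<Rightarrow> complex^'n^'n"
  where "r_matrix L h s k kbar X =
    (let fixed = {x \<in> h. s x = x};
         perp = {x \<in> h. \<forall>y\<in>fixed. killing_form L x y = 0}
     in projection k (cmat.span (kbar \<union> perp \<union> fixed)) X
        - projection kbar (cmat.span (k \<union> perp \<union> fixed)) X
        + cayley s perp (projection perp (cmat.span (k \<union> kbar \<union> fixed)) X))"

section \<open>Smooth and holomorphic functions\<close>

text \<open>Everything below is over a ground field \<open>'k\<close>, which is either \<open>complex\<close> (complex manifolds and
  holomorphic functions) or \<open>real\<close> (real manifolds and smooth functions).\<close>

primrec times_differentiable_on ::
    "nat \<Rightarrow> ('a::real_normed_vector) set \<Rightarrow> ('a \<Rightarrow> 'b::real_normed_vector) \<Rightarrow> bool" where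
  "times_differentiable_on 0 U f \<longleftrightarrow> continuous_on U f"
| "times_differentiable_on (Suc p) U f \<longleftrightarrow>
    (\<exists>D. (\<forall>x\<in>U. (f has_derivative D x) (at x)) \<and>
         (\<forall>v. times_differentiable_on p U (\<lambda>x. D x v)))"

text \<open>A function on an arbitrary subset \<open>S\<close> of a \<open>'k\<close>-vector space with scalar multiplication \<open>sc\<close>
  is smooth if it extends locally to a smooth function on an open set with \<open>'k\<close>-linear
  derivatives. For \<open>'k = complex\<close> this says that the local extensions are holomorphic.\<close>

definition smooth_on ::
    "('k \<Rightarrow> 'a \<Rightarrow> 'a) \<Rightarrow> ('a::real_normed_vector) set \<Rightarrow> ('a \<Rightarrow> 'k::real_normed_field) \<Rightarrow> bool"
  where "smooth_on sc S f \<longleftrightarrow>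
    (\<forall>x\<in>S. \<exists>U F. open U \<and> x \<in> U \<and> (\<forall>y\<in>S \<inter> U. F y = f y) \<and>
      (\<forall>p. times_differentiable_on p U F) \<and>
      (\<forall>y\<in>U. \<exists>D. (F has_derivative D) (at y) \<and> (\<forall>c v. D (sc c v) = c * D v)))"

section \<open>Poisson manifolds\<close>

text \<open>The bracket acts on locally defined functions (total functions with irrelevant values outside
  an open set); for \<open>'k = real\<close> this is equivalent to a bracket of global functions, whereas a
  complex manifold may have too few global holomorphic functions.\<close>

record ('m, 'k, 'd::finite) poisson_space =
  mtop :: "'m topology"
  atlas :: "('m set \<times> ('m \<Rightarrow> 'k^'d)) set"
  pbracket :: "('m \<Rightarrow> 'k) \<Rightarrow> ('m \<Rightarrow> 'k) \<Rightarrow> 'm \<Rightarrow> 'k"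

definition smooth_manifold ::
    "('m, 'k::{real_normed_field,euclidean_space}, 'd::finite) poisson_space \<Rightarrow> bool"
  where "smooth_manifold M \<longleftrightarrow>
    Hausdorff_space (mtop M) \<and> second_countable (mtop M) \<and>
    \<Union>(fst ` atlas M) = topspace (mtop M) \<and>
    (\<forall>(U, \<kappa>)\<in>atlas M. openin (mtop M) U \<and> open (\<kappa> ` U) \<and>
      homeomorphic_map (subtopology (mtop M) U) (top_of_set (\<kappa> ` U)) \<kappa>) \<and>
    (\<forall>(U, \<kappa>)\<in>atlas M. \<forall>(U', \<kappa>')\<in>atlas M. \<forall>i.
      smooth_on (*s) (\<kappa> ` (U \<inter> U')) (\<lambda>y. \<kappa>' (inv_into U \<kappa> y) $ i))"

definition smooth_functions ::
    "('m, 'k::{real_normed_field,euclidean_space}, 'd::finite) poisson_space \<Rightarrow> 'm set \<Rightarrow>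
      ('m \<Rightarrow> 'k) set"
  where "smooth_functions M W =
    {\<phi>. \<forall>(U, \<kappa>)\<in>atlas M. smooth_on (*s) (\<kappa> ` (U \<inter> W)) (\<lambda>y. \<phi> (inv_into U \<kappa> y))}"

definition poisson_manifold ::
    "('m, 'k::{real_normed_field,euclidean_space}, 'd::finite) poisson_space \<Rightarrow> bool"
  where "poisson_manifold M \<longleftrightarrow> smooth_manifold M \<and>
    (\<forall>U. openin (mtop M) U \<longrightarrow>
      (\<forall>\<phi>\<in>smooth_functions M U. \<forall>\<psi>\<in>smooth_functions M U.
        pbracket M \<phi> \<psi> \<in> smooth_functions M U \<and>
        (\<forall>x\<in>U. pbracket M \<phi> \<psi> x = - pbracket M \<psi> \<phi> x) \<and>
        (\<forall>\<phi>'\<in>smooth_functions M U. \<forall>\<psi>'\<in>smooth_functions M U.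
          (\<forall>x\<in>U. \<phi> x = \<phi>' x \<and> \<psi> x = \<psi>' x) \<longrightarrow>
          (\<forall>x\<in>U. pbracket M \<phi> \<psi> x = pbracket M \<phi>' \<psi>' x)) \<and>
        (\<forall>\<omega>\<in>smooth_functions M U. \<forall>x\<in>U.
          (\<forall>c. pbracket M (\<lambda>y. c * \<phi> y + \<omega> y) \<psi> x = c * pbracket M \<phi> \<psi> x + pbracket M \<omega> \<psi> x) \<and>
          pbracket M (\<lambda>y. \<phi> y * \<omega> y) \<psi> x = \<phi> x * pbracket M \<omega> \<psi> x + pbracket M \<phi> \<psi> x * \<omega> x \<and>
          pbracket M \<phi> (pbracket M \<psi> \<omega>) x + pbracket M \<psi> (pbracket M \<omega> \<phi>) x
            + pbracket M \<omega> (pbracket M \<phi> \<psi>) x = 0)))"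

definition poisson_subalgebra ::
    "('m, 'k::{real_normed_field,euclidean_space}, 'd::finite) poisson_space \<Rightarrow>
      ('m \<Rightarrow> 'k) set \<Rightarrow> bool"
  where "poisson_subalgebra M A \<longleftrightarrow>
    A \<subseteq> smooth_functions M (topspace (mtop M)) \<and>
    (\<forall>c. (\<lambda>x. c) \<in> A) \<and>
    (\<forall>\<phi>\<in>A. \<forall>\<psi>\<in>A. (\<lambda>x. \<phi> x + \<psi> x) \<in> A \<and> (\<lambda>x. \<phi> x * \<psi> x) \<in> A \<and> pbracket M \<phi> \<psi> \<in> A)"

section \<open>Poisson group actions and admissible subgroups\<close>

text \<open>Here \<open>emb\<close> is the inclusion of the ground field into the complex numbers, through which a
  complex matrix group becomes a manifold over \<open>'k\<close>.\<close>

definition smooth_on_product ::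
    "('k \<Rightarrow> complex) \<Rightarrow> ('m, 'k::{real_normed_field,euclidean_space}, 'd::finite) poisson_space \<Rightarrow>
      ((complex^'n^'n) \<times> 'm) set \<Rightarrow> ((complex^'n^'n) \<times> 'm \<Rightarrow> 'k) \<Rightarrow> bool"
  where "smooth_on_product emb M W F \<longleftrightarrow>
    (\<forall>(U, \<kappa>)\<in>atlas M.
      smooth_on (\<lambda>c (A, y). (emb c *\<^sub>C A, c *s y))
        {(g, \<kappa> x) |g x. (g, x) \<in> W \<and> x \<in> U}
        (\<lambda>(g, y). F (g, inv_into U \<kappa> y)))"

definition smooth_group_action ::
    "('k \<Rightarrow> complex) \<Rightarrow> (complex^'n^'n) set \<Rightarrow>
      ('m, 'k::{real_normed_field,euclidean_space}, 'd::finite) poisson_space \<Rightarrow>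
      (complex^'n^'n \<Rightarrow> 'm \<Rightarrow> 'm) \<Rightarrow> bool"
  where "smooth_group_action emb G M act \<longleftrightarrow>
    (\<forall>x\<in>topspace (mtop M). act (mat 1) x = x) \<and>
    (\<forall>g\<in>G. \<forall>g'\<in>G. \<forall>x\<in>topspace (mtop M). act (g ** g') x = act g (act g' x)) \<and>
    continuous_map (prod_topology (top_of_set G) (mtop M)) (mtop M) (\<lambda>(g, x). act g x) \<and>
    (\<forall>U. openin (mtop M) U \<longrightarrow> (\<forall>\<phi>\<in>smooth_functions M U.
      smooth_on_product emb M {(g, x). g \<in> G \<and> x \<in> topspace (mtop M) \<and> act g x \<in> U}
        (\<lambda>(g, x). \<phi> (act g x))))"

definition product_bracket ::
    "((complex^'n^'n \<Rightarrow> 'k) \<Rightarrow> (complex^'n^'n \<Rightarrow> 'k) \<Rightarrow> complex^'n^'n \<Rightarrow> 'k::real_normed_field) \<Rightarrow>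
      (('m \<Rightarrow> 'k) \<Rightarrow> ('m \<Rightarrow> 'k) \<Rightarrow> 'm \<Rightarrow> 'k) \<Rightarrow>
      ((complex^'n^'n) \<times> 'm \<Rightarrow> 'k) \<Rightarrow> ((complex^'n^'n) \<times> 'm \<Rightarrow> 'k) \<Rightarrow> (complex^'n^'n) \<times> 'm \<Rightarrow> 'k"
  where "product_bracket brG brM F H = (\<lambda>(g, x).
    brG (\<lambda>g'. F (g', x)) (\<lambda>g'. H (g', x)) g + brM (\<lambda>x'. F (g, x')) (\<lambda>x'. H (g, x')) x)"

definition poisson_group_action ::
    "('k \<Rightarrow> complex) \<Rightarrow> (complex^'n^'n) set \<Rightarrow>
      ((complex^'n^'n \<Rightarrow> 'k) \<Rightarrow> (complex^'n^'n \<Rightarrow> 'k) \<Rightarrow> complex^'n^'n \<Rightarrow> 'k) \<Rightarrow>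
      ('m, 'k::{real_normed_field,euclidean_space}, 'd::finite) poisson_space \<Rightarrow>
      (complex^'n^'n \<Rightarrow> 'm \<Rightarrow> 'm) \<Rightarrow> bool"
  where "poisson_group_action emb G brG M act \<longleftrightarrow>
    smooth_group_action emb G M act \<and>
    (\<forall>U. openin (mtop M) U \<longrightarrow>
      (\<forall>\<phi>\<in>smooth_functions M U. \<forall>\<psi>\<in>smooth_functions M U.
        \<forall>g\<in>G. \<forall>x\<in>topspace (mtop M). act g x \<in> U \<longrightarrow>
          product_bracket brG (pbracket M) (\<lambda>(g, x). \<phi> (act g x)) (\<lambda>(g, x). \<psi> (act g x)) (g, x)
            = pbracket M \<phi> \<psi> (act g x)))"

definition invariant_functions ::
    "('m, 'k::{real_normed_field,euclidean_space}, 'd::finite) poisson_space \<Rightarrow>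
      (complex^'n^'n \<Rightarrow> 'm \<Rightarrow> 'm) \<Rightarrow> (complex^'n^'n) set \<Rightarrow> ('m \<Rightarrow> 'k) set"
  where "invariant_functions M act N =
    {\<phi> \<in> smooth_functions M (topspace (mtop M)).
      \<forall>g\<in>N. \<forall>x\<in>topspace (mtop M). \<phi> (act g x) = \<phi> x}"

text \<open>Admissibility with respect to every Poisson group action of \<open>G\<close>. The last argument only
  carries the types of the points, of the ground field and of the dimension of the manifolds.
  The bracket \<open>brG\<close> is meant to be a Poisson--Lie bracket, which need not be assumed here.\<close>

definition admissible_subgroup ::
    "('k \<Rightarrow> complex) \<Rightarrow> (complex^'n^'n) set \<Rightarrow>
      ((complex^'n^'n \<Rightarrow> 'k) \<Rightarrow> (complex^'n^'n \<Rightarrow> 'k) \<Rightarrow> complex^'n^'n \<Rightarrow> 'k) \<Rightarrow>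
      (complex^'n^'n) set \<Rightarrow>
      ('m, 'k::{real_normed_field,euclidean_space}, 'd::finite) poisson_space itself \<Rightarrow> bool"
  where "admissible_subgroup emb G brG N _ \<longleftrightarrow>
    matrix_group N \<and> N \<subseteq> G \<and>
    (\<forall>(M :: ('m, 'k, 'd) poisson_space) act.
      poisson_manifold M \<longrightarrow> poisson_group_action emb G brG M act \<longrightarrow>
      poisson_subalgebra M (invariant_functions M act N))"

section \<open>The Poisson bracket on the group\<close>

definition left_gradient ::
    "(complex^'n^'n \<Rightarrow> complex^'n^'n \<Rightarrow> 'k::real_normed_field) \<Rightarrow> (complex^'n^'n) set \<Rightarrow>
      (complex^'n^'n \<Rightarrow> 'k) \<Rightarrow> complex^'n^'n \<Rightarrow> complex^'n^'n"
  where "left_gradient B L \<phi> x =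
    (THE X. X \<in> L \<and> (\<forall>\<xi>\<in>L.
      ((\<lambda>t. \<phi> (matrix_exp (t *\<^sub>R \<xi>) ** x)) has_vector_derivative B \<xi> X) (at 0)))"

definition right_gradient ::
    "(complex^'n^'n \<Rightarrow> complex^'n^'n \<Rightarrow> 'k::real_normed_field) \<Rightarrow> (complex^'n^'n) set \<Rightarrow>
      (complex^'n^'n \<Rightarrow> 'k) \<Rightarrow> complex^'n^'n \<Rightarrow> complex^'n^'n"
  where "right_gradient B L \<phi> x =
    (THE X. X \<in> L \<and> (\<forall>\<xi>\<in>L.
      ((\<lambda>t. \<phi> (x ** matrix_exp (t *\<^sub>R \<xi>))) has_vector_derivative B \<xi> X) (at 0)))"

definition group_bracket ::
    "(complex^'n^'n \<Rightarrow> complex^'n^'n \<Rightarrow> 'k::real_normed_field) \<Rightarrow> (complex^'n^'n) set \<Rightarrow>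
      (complex^'n^'n \<Rightarrow> complex^'n^'n) \<Rightarrow>
      (complex^'n^'n \<Rightarrow> 'k) \<Rightarrow> (complex^'n^'n \<Rightarrow> 'k) \<Rightarrow> complex^'n^'n \<Rightarrow> 'k"
  where "group_bracket B L r \<phi> \<psi> x =
    1/2 * B (r (left_gradient B L \<phi> x)) (left_gradient B L \<psi> x)
    - 1/2 * B (r (right_gradient B L \<phi> x)) (right_gradient B L \<psi> x)"

text \<open>The Killing form of the Lie algebra regarded as a real Lie algebra: the real trace of a
  complex linear map is twice the real part of its complex trace.\<close>

definition real_killing_form ::
    "(complex^'n^'n) set \<Rightarrow> complex^'n^'n \<Rightarrow> complex^'n^'n \<Rightarrow> real"
  where "real_killing_form L X Y = 2 * Re (killing_form L X Y)"

end

theory Submission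
  imports Defs
begin

text \<open>
  Why \<open>N\<close> is admissible. Let \<open>G\<close> act on a Poisson manifold \<open>M\<close> by a Poisson action, let \<open>\<phi>\<close>, \<open>\<psi>\<close> be
  \<open>N\<close>-invariant functions, fix \<open>x \<in> M\<close> and put \<open>F g = \<phi> (g x)\<close>, \<open>H g = \<psi> (g x)\<close>. For \<open>g \<in> N\<close> the
  Poisson property of the action reads \<open>{\<phi>, \<psi>} (g x) = {F, H} g + {\<phi>, \<psi>} x\<close>, so it suffices that
  the bracket on \<open>G\<close> of two left \<open>N\<close>-invariant functions vanishes on \<open>N\<close>
  (lemma \<open>admissible_criterion\<close>).

  Let \<open>X\<close>, \<open>Y\<close> be the gradients of \<open>F\<close>, \<open>H\<close> at the identity. Invariance puts them into the orthogonal
  complement of \<open>\<nn>\<close>, which is the parabolic subalgebra \<open>\<pp>\<close>. At \<open>g \<in> N\<close> the right gradients are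
  still \<open>X\<close> and \<open>Y\<close>, while the left gradients are \<open>Ad g X\<close> and \<open>Ad g Y\<close>
  (lemma \<open>gradients_of_invariant\<close>). Since \<open>\<nn>\<close> is an ideal of \<open>\<pp>\<close> that acts nilpotently,
  \<open>Ad g X\<close> and \<open>X\<close> differ by an element of \<open>\<nn>\<close> (lemma \<open>Ad_N\<close>). Finally \<open>r\<close> is the
  identity on \<open>\<nn>\<close>, because \<open>\<nn>\<close> lies in the nilradical \<open>k\<close> of the Borel subalgebra, and \<open>r\<close> maps \<open>\<pp>\<close>
  into \<open>\<pp>\<close>. Hence \<open>\<langle>r X, Y\<rangle>\<close> only depends on \<open>X\<close> and \<open>Y\<close> modulo \<open>\<nn>\<close>
  (lemma \<open>r_form_modulo_nn\<close>), and the two terms of the group bracket cancel.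

  Most of the text supplies the structure theory behind this. A basis of joint eigenvectors of the
  Cartan subalgebra turns all subalgebras in question into sums of weight spaces (\<open>wsp\<close>). The Killing
  form is nondegenerate (\<open>killing_nondegenerate\<close>) by simplicity and an argument with traces on
  strings of weights; the same argument shows that weights are real on coroots. From this come
  the splitting of the Cartan subalgebra that makes \<open>r\<close> well defined (\<open>perp_fixed_decomposition\<close>), the
  nilradicals of the Borel subalgebras (\<open>nilradical_borel\<close>), and the fact that a negative root
  for the parabolic grading is a negative root for the chamber (\<open>chamber_of_decomposition\<close>).
\<close>

section \<open>Linear algebra of complex matrices\<close>

lemma cscale_component [simp]: "(c *\<^sub>C A) $ i $ j = c * A $ i $ j"
  by (simp add: cscale_def)

lemma scaleR_eq_cscale: "(c::real) *\<^sub>R A = complex_of_real c *\<^sub>C A"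
  by (simp add: vec_eq_iff scaleR_conv_of_real[where 'a = complex])

lemma cscale_mult_left: "(c *\<^sub>C A) ** B = c *\<^sub>C (A ** B)"
  and cscale_mult_right: "A ** (c *\<^sub>C B) = c *\<^sub>C (A ** B)"
  by (simp_all add: vec_eq_iff matrix_matrix_mult_def sum_distrib_left algebra_simps)

lemma csubspace_imp_subspace: "cmat.subspace S \<Longrightarrow> subspace S"
  unfolding cmat.subspace_def subspace_def scaleR_eq_cscale by blast

lemma independent_imp_real_independent:
  assumes "cmat.independent B"
  shows "independent B"
proof
  assume "dependent B"
  then obtain a where a: "a \<in> B" "a \<in> span (B - {a})"
    unfolding dependent_def by blast
  have "span (B - {a}) \<subseteq> cmat.span (B - {a})"
    by (rule span_minimal) (auto intro: cmat.span_base csubspace_imp_subspace cmat.subspace_span)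
  with a assms show False
    unfolding cmat.dependent_def by blast
qed

lemma independent_finite: "cmat.independent B \<Longrightarrow> finite B"
  using independent_imp_real_independent independent_bound by blast

global_interpretation cmat_fd: finite_dimensional_vector_space
    "cscale :: complex \<Rightarrow> complex^'n^'n \<Rightarrow> complex^'n^'n" "cmat.extend_basis {}"
proof
  show "finite (cmat.extend_basis ({} :: (complex^'n^'n) set))"
    "cmat.independent (cmat.extend_basis ({} :: (complex^'n^'n) set))"
    "cmat.span (cmat.extend_basis ({} :: (complex^'n^'n) set)) = UNIV"
    using cmat.independent_extend_basis[OF cmat.independent_empty] independent_finite
      cmat.span_extend_basis[OF cmat.independent_empty] by auto
qed

interpretation cmat_pair: vector_space_pair
    "cscale :: complex \<Rightarrow> complex^'n^'n \<Rightarrow> complex^'n^'n"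
    "cscale :: complex \<Rightarrow> complex^'n^'n \<Rightarrow> complex^'n^'n" ..

interpretation cmat_fd_pair: finite_dimensional_vector_space_pair
    "cscale :: complex \<Rightarrow> complex^'n^'n \<Rightarrow> complex^'n^'n" "cmat.extend_basis {}"
    "cscale :: complex \<Rightarrow> complex^'n^'n \<Rightarrow> complex^'n^'n" "cmat.extend_basis {}" ..

abbreviation clinear :: "(complex^'n^'n \<Rightarrow> complex^'n^'n) \<Rightarrow> bool"
  where "clinear \<equiv> Vector_Spaces.linear cscale cscale"

lemma clinearI:
  assumes "\<And>x y. f (x + y) = f x + f y" "\<And>c x. f (c *\<^sub>C x) = c *\<^sub>C f x"
  shows "clinear f"
  using assms by (auto simp: Vector_Spaces.linear_iff cmat.vector_space_axioms)

lemma clinear_add: "clinear f \<Longrightarrow> f (x + y) = f x + f y"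
  and clinear_scale: "clinear f \<Longrightarrow> f (c *\<^sub>C x) = c *\<^sub>C f x"
  and clinear_0: "clinear f \<Longrightarrow> f 0 = 0"
  and clinear_diff: "clinear f \<Longrightarrow> f (x - y) = f x - f y"
  and clinear_sum: "clinear f \<Longrightarrow> f (\<Sum>a\<in>A. u a) = (\<Sum>a\<in>A. f (u a))"
  by (simp_all add: cmat_pair.linear_add cmat_pair.linear_scale cmat_pair.linear_0
      cmat_pair.linear_diff cmat_pair.linear_sum)

lemma obtain_cbasis:
  assumes "cmat.subspace V"
  obtains B where "finite B" "B \<subseteq> V" "cmat.independent B" "cmat.span B = V"
proof -
  obtain B where "B \<subseteq> V" "cmat.independent B" "V \<subseteq> cmat.span B"
    using cmat.basis_exists[of V] by metis
  moreover from this have "cmat.span B = V"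
    using cmat.span_minimal[OF _ assms] by blast
  ultimately show ?thesis using that independent_finite by blast
qed

lemma span_induct_clinear:
  assumes "x \<in> cmat.span B" "clinear f" "cmat.subspace S" "\<And>b. b \<in> B \<Longrightarrow> f b \<in> S"
  shows "f x \<in> S"
  using assms(1)
proof (rule cmat.span_induct)
  show "cmat.subspace {x. f x \<in> S}"
    using assms(2,3) by (auto simp: cmat.subspace_def clinear_add clinear_scale clinear_0)
qed (use assms in auto)

text \<open>Maps such as the Weyl group elements are linear on a subspace only, so the dimension count
  is done for a linear extension.\<close>

lemma injective_endo_imp_surjective:
  fixes f :: "complex^'n^'n \<Rightarrow> complex^'n^'n"
  assumes V: "cmat.subspace V"
    and add: "\<And>x y. x \<in> V \<Longrightarrow> y \<in> V \<Longrightarrow> f (x + y) = f x + f y"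
    and scale: "\<And>c x. x \<in> V \<Longrightarrow> f (c *\<^sub>C x) = c *\<^sub>C f x"
    and into: "\<And>x. x \<in> V \<Longrightarrow> f x \<in> V"
    and inj: "\<And>x. x \<in> V \<Longrightarrow> f x = 0 \<Longrightarrow> x = 0"
  shows "f ` V = V"
proof -
  obtain B where B: "finite B" "B \<subseteq> V" "cmat.independent B" "cmat.span B = V"
    using obtain_cbasis[OF V] .
  obtain F where F: "clinear F" "\<forall>x\<in>B. F x = f x"
    using cmat_pair.linear_independent_extend[OF B(3)] by blast
  have f0: "f 0 = 0" using scale[of 0 0] V by (simp add: cmat.subspace_0)
  have eq: "x \<in> V \<and> F x = f x" if "x \<in> cmat.span B" for x
    using that
  proof (rule cmat.span_induct)
    show "cmat.subspace {x. x \<in> V \<and> F x = f x}"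
      using V by (auto simp: cmat.subspace_def clinear_add[OF F(1)] clinear_scale[OF F(1)]
          clinear_0[OF F(1)] add scale f0)
  qed (use F(2) B(2) in auto)
  have eqV: "F x = f x" if "x \<in> V" for x using eq that B by blast
  have "inj_on F V"
  proof (rule inj_onI)
    fix x y assume xy: "x \<in> V" "y \<in> V" "F x = F y"
    hence "x - y \<in> V" using V by (simp add: cmat.subspace_diff)
    moreover have "F (x - y) = 0" using xy by (simp add: clinear_diff[OF F(1)])
    ultimately show "x = y" using eqV inj by fastforce
  qed
  hence "cmat.dim (F ` V) = cmat.dim V"
    using cmat_fd_pair.dim_image_eq[OF F(1)] B(4) V
    by (simp add: cmat.span_eq_iff[THEN iffD2, OF V])
  moreover have "cmat.subspace (F ` V)"
    using F(1) V cmat_pair.linear_subspace_image by blast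
  moreover have "F ` V \<subseteq> V" using eqV into by auto
  ultimately have "F ` V = V"
    using cmat_fd.subspace_dim_equal[of "F ` V" V] V by simp
  thus ?thesis using eqV by auto
qed

text \<open>Riesz representation for a nondegenerate bilinear form: pairing with a basis gives an
  injective endomorphism of the subspace.\<close>

lemma bilinear_form_represents:
  fixes B :: "complex^'n^'n \<Rightarrow> complex^'n^'n \<Rightarrow> complex"
  assumes V: "cmat.subspace V"
    and addl: "\<And>x y z. x \<in> V \<Longrightarrow> y \<in> V \<Longrightarrow> z \<in> V \<Longrightarrow> B (x + y) z = B x z + B y z"
    and scalel: "\<And>c x z. x \<in> V \<Longrightarrow> z \<in> V \<Longrightarrow> B (c *\<^sub>C x) z = c * B x z"
    and addr: "\<And>x y z. x \<in> V \<Longrightarrow> y \<in> V \<Longrightarrow> z \<in> V \<Longrightarrow> B x (y + z) = B x y + B x z"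
    and scaler: "\<And>c x z. x \<in> V \<Longrightarrow> z \<in> V \<Longrightarrow> B x (c *\<^sub>C z) = c * B x z"
    and nondeg: "\<And>y. y \<in> V \<Longrightarrow> (\<And>x. x \<in> V \<Longrightarrow> B x y = 0) \<Longrightarrow> y = 0"
    and ladd: "\<And>x y. x \<in> V \<Longrightarrow> y \<in> V \<Longrightarrow> l (x + y) = l x + l y"
    and lscale: "\<And>c x. x \<in> V \<Longrightarrow> l (c *\<^sub>C x) = c * l x"
  shows "\<exists>y\<in>V. \<forall>x\<in>V. B x y = l x"
proof -
  obtain C where C: "finite C" "C \<subseteq> V" "cmat.independent C" "cmat.span C = V"
    using obtain_cbasis[OF V] .
  let ?T = "\<lambda>y. \<Sum>c\<in>C. B c y *\<^sub>C c"
  have vanish: "\<And>c. c \<in> C \<Longrightarrow> u c = 0" if "(\<Sum>c\<in>C. u c *\<^sub>C c) = 0" for u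
    by (rule cmat.independentD[OF C(3,1) subset_refl that])
  have inV: "(\<Sum>c\<in>C. u c *\<^sub>C c) \<in> V" for u
    using C(2) V by (auto intro!: cmat.subspace_sum cmat.subspace_scale)
  have "?T ` V = V"
  proof (rule injective_endo_imp_surjective[OF V])
    fix y assume y: "y \<in> V" "?T y = 0"
    have "x \<in> V \<and> B x y = 0" if "x \<in> cmat.span C" for x
      using that
    proof (rule cmat.span_induct)
      have "B 0 y = 0" using scalel[of 0 y 0] y(1) V by (simp add: cmat.subspace_0)
      thus "cmat.subspace {x. x \<in> V \<and> B x y = 0}"
        using V y(1) by (auto simp: cmat.subspace_def addl scalel)
    qed (use vanish[OF y(2)] C(2) in auto)
    hence "B x y = 0" if "x \<in> V" for x using that C(4) by blast
    thus "y = 0" using nondeg y(1) by blast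
  next
    fix y z assume yz: "y \<in> V" "z \<in> V"
    have "?T (y + z) = (\<Sum>c\<in>C. B c y *\<^sub>C c + B c z *\<^sub>C c)"
      using C(2) by (intro sum.cong refl) (simp add: addr yz subset_iff cmat.scale_left_distrib)
    thus "?T (y + z) = ?T y + ?T z" by (simp add: sum.distrib)
  next
    fix a y assume yV: "y \<in> V"
    have "?T (a *\<^sub>C y) = (\<Sum>c\<in>C. a *\<^sub>C (B c y *\<^sub>C c))"
      using C(2) by (intro sum.cong refl) (simp add: scaler yV subset_iff)
    thus "?T (a *\<^sub>C y) = a *\<^sub>C ?T y" by (simp add: cmat.scale_sum_right)
  qed (rule inV)
  moreover have "(\<Sum>c\<in>C. l c *\<^sub>C c) \<in> V" by (rule inV)
  ultimately have "(\<Sum>c\<in>C. l c *\<^sub>C c) \<in> ?T ` V" by simp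
  then obtain y where y: "(\<Sum>c\<in>C. l c *\<^sub>C c) = ?T y" "y \<in> V"
    by (rule imageE)
  have "(\<Sum>c\<in>C. (B c y - l c) *\<^sub>C c) = 0"
    unfolding cmat.scale_left_diff_distrib sum_subtractf y(1) by simp
  hence eq: "B c y = l c" if "c \<in> C" for c
    using vanish[of "\<lambda>c. B c y - l c" c] that by simp
  have "x \<in> V \<and> B x y = l x" if "x \<in> cmat.span C" for x
    using that
  proof (rule cmat.span_induct)
    have "B 0 y = 0" "l 0 = 0" using scalel[of 0 y 0] lscale[of 0 0] V y(2)
      by (simp_all add: cmat.subspace_0)
    thus "cmat.subspace {x. x \<in> V \<and> B x y = l x}"
      using V y(2) by (auto simp: cmat.subspace_def addl scalel ladd lscale)
  qed (use eq C(2) in auto)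
  thus ?thesis using y(2) C(4) by blast
qed

section \<open>Traces\<close>

text \<open>The basis that the definition of the trace on \<open>V\<close> selects.\<close>

definition chosen_basis :: "(complex^'n^'n) set \<Rightarrow> (complex^'n^'n) set"
  where "chosen_basis V = (SOME B. B \<subseteq> V \<and> cmat.independent B \<and> cmat.span B = V)"

lemma chosen_basis:
  assumes "cmat.subspace V"
  shows "chosen_basis V \<subseteq> V" "cmat.independent (chosen_basis V)" "cmat.span (chosen_basis V) = V"
    "finite (chosen_basis V)"
proof -
  have "\<exists>B. B \<subseteq> V \<and> cmat.independent B \<and> cmat.span B = V"
    using obtain_cbasis[OF assms] by metis
  from someI_ex[OF this] show "chosen_basis V \<subseteq> V" "cmat.independent (chosen_basis V)"
    "cmat.span (chosen_basis V) = V"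
    unfolding chosen_basis_def by auto
  thus "finite (chosen_basis V)" using independent_finite by blast
qed

lemma trace_on_chosen:
  "trace_on V T = (\<Sum>b\<in>chosen_basis V. cmat.representation (chosen_basis V) (T b) b)"
  by (simp add: trace_on_def chosen_basis_def Let_def)

lemma basis_expansion:
  assumes "finite B" "cmat.independent B" "cmat.span B = V" "v \<in> V"
  shows "(\<Sum>b\<in>B. cmat.representation B v b *\<^sub>C b) = v"
  by (rule cmat.sum_representation_eq) (use assms in simp_all)

text \<open>Both sides are the sum over \<open>b\<close> and \<open>c\<close> of the products of matrix entries of \<open>S\<close> and \<open>T\<close> between
  the two bases. With \<open>S\<close> the identity this is independence of the basis, with equal bases it is
  \<open>tr (S T) = tr (T S)\<close>.\<close>

lemma trace_change_of_basis:
  fixes B C :: "(complex^'n^'n) set"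
  assumes B: "finite B" "cmat.independent B" "cmat.span B = V"
    and C: "finite C" "cmat.independent C" "cmat.span C = V"
    and S: "clinear S" "S ` V \<subseteq> V" and T: "clinear T" "T ` V \<subseteq> V"
  shows "(\<Sum>b\<in>B. cmat.representation B (S (T b)) b) = (\<Sum>c\<in>C. cmat.representation C (T (S c)) c)"
proof -
  have BV: "B \<subseteq> V" and CV: "C \<subseteq> V" using B C cmat.span_superset by blast+
  have "(\<Sum>b\<in>B. cmat.representation B (S (T b)) b)
      = (\<Sum>b\<in>B. \<Sum>c\<in>C. cmat.representation C (T b) c * cmat.representation B (S c) b)"
  proof (rule sum.cong[OF refl])
    fix b assume b: "b \<in> B"
    have "S (T b) = S (\<Sum>c\<in>C. cmat.representation C (T b) c *\<^sub>C c)"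
      using b BV T basis_expansion[OF C, of "T b"] by (simp add: image_subset_iff subset_iff)
    also have "\<dots> = (\<Sum>c\<in>C. cmat.representation C (T b) c *\<^sub>C S c)"
      by (simp add: clinear_sum[OF S(1)] clinear_scale[OF S(1)])
    finally have eq: "S (T b) = \<dots>" .
    have sp: "c \<in> C \<Longrightarrow> S c \<in> cmat.span B" for c using S(2) CV B(3) by auto
    show "cmat.representation B (S (T b)) b
      = (\<Sum>c\<in>C. cmat.representation C (T b) c * cmat.representation B (S c) b)"
      unfolding eq using B(2) sp
      by (simp add: cmat.representation_sum cmat.representation_scale cmat.span_scale)
  qed
  also have "\<dots> = (\<Sum>c\<in>C. \<Sum>b\<in>B. cmat.representation B (S c) b * cmat.representation C (T b) c)"
    by (subst sum.swap) (simp add: mult.commute)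
  also have "\<dots> = (\<Sum>c\<in>C. cmat.representation C (T (S c)) c)"
  proof (rule sum.cong[OF refl])
    fix c assume c: "c \<in> C"
    have "T (S c) = T (\<Sum>b\<in>B. cmat.representation B (S c) b *\<^sub>C b)"
      using c CV S basis_expansion[OF B, of "S c"] by (simp add: image_subset_iff subset_iff)
    also have "\<dots> = (\<Sum>b\<in>B. cmat.representation B (S c) b *\<^sub>C T b)"
      by (simp add: clinear_sum[OF T(1)] clinear_scale[OF T(1)])
    finally have eq: "T (S c) = \<dots>" .
    have sp: "b \<in> B \<Longrightarrow> T b \<in> cmat.span C" for b using T(2) BV C(3) by auto
    show "(\<Sum>b\<in>B. cmat.representation B (S c) b * cmat.representation C (T b) c)
      = cmat.representation C (T (S c)) c"
      unfolding eq using C(2) sp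
      by (simp add: cmat.representation_sum cmat.representation_scale cmat.span_scale)
  qed
  finally show ?thesis .
qed

lemma clinear_id: "clinear (\<lambda>x. x)"
  by (rule clinearI) auto

lemma trace_on_any_basis:
  assumes B: "finite B" "cmat.independent B" "cmat.span B = V" and T: "clinear T" "T ` V \<subseteq> V"
  shows "trace_on V T = (\<Sum>b\<in>B. cmat.representation B (T b) b)"
proof -
  have V: "cmat.subspace V" using B(3) cmat.subspace_span by blast
  show ?thesis
    using trace_change_of_basis[of "chosen_basis V" V B T "\<lambda>x. x"]
      chosen_basis[OF V] B T clinear_id
    unfolding trace_on_chosen by blast
qed

lemma trace_on_commute:
  assumes "cmat.subspace V" "clinear S" "S ` V \<subseteq> V" "clinear T" "T ` V \<subseteq> V"
  shows "trace_on V (\<lambda>x. S (T x)) = trace_on V (\<lambda>x. T (S x))"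
proof -
  note b = chosen_basis[OF assms(1)]
  from trace_change_of_basis[OF b(4,2,3) b(4,2,3) assms(2-5)]
  show ?thesis by (simp add: trace_on_chosen)
qed

lemma trace_on_add:
  assumes "cmat.subspace V" "S ` V \<subseteq> V" "T ` V \<subseteq> V"
  shows "trace_on V (\<lambda>x. S x + T x) = trace_on V S + trace_on V T"
proof -
  note b = chosen_basis[OF assms(1)]
  have "S c \<in> cmat.span (chosen_basis V)" "T c \<in> cmat.span (chosen_basis V)"
    if "c \<in> chosen_basis V" for c
    unfolding b(3) using that assms(2,3) b(1) by blast+
  thus ?thesis unfolding trace_on_chosen
    using b(2) by (simp add: cmat.representation_add sum.distrib)
qed

lemma trace_on_scale:
  assumes "cmat.subspace V" "T ` V \<subseteq> V"
  shows "trace_on V (\<lambda>x. c *\<^sub>C T x) = c * trace_on V T"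
proof -
  note b = chosen_basis[OF assms(1)]
  have "T c \<in> cmat.span (chosen_basis V)" if "c \<in> chosen_basis V" for c
    unfolding b(3) using that assms(2) b(1) by blast
  thus ?thesis unfolding trace_on_chosen
    using b(2) by (simp add: cmat.representation_scale sum_distrib_left)
qed

lemma trace_on_diff:
  assumes "cmat.subspace V" "S ` V \<subseteq> V" "T ` V \<subseteq> V"
  shows "trace_on V (\<lambda>x. S x - T x) = trace_on V S - trace_on V T"
proof -
  note b = chosen_basis[OF assms(1)]
  have "S c \<in> cmat.span (chosen_basis V)" "T c \<in> cmat.span (chosen_basis V)"
    if "c \<in> chosen_basis V" for c
    unfolding b(3) using that assms(2,3) b(1) by blast+
  thus ?thesis unfolding trace_on_chosen
    using b(2) by (simp add: cmat.representation_diff sum_subtractf)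
qed

lemma trace_on_eigenbasis:
  assumes B: "finite B" "cmat.independent B" "cmat.span B = V" and T: "clinear T"
    and ev: "\<And>b. b \<in> B \<Longrightarrow> T b = l b *\<^sub>C b"
  shows "trace_on V T = (\<Sum>b\<in>B. l b)"
proof -
  have "T x \<in> V" if "x \<in> V" for x
    by (rule span_induct_clinear[OF _ T, where B = B])
      (use that B ev in \<open>auto simp: cmat.span_base cmat.span_scale\<close>)
  hence "trace_on V T = (\<Sum>b\<in>B. cmat.representation B (T b) b)"
    by (intro trace_on_any_basis[OF B T]) blast
  also have "\<dots> = (\<Sum>b\<in>B. l b)"
    using B(2) by (simp add: ev cmat.representation_scale cmat.span_base cmat.representation_basis)
  finally show ?thesis .
qed

section \<open>The exponential of a matrix\<close>

lemma bounded_bilinear_matrix_mult: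
  "bounded_bilinear ((**) :: complex^'n^'n \<Rightarrow> complex^'n^'n \<Rightarrow> complex^'n^'n)"
proof -
  have "bilinear ((**) :: complex^'n^'n \<Rightarrow> complex^'n^'n \<Rightarrow> complex^'n^'n)"
    unfolding bilinear_def
    by (auto intro!: linearI simp: matrix_add_ldistrib scaleR_eq_cscale cscale_mult_left
        cscale_mult_right)
      (simp add: vec_eq_iff matrix_matrix_mult_def sum.distrib distrib_right)
  thus ?thesis by (simp add: bilinear_conv_bounded_bilinear)
qed

interpretation mmult: bounded_bilinear
    "(**) :: complex^'n^'n \<Rightarrow> complex^'n^'n \<Rightarrow> complex^'n^'n"
  by (rule bounded_bilinear_matrix_mult)

lemma matrix_inv_eq:
  fixes A B :: "complex^'n^'n"
  assumes "A ** B = mat 1" "B ** A = mat 1"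
  shows "matrix_inv A = B"
proof -
  have "\<exists>A'. A ** A' = mat 1 \<and> A' ** A = mat 1" using assms by blast
  from someI_ex[OF this] have i: "A ** matrix_inv A = mat 1" "matrix_inv A ** A = mat 1"
    unfolding matrix_inv_def by auto
  have "matrix_inv A = (B ** A) ** matrix_inv A" by (simp add: assms)
  also have "\<dots> = B" unfolding matrix_mul_assoc[symmetric] i by simp
  finally show ?thesis .
qed

lemma matrix_inv_cancel:
  fixes A :: "complex^'n^'n"
  assumes "invertible A"
  shows "A ** matrix_inv A = mat 1" "matrix_inv A ** A = mat 1"
proof -
  have "\<exists>A'. A ** A' = mat 1 \<and> A' ** A = mat 1" using assms unfolding invertible_def .
  from someI_ex[OF this] show "A ** matrix_inv A = mat 1" "matrix_inv A ** A = mat 1"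
    unfolding matrix_inv_def by auto
qed

lemma matrix_inv_inv:
  fixes A :: "complex^'n^'n"
  assumes "invertible A"
  shows "matrix_inv (matrix_inv A) = A"
  by (rule matrix_inv_eq) (rule matrix_inv_cancel[OF assms])+

lemma matrix_inv_mult:
  fixes A C :: "complex^'n^'n"
  assumes "invertible A" "invertible C"
  shows "matrix_inv (A ** C) = matrix_inv C ** matrix_inv A"
proof (rule matrix_inv_eq)
  note i = matrix_inv_cancel[OF assms(1)] and j = matrix_inv_cancel[OF assms(2)]
  have "A ** C ** (matrix_inv C ** matrix_inv A) = A ** (C ** matrix_inv C) ** matrix_inv A"
    by (simp only: matrix_mul_assoc)
  thus "A ** C ** (matrix_inv C ** matrix_inv A) = mat 1" by (simp add: i j)
  have "matrix_inv C ** matrix_inv A ** (A ** C) = matrix_inv C ** (matrix_inv A ** A) ** C"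
    by (simp only: matrix_mul_assoc)
  thus "matrix_inv C ** matrix_inv A ** (A ** C) = mat 1" by (simp add: i j)
qed

definition mpow :: "complex^'n^'n \<Rightarrow> nat \<Rightarrow> complex^'n^'n"
  where "mpow X k = ((\<lambda>B. X ** B) ^^ k) (mat 1)"

lemma mpow_0 [simp]: "mpow X 0 = mat 1"
  and mpow_Suc [simp]: "mpow X (Suc k) = X ** mpow X k"
  by (simp_all add: mpow_def)

lemma matrix_exp_mpow: "matrix_exp X = (\<Sum>k. (1 / fact k) *\<^sub>R mpow X k)"
  by (simp add: matrix_exp_def mpow_def)

lemma mpow_commute: "mpow X k ** X = X ** mpow X k"
  by (induction k) (simp_all add: matrix_mul_assoc[symmetric])

lemma mpow_scaleR: "mpow (t *\<^sub>R X) k = t ^ k *\<^sub>R mpow X k"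
proof (induction k)
  case (Suc k)
  have "mpow (t *\<^sub>R X) (Suc k) = (t *\<^sub>R X) ** (t ^ k *\<^sub>R mpow X k)" by (simp add: Suc)
  also have "\<dots> = t ^ Suc k *\<^sub>R mpow X (Suc k)"
    unfolding mmult.scaleR_left mmult.scaleR_right by simp
  finally show ?case .
qed simp

lemma mpow_conj:
  fixes A B X :: "complex^'n^'n"
  assumes "B ** A = mat 1" "A ** B = mat 1"
  shows "mpow (A ** X ** B) k = A ** mpow X k ** B"
proof (induction k)
  case (Suc k)
  have "mpow (A ** X ** B) (Suc k) = A ** X ** (B ** A) ** mpow X k ** B"
    by (simp only: Suc mpow_Suc matrix_mul_assoc)
  also have "\<dots> = A ** mpow X (Suc k) ** B"
    unfolding assms(1) by (simp only: mpow_Suc matrix_mul_assoc matrix_mul_rid)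
  finally show ?case .
qed (simp add: assms)

lemma summable_exp_norms:
  assumes "r \<ge> 0"
  shows "summable (\<lambda>k. norm (mpow (X :: complex^'n^'n) k) / fact k * r ^ k)"
proof -
  obtain K where "K > 0 \<and> (\<forall>A :: complex^'n^'n. \<forall>B :: complex^'n^'n. norm (A ** B) \<le> norm A * norm B * K)"
    using mmult.pos_bounded by (elim exE) (rule that)
  hence K: "K > 0" "\<And>(A :: complex^'n^'n) (B :: complex^'n^'n). norm (A ** B) \<le> norm A * norm B * K" by simp_all
  let ?C = "norm (mat 1 :: complex^'n^'n)"
  have bound: "norm (mpow X k) \<le> ?C * (norm X * K) ^ k" for k
  proof (induction k)
    case (Suc k)
    have "norm (mpow X (Suc k)) \<le> norm X * norm (mpow X k) * K" using K(2) by simp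
    also have "\<dots> \<le> norm X * (?C * (norm X * K) ^ k) * K"
      using Suc K(1) by (intro mult_right_mono mult_left_mono) auto
    finally show ?case by (simp add: mult_ac)
  qed simp
  show ?thesis
  proof (rule summable_comparison_test')
    show "summable (\<lambda>k. ?C * (inverse (fact k) * (norm X * K * r) ^ k))"
      by (intro summable_mult summable_exp)
    show "norm (norm (mpow X k) / fact k * r ^ k) \<le> ?C * (inverse (fact k) * (norm X * K * r) ^ k)"
      if "k \<ge> 0" for k
      using mult_left_mono[OF bound[of k], of "inverse (fact k) * r ^ k"] assms
      by (simp add: divide_inverse power_mult_distrib mult_ac)
  qed
qed

lemma summable_exp_series: "summable (\<lambda>k. (1 / fact k) *\<^sub>R mpow X k)"
  by (rule summable_norm_cancel) (use summable_exp_norms[of 1 X] in simp)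

lemma matrix_exp_commute: "matrix_exp (t *\<^sub>R X) ** X = X ** matrix_exp (t *\<^sub>R X)"
proof -
  have "matrix_exp (t *\<^sub>R X) ** X = (\<Sum>k. (1 / fact k) *\<^sub>R mpow (t *\<^sub>R X) k ** X)"
    unfolding matrix_exp_mpow
    by (rule bounded_linear.suminf[OF mmult.bounded_linear_left summable_exp_series])
  also have "\<dots> = (\<Sum>k. X ** ((1 / fact k) *\<^sub>R mpow (t *\<^sub>R X) k))"
    unfolding mpow_scaleR mmult.scaleR_left mmult.scaleR_right mpow_commute ..
  also have "\<dots> = X ** matrix_exp (t *\<^sub>R X)"
    unfolding matrix_exp_mpow
    by (rule bounded_linear.suminf[OF mmult.bounded_linear_right summable_exp_series, symmetric])
  finally show ?thesis .
qed

lemma matrix_exp_conj: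
  fixes A B X :: "complex^'n^'n"
  assumes "B ** A = mat 1" "A ** B = mat 1"
  shows "matrix_exp (A ** X ** B) = A ** matrix_exp X ** B"
proof -
  have bl: "bounded_linear (\<lambda>Y. A ** Y ** B)"
    by (rule bounded_linear_compose[OF mmult.bounded_linear_left mmult.bounded_linear_right])
  show ?thesis
    unfolding matrix_exp_mpow bounded_linear.suminf[OF bl summable_exp_series]
    unfolding mpow_conj[OF assms] mmult.scaleR_left mmult.scaleR_right ..
qed

lemma matrix_exp_0 [simp]: "matrix_exp 0 = mat 1"
proof -
  have "mpow 0 k = (0 :: complex^'n^'n)" if "k \<noteq> 0" for k
    using that by (cases k) simp_all
  hence "matrix_exp (0 :: complex^'n^'n) = (\<Sum>k\<in>{0}. (1 / fact k) *\<^sub>R mpow 0 k)"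
    unfolding matrix_exp_mpow by (intro suminf_finite) auto
  thus ?thesis by simp
qed

lemma bounded_linear_component2: "bounded_linear (\<lambda>A::complex^'n^'n. A $ i $ j)"
  using bounded_linear_compose[OF bounded_linear_vec_nth bounded_linear_vec_nth] .

lemma matrix_exp_component:
  "matrix_exp (t *\<^sub>R X) $ i $ j = (\<Sum>k. (mpow X k $ i $ j / fact k) * complex_of_real t ^ k)"
proof -
  have "matrix_exp (t *\<^sub>R X) $ i $ j = (\<Sum>k. ((1 / fact k) *\<^sub>R mpow (t *\<^sub>R X) k) $ i $ j)"
    unfolding matrix_exp_mpow
    by (rule bounded_linear.suminf[OF bounded_linear_component2 summable_exp_series])
  thus ?thesis
    unfolding mpow_scaleR vector_scaleR_component
    by (simp add: scaleR_conv_of_real[where 'a = complex] mult_ac)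
qed

lemma has_vector_derivative_matrix:
  fixes f :: "real \<Rightarrow> complex^'n^'n"
  assumes "\<And>i j. ((\<lambda>t. f t $ i $ j) has_vector_derivative D $ i $ j) (at t)"
  shows "(f has_vector_derivative D) (at t)"
  unfolding has_vector_derivative_def
proof (subst has_derivative_componentwise_within, rule ballI)
  fix b :: "complex^'n^'n" assume "b \<in> Basis"
  then obtain i u where u: "b = axis i u" "u \<in> Basis" unfolding Basis_vec_def by blast
  then obtain j c where "u = axis j c" unfolding Basis_vec_def by blast
  with u have b: "b = axis i (axis j c)" by simp
  have "((\<lambda>t. inner (f t $ i $ j) c) has_derivative (\<lambda>h. inner (h *\<^sub>R (D $ i $ j)) c)) (at t)"
    using assms[of i j] unfolding has_vector_derivative_def
    by (intro has_derivative_inner_left)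
  thus "((\<lambda>x. inner (f x) b) has_derivative (\<lambda>x. inner (x *\<^sub>R D) b)) (at t)"
    unfolding b inner_axis by simp
qed

text \<open>Each entry of the exponential is an everywhere convergent power series, which may be
  differentiated term by term.\<close>

lemma matrix_exp_has_derivative:
  "((\<lambda>t. matrix_exp (t *\<^sub>R X)) has_vector_derivative X ** matrix_exp (t *\<^sub>R X)) (at t)"
proof (rule has_vector_derivative_matrix)
  fix i j
  let ?c = "\<lambda>k. mpow X k $ i $ j / fact k"
  have summ: "summable (\<lambda>k. ?c k * z ^ k)" for z
  proof (rule summable_comparison_test'[OF summable_exp_norms[of "cmod z" X]])
    fix k :: nat
    have "cmod (mpow X k $ i $ j) \<le> norm (mpow X k)"
      by (rule order_trans[OF Finite_Cartesian_Product.norm_nth_le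
            Finite_Cartesian_Product.norm_nth_le])
    thus "norm (?c k * z ^ k) \<le> norm (mpow X k) / fact k * cmod z ^ k"
      by (simp add: norm_mult norm_divide norm_power mult_right_mono divide_right_mono)
  qed simp
  have "((\<lambda>z. \<Sum>k. ?c k * z ^ k) has_field_derivative (\<Sum>k. diffs ?c k * complex_of_real t ^ k))
      (at (complex_of_real t))"
    by (rule termdiffs_strong_converges_everywhere[OF summ])
  hence "((\<lambda>t. \<Sum>k. ?c k * complex_of_real t ^ k) has_vector_derivative
      (\<Sum>k. diffs ?c k * complex_of_real t ^ k)) (at t)"
    by (rule has_vector_derivative_real_field)
  moreover have "(\<Sum>k. diffs ?c k * complex_of_real t ^ k) = (X ** matrix_exp (t *\<^sub>R X)) $ i $ j"
  proof -
    have bl: "bounded_linear (\<lambda>Y. (X ** Y) $ i $ j)"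
      by (rule bounded_linear_compose[OF bounded_linear_component2 mmult.bounded_linear_right])
    have "diffs ?c k = mpow X (Suc k) $ i $ j / fact k" for k
      unfolding diffs_def by (simp add: field_simps del: of_nat_Suc mpow_Suc)
    moreover have "(X ** matrix_exp (t *\<^sub>R X)) $ i $ j
        = (\<Sum>k. (X ** ((1 / fact k) *\<^sub>R mpow (t *\<^sub>R X) k)) $ i $ j)"
      unfolding matrix_exp_mpow
      by (rule bounded_linear.suminf[OF bl summable_exp_series])
    ultimately show ?thesis
      unfolding mpow_scaleR mmult.scaleR_right vector_scaleR_component
      by (simp add: scaleR_conv_of_real[where 'a = complex] mult_ac)
  qed
  ultimately show "((\<lambda>t. matrix_exp (t *\<^sub>R X) $ i $ j) has_vector_derivative
      (X ** matrix_exp (t *\<^sub>R X)) $ i $ j) (at t)"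
    unfolding matrix_exp_component by simp
qed

text \<open>A solution of \<open>Y' = [Z, Y]\<close> is carried along by conjugation with the one-parameter group.\<close>

lemma matrix_exp_flow:
  fixes Y :: "real \<Rightarrow> complex^'n^'n"
  assumes "\<And>t. (Y has_vector_derivative lie_bracket Z (Y t)) (at t)"
  shows "matrix_exp (- (t *\<^sub>R Z)) ** (Y t ** matrix_exp (t *\<^sub>R Z)) = Y 0"
proof -
  let ?E = "\<lambda>t. matrix_exp (t *\<^sub>R Z)" and ?F = "\<lambda>t. matrix_exp (t *\<^sub>R (- Z))"
  have E: "(?E has_vector_derivative Z ** ?E t) (at t)" for t
    by (rule matrix_exp_has_derivative)
  have F: "(?F has_vector_derivative - (?F t ** Z)) (at t)" for t
  proof -
    have "?F t ** (- Z) = (- Z) ** ?F t" by (rule matrix_exp_commute)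
    thus ?thesis
      using matrix_exp_has_derivative[of "- Z" t] by (simp only: mmult.minus_right)
  qed
  have YE: "((\<lambda>t. Y t ** ?E t) has_vector_derivative
      Y t ** (Z ** ?E t) + lie_bracket Z (Y t) ** ?E t) (at t)" for t
    by (rule mmult.has_vector_derivative[OF assms E])
  have "((\<lambda>t. ?F t ** (Y t ** ?E t)) has_vector_derivative
      ?F t ** (Y t ** (Z ** ?E t) + lie_bracket Z (Y t) ** ?E t)
      + (- (?F t ** Z)) ** (Y t ** ?E t)) (at t)" for t
    by (rule mmult.has_vector_derivative[OF F YE])
  moreover have "?F t ** (Y t ** (Z ** ?E t) + lie_bracket Z (Y t) ** ?E t)
      + (- (?F t ** Z)) ** (Y t ** ?E t) = 0" for t
    by (simp add: lie_bracket_def mmult.add_right mmult.diff_left mmult.diff_right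
        mmult.minus_left matrix_mul_assoc)
  ultimately have "((\<lambda>t. ?F t ** (Y t ** ?E t)) has_derivative (\<lambda>h. 0)) (at t within UNIV)" for t
    by (simp add: has_vector_derivative_def)
  then obtain c where "\<forall>t\<in>UNIV. ?F t ** (Y t ** ?E t) = c"
    using has_derivative_zero_constant[of UNIV "\<lambda>t. ?F t ** (Y t ** ?E t)"] by blast
  hence "?F t ** (Y t ** ?E t) = ?F 0 ** (Y 0 ** ?E 0)" by (simp only: UNIV_I)
  thus ?thesis by simp
qed

lemma matrix_exp_minus:
  "matrix_exp (- Z) ** matrix_exp Z = mat 1" "matrix_exp Z ** matrix_exp (- Z) = mat 1"
proof -
  have *: "matrix_exp (- Z) ** matrix_exp Z = mat 1" for Z :: "complex^'n^'n"
    using matrix_exp_flow[of "\<lambda>_. mat 1" Z 1] by (simp add: lie_bracket_def)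
  show "matrix_exp (- Z) ** matrix_exp Z = mat 1" by (rule *)
  show "matrix_exp Z ** matrix_exp (- Z) = mat 1" using *[of "- Z"] by simp
qed

lemma matrix_inv_exp: "matrix_inv (matrix_exp Z) = matrix_exp (- Z)"
  by (rule matrix_inv_eq) (rule matrix_exp_minus)+

lemma bounded_linear_lie_bracket: "bounded_linear (lie_bracket (Z :: complex^'n^'n))"
  unfolding lie_bracket_def
  by (intro bounded_linear_sub mmult.bounded_linear_right mmult.bounded_linear_left)

text \<open>\<open>Ad (exp Z) = exp (ad Z)\<close>, for arguments on which \<open>ad Z\<close> is nilpotent.\<close>

lemma matrix_exp_Ad:
  fixes X Z :: "complex^'n^'n"
  assumes "(lie_bracket Z ^^ m) X = 0"
  shows "matrix_exp Z ** X ** matrix_exp (- Z)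
    = (\<Sum>j<m. (1 / fact j) *\<^sub>R (lie_bracket Z ^^ j) X)"
proof -
  define Y where "Y k t = (\<Sum>j<k. (t ^ j / fact j) *\<^sub>R (lie_bracket Z ^^ j) X)" for k and t :: real
  interpret ad: bounded_linear "lie_bracket Z" by (rule bounded_linear_lie_bracket)
  have "(Y (Suc k) has_vector_derivative lie_bracket Z (Y k t)) (at t)" for k t
  proof (induction k)
    case 0
    show ?case by (simp add: Y_def[abs_def] ad.zero)
  next
    case (Suc k)
    have "((\<lambda>t::real. t ^ Suc k / fact (Suc k)) has_real_derivative
        (real (Suc k) * t ^ k) / fact (Suc k)) (at t)"
      by (rule derivative_eq_intros refl | simp)+
    hence "((\<lambda>t::real. t ^ Suc k / fact (Suc k)) has_real_derivative t ^ k / fact k) (at t)"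
      by simp
    hence "((\<lambda>t. (t ^ Suc k / fact (Suc k)) *\<^sub>R (lie_bracket Z ^^ Suc k) X) has_vector_derivative
        (t ^ k / fact k) *\<^sub>R (lie_bracket Z ^^ Suc k) X) (at t)"
      using has_vector_derivative_scaleR[OF _ has_vector_derivative_const] by fastforce
    from has_vector_derivative_add[OF Suc this] show ?case
      by (simp add: Y_def[abs_def] ad.add ad.scaleR)
  qed
  moreover have "Y (Suc m) = Y m" by (simp add: Y_def[abs_def] assms)
  ultimately have "(Y m has_vector_derivative lie_bracket Z (Y m t)) (at t)" for t by metis
  from matrix_exp_flow[of "Y m" Z 1, OF this]
  have eq: "matrix_exp (- Z) ** (Y m 1 ** matrix_exp Z) = Y m 0" by simp
  have Y0: "Y m 0 = X"
  proof (cases m)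
    case (Suc k)
    have "Y m 0 = (\<Sum>j\<in>{0}. (0 ^ j / fact j) *\<^sub>R (lie_bracket Z ^^ j) X)"
      unfolding Y_def by (rule sum.mono_neutral_right) (use Suc in auto)
    thus ?thesis by simp
  qed (use assms in \<open>simp add: Y_def\<close>)
  have "matrix_exp Z ** X ** matrix_exp (- Z)
      = (matrix_exp Z ** matrix_exp (- Z)) ** Y m 1 ** (matrix_exp Z ** matrix_exp (- Z))"
    unfolding Y0[symmetric] eq[symmetric] by (simp only: matrix_mul_assoc)
  thus ?thesis by (simp add: matrix_exp_minus Y_def)
qed

section \<open>Weights of a Cartan subalgebra\<close>

lemma clinear_lie_bracket: "clinear (lie_bracket X)"
  by (rule clinearI)
    (simp_all add: lie_bracket_def mmult.add_left mmult.add_right cscale_mult_left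
      cscale_mult_right cmat.scale_right_diff_distrib)

lemma clinear_lie_bracket_left: "clinear (\<lambda>X. lie_bracket X Y)"
  by (rule clinearI)
    (simp_all add: lie_bracket_def mmult.add_left mmult.add_right cscale_mult_left
      cscale_mult_right cmat.scale_right_diff_distrib)

lemmas lie_bracket_linear =
  clinear_add[OF clinear_lie_bracket] clinear_scale[OF clinear_lie_bracket]
  clinear_diff[OF clinear_lie_bracket] clinear_0[OF clinear_lie_bracket]
  clinear_add[OF clinear_lie_bracket_left] clinear_scale[OF clinear_lie_bracket_left]
  clinear_diff[OF clinear_lie_bracket_left] clinear_0[OF clinear_lie_bracket_left]

lemma lie_bracket_anti: "lie_bracket X Y = - lie_bracket Y X"
  by (simp add: lie_bracket_def)

lemma lie_bracket_jacobi:
  "lie_bracket X (lie_bracket Y Z) = lie_bracket (lie_bracket X Y) Z + lie_bracket Y (lie_bracket X Z)"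
  by (simp add: lie_bracket_def mmult.diff_left mmult.diff_right matrix_mul_assoc)

text \<open>Eigenvectors of a diagonalizable map only involve basis vectors with the same eigenvalue;
  this describes eigenspaces by coefficients.\<close>

lemma eigenbasis_support:
  assumes C: "finite C" "cmat.independent C" and T: "clinear T"
    and ev: "\<And>e. e \<in> C \<Longrightarrow> T e = l e *\<^sub>C e"
    and x: "x \<in> cmat.span C" "T x = c *\<^sub>C x" and e: "e \<in> C" "cmat.representation C x e \<noteq> 0"
  shows "l e = c"
proof -
  let ?r = "cmat.representation C"
  have "(\<Sum>a\<in>C. ?r x a *\<^sub>C a) = x"
    using basis_expansion[OF C refl x(1)] .
  hence "T x = (\<Sum>a\<in>C. ?r x a *\<^sub>C T a)"
    using clinear_sum[OF T, of "\<lambda>a. ?r x a *\<^sub>C a" C] by (simp add: clinear_scale[OF T])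
  also have "\<dots> = (\<Sum>a\<in>C. (l a * ?r x a) *\<^sub>C a)"
    by (intro sum.cong refl) (simp add: ev mult.commute)
  finally have "T x = (\<Sum>a\<in>C. (l a * ?r x a) *\<^sub>C a)" .
  moreover have "?r (\<Sum>a\<in>C. (l a * ?r x a) *\<^sub>C a) e = (\<Sum>a\<in>C. (l a * ?r x a) * ?r a e)"
    using C(2) by (simp add: cmat.representation_sum cmat.representation_scale
        cmat.span_base cmat.span_scale)
  moreover have "(\<Sum>a\<in>C. (l a * ?r x a) * ?r a e) = (\<Sum>a\<in>C. if a = e then l a * ?r x a else 0)"
    using C(2) by (intro sum.cong refl) (simp add: cmat.representation_basis)
  ultimately have "?r (T x) e = l e * ?r x e"
    using C(1) e(1) by (simp add: sum.delta)
  moreover have "?r (T x) e = c * ?r x e"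
    using x C(2) by (simp add: cmat.representation_scale)
  ultimately show ?thesis using e(2) by simp
qed

locale cartan_pair =
  fixes L h :: "(complex^'n^'n) set"
  assumes simple: "simple_lie_algebra L"
    and cartan: "cartan_subalgebra L h"
begin

lemma L_subspace: "cmat.subspace L"
  and L_bracket: "X \<in> L \<Longrightarrow> Y \<in> L \<Longrightarrow> lie_bracket X Y \<in> L"
  and L_nonabelian: "\<exists>X\<in>L. \<exists>Y\<in>L. lie_bracket X Y \<noteq> 0"
  and L_ideal: "lie_ideal I L \<Longrightarrow> I = {0} \<or> I = L"
  using simple unfolding simple_lie_algebra_def by blast+

lemma h_L: "X \<in> h \<Longrightarrow> X \<in> L"
  and h_subspace: "cmat.subspace h"
  and h_commute: "X \<in> h \<Longrightarrow> Y \<in> h \<Longrightarrow> lie_bracket X Y = 0"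
  and h_maximal: "X \<in> L \<Longrightarrow> (\<And>Y. Y \<in> h \<Longrightarrow> lie_bracket Y X = 0) \<Longrightarrow> X \<in> h"
  and h_diagonal: "Y \<in> h \<Longrightarrow> cmat.span {X \<in> L. \<exists>c. lie_bracket Y X = c *\<^sub>C X} = L"
  using cartan unfolding cartan_subalgebra_def by blast+

lemma span_eigen_basis:
  assumes "J \<subseteq> L" "cmat.span J = L"
  obtains C where "C \<subseteq> J" "finite C" "cmat.independent C" "cmat.span C = L"
proof -
  obtain C where C: "C \<subseteq> J" "cmat.independent C" "J \<subseteq> cmat.span C"
    using cmat.maximal_independent_subset[of J] by metis
  have "cmat.span C \<subseteq> L" using cmat.span_mono[OF C(1)] assms(2) by simp
  moreover have "L \<subseteq> cmat.span C"
    using cmat.span_minimal[OF C(3) cmat.subspace_span] assms(2) by simp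
  ultimately show ?thesis using that[OF C(1) independent_finite[OF C(2)] C(2)] by simp
qed

text \<open>A joint eigenvector of commuting diagonalizable operators splits into joint eigenvectors
  when one more such operator is added, because its components for the new operator are
  linearly independent and the old operators preserve them.\<close>

lemma joint_eigenvectors_span:
  assumes "set Ys \<subseteq> h"
  shows "cmat.span {X \<in> L. \<forall>Y\<in>set Ys. \<exists>c. lie_bracket Y X = c *\<^sub>C X} = L"
  using assms
proof (induction Ys)
  case Nil
  show ?case using L_subspace by (simp add: cmat.span_eq_iff[THEN iffD2])
next
  case (Cons Y Ys)
  let ?J = "{X \<in> L. \<forall>Y\<in>set Ys. \<exists>c. lie_bracket Y X = c *\<^sub>C X}"
  let ?J' = "{X \<in> L. \<forall>Y\<in>set (Y # Ys). \<exists>c. lie_bracket Y X = c *\<^sub>C X}"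
  have Y: "Y \<in> h" and Ys: "set Ys \<subseteq> h" using Cons.prems by auto
  obtain C where C: "C \<subseteq> {X \<in> L. \<exists>c. lie_bracket Y X = c *\<^sub>C X}" "finite C"
    "cmat.independent C" "cmat.span C = L"
    using span_eigen_basis[OF _ h_diagonal[OF Y]] by blast
  have "\<forall>e\<in>C. \<exists>c. lie_bracket Y e = c *\<^sub>C e" using C(1) by blast
  then obtain l where l: "\<forall>e\<in>C. lie_bracket Y e = l e *\<^sub>C e" by metis
  let ?r = "cmat.representation C"
  have CL: "C \<subseteq> L" using C(1) by blast
  have "v \<in> cmat.span ?J'" if v: "v \<in> ?J" for v
  proof -
    define p where "p c = (\<Sum>e\<in>{e\<in>C. l e = c}. ?r v e *\<^sub>C e)" for c
    have vL: "v \<in> L" using v by blast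
    have pL: "p c \<in> L" for c
      unfolding p_def using CL L_subspace by (auto intro!: cmat.subspace_sum cmat.subspace_scale)
    have Yp: "lie_bracket Y (p c) = c *\<^sub>C p c" for c
      unfolding p_def clinear_sum[OF clinear_lie_bracket] cmat.scale_sum_right
      using l by (intro sum.cong refl) (simp add: lie_bracket_linear mult.commute)
    have vp: "v = (\<Sum>c\<in>l ` C. p c)"
      unfolding p_def using sum.image_gen[OF C(2), of "\<lambda>e. ?r v e *\<^sub>C e" l]
        basis_expansion[OF C(2,3,4) vL] by simp
    have "p c \<in> ?J'" for c
    proof -
      have "\<exists>a. lie_bracket Z (p c) = a *\<^sub>C p c" if Z: "Z \<in> set Ys" for Z
      proof -
        obtain m where m: "lie_bracket Z v = m *\<^sub>C v" using v Z by blast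
        define w where "w c = lie_bracket Z (p c) - m *\<^sub>C p c" for c
        have Zh: "Z \<in> h" using Z Ys by blast
        have wL: "w c \<in> L" for c
          unfolding w_def using L_subspace pL L_bracket[OF h_L[OF Zh]]
          by (simp add: cmat.subspace_diff cmat.subspace_scale)
        have Yw: "lie_bracket Y (w c) = c *\<^sub>C w c" for c
          unfolding w_def using lie_bracket_jacobi[of Y Z "p c"] h_commute[OF Y Zh]
          by (simp add: lie_bracket_linear Yp cmat.scale_right_diff_distrib mult.commute)
        have "(\<Sum>c\<in>l ` C. w c) = lie_bracket Z v - m *\<^sub>C v"
          unfolding w_def sum_subtractf vp clinear_sum[OF clinear_lie_bracket]
            cmat.scale_sum_right ..
        hence w0: "(\<Sum>c\<in>l ` C. w c) = 0" by (simp add: m)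
        have supp: "?r (w c) e = 0" if "e \<in> C" "l e \<noteq> c" for c e
          using eigenbasis_support[OF C(2,3) clinear_lie_bracket, of Y l "w c" c e] l that
            C(4) wL Yw by auto
        have "?r (w c) e = 0" if e: "e \<in> C" for e
        proof -
          have "?r (\<Sum>c\<in>l ` C. w c) e = (\<Sum>c\<in>l ` C. ?r (w c) e)"
            using C(3,4) wL by (simp add: cmat.representation_sum)
          also have "\<dots> = (\<Sum>c\<in>l ` C. if c = l e then ?r (w (l e)) e else 0)"
            by (intro sum.cong refl) (use supp e in auto)
          also have "\<dots> = ?r (w (l e)) e" using C(2) e by simp
          finally have "?r (w (l e)) e = 0" by (simp add: w0 cmat.representation_zero)
          thus ?thesis using supp[OF e, of c] by (cases "l e = c") auto
        qed
        hence "w c = 0" using basis_expansion[OF C(2,3,4) wL[of c]] by simp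
        thus ?thesis unfolding w_def by auto
      qed
      thus ?thesis using pL Yp by auto
    qed
    thus ?thesis unfolding vp by (intro cmat.span_sum cmat.span_base)
  qed
  hence "cmat.span ?J \<subseteq> cmat.span ?J'"
    by (intro cmat.span_minimal cmat.subspace_span subsetI)
  moreover have "cmat.span ?J' \<subseteq> L"
    using L_subspace by (intro cmat.span_minimal) auto
  ultimately show ?case using Cons.IH[OF Ys] by blast
qed

lemma weight_basis_exists:
  "\<exists>E. finite E \<and> cmat.independent E \<and> cmat.span E = L \<and>
    (\<forall>e\<in>E. \<forall>Y\<in>h. \<exists>c. lie_bracket Y e = c *\<^sub>C e)"
proof -
  obtain H where H: "finite H" "H \<subseteq> h" "cmat.independent H" "cmat.span H = h"
    using obtain_cbasis[OF h_subspace] .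
  obtain Ys where Ys: "set Ys = H" using H(1) finite_list by blast
  obtain E where E: "E \<subseteq> {X \<in> L. \<forall>Y\<in>set Ys. \<exists>c. lie_bracket Y X = c *\<^sub>C X}" "finite E"
    "cmat.independent E" "cmat.span E = L"
    using span_eigen_basis[OF _ joint_eigenvectors_span[of Ys]] Ys H(2) by blast
  have "\<exists>c. lie_bracket Y e = c *\<^sub>C e" if e: "e \<in> E" and Y: "Y \<in> h" for e Y
  proof -
    have "Y \<in> cmat.span H" using Y H(4) by simp
    hence "Y \<in> {Y. \<exists>c. lie_bracket Y e = c *\<^sub>C e}"
    proof (rule cmat.span_induct[where P = "\<lambda>Y. Y \<in> {Y. \<exists>c. lie_bracket Y e = c *\<^sub>C e}"])
      have "\<exists>c. lie_bracket (Y + Z) e = c *\<^sub>C e"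
        if "lie_bracket Y e = a *\<^sub>C e" "lie_bracket Z e = b *\<^sub>C e" for Y Z a b
        using that by (intro exI[of _ "a + b"]) (simp add: lie_bracket_linear cmat.scale_left_distrib)
      moreover have "\<exists>c. lie_bracket (x *\<^sub>C Y) e = c *\<^sub>C e" if "lie_bracket Y e = a *\<^sub>C e" for x Y a
        using that by (intro exI[of _ "x * a"]) (simp add: lie_bracket_linear)
      moreover have "\<exists>c. lie_bracket 0 e = c *\<^sub>C e"
        by (intro exI[of _ 0]) (simp add: lie_bracket_linear)
      ultimately show "cmat.subspace {Y. Y \<in> {Y. \<exists>c. lie_bracket Y e = c *\<^sub>C e}}"
        unfolding cmat.subspace_def by blast
    qed (use E(1) e Ys in blast)
    thus ?thesis by blast
  qed
  thus ?thesis using E by blast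
qed

definition weight_basis :: "(complex^'n^'n) set"
  where "weight_basis = (SOME E. finite E \<and> cmat.independent E \<and> cmat.span E = L \<and>
    (\<forall>e\<in>E. \<forall>Y\<in>h. \<exists>c. lie_bracket Y e = c *\<^sub>C e))"

abbreviation E where "E \<equiv> weight_basis"

lemma E_finite: "finite E"
  and E_independent: "cmat.independent E"
  and E_span: "cmat.span E = L"
  and E_eigen: "e \<in> E \<Longrightarrow> Y \<in> h \<Longrightarrow> \<exists>c. lie_bracket Y e = c *\<^sub>C e"
  using someI_ex[OF weight_basis_exists] unfolding weight_basis_def by blast+

lemma E_L: "e \<in> E \<Longrightarrow> e \<in> L"
  using E_span cmat.span_base by blast

lemma E_nonzero: "e \<in> E \<Longrightarrow> e \<noteq> 0"
  using E_independent cmat.dependent_zero by blast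

text \<open>Weights vanish outside the Cartan subalgebra, like roots, so that a weight is determined by its
  values there.\<close>

definition weight :: "complex^'n^'n \<Rightarrow> complex^'n^'n \<Rightarrow> complex"
  where "weight e Y = (if Y \<in> h then SOME c. lie_bracket Y e = c *\<^sub>C e else 0)"

lemma weight: "e \<in> E \<Longrightarrow> Y \<in> h \<Longrightarrow> lie_bracket Y e = weight e Y *\<^sub>C e"
  using someI_ex[OF E_eigen[of e Y]] by (simp add: weight_def)

lemma weight_outside: "Y \<notin> h \<Longrightarrow> weight e Y = 0"
  by (simp add: weight_def)

lemma weight_add: "e \<in> E \<Longrightarrow> X \<in> h \<Longrightarrow> Y \<in> h \<Longrightarrow> weight e (X + Y) = weight e X + weight e Y"
proof -
  assume *: "e \<in> E" "X \<in> h" "Y \<in> h"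
  hence "X + Y \<in> h" using h_subspace by (simp add: cmat.subspace_add)
  hence "weight e (X + Y) *\<^sub>C e = (weight e X + weight e Y) *\<^sub>C e"
    using * weight[of e] by (simp add: lie_bracket_linear cmat.scale_left_distrib flip: weight)
  thus ?thesis using E_nonzero[OF *(1)] by simp
qed

lemma weight_scale: "e \<in> E \<Longrightarrow> Y \<in> h \<Longrightarrow> weight e (c *\<^sub>C Y) = c * weight e Y"
proof -
  assume *: "e \<in> E" "Y \<in> h"
  hence "c *\<^sub>C Y \<in> h" using h_subspace by (simp add: cmat.subspace_scale)
  hence "weight e (c *\<^sub>C Y) *\<^sub>C e = lie_bracket (c *\<^sub>C Y) e" using weight[of e] * by simp
  also have "\<dots> = (c * weight e Y) *\<^sub>C e" using weight[of e Y] * by (simp add: lie_bracket_linear)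
  finally show ?thesis using E_nonzero[OF *(1)] by simp
qed

abbreviation coef :: "complex^'n^'n \<Rightarrow> complex^'n^'n \<Rightarrow> complex"
  where "coef \<equiv> cmat.representation E"

lemma coef_add: "X \<in> L \<Longrightarrow> Y \<in> L \<Longrightarrow> coef (X + Y) e = coef X e + coef Y e"
  and coef_scale: "X \<in> L \<Longrightarrow> coef (c *\<^sub>C X) e = c * coef X e"
  and coef_diff: "X \<in> L \<Longrightarrow> Y \<in> L \<Longrightarrow> coef (X - Y) e = coef X e - coef Y e"
  and coef_zero: "coef 0 e = 0"
  and coef_basis: "f \<in> E \<Longrightarrow> coef f e = (if e = f then 1 else 0)"
  using E_independent E_span
  by (simp_all add: cmat.representation_add cmat.representation_scale cmat.representation_diff
      cmat.representation_zero cmat.representation_basis)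

lemma coef_expansion: "X \<in> L \<Longrightarrow> (\<Sum>e\<in>E. coef X e *\<^sub>C e) = X"
  by (rule basis_expansion[OF E_finite E_independent E_span])

text \<open>The sum of the weight spaces whose weights satisfy a predicate. The Cartan subalgebra, the
  root spaces, the Borel and parabolic subalgebras and their nilradicals all have this form.\<close>

definition wsp :: "((complex^'n^'n \<Rightarrow> complex) \<Rightarrow> bool) \<Rightarrow> (complex^'n^'n) set"
  where "wsp P = cmat.span {e \<in> E. P (weight e)}"

lemma wsp_subspace: "cmat.subspace (wsp P)"
  by (simp add: wsp_def)

lemma wsp_base: "e \<in> E \<Longrightarrow> P (weight e) \<Longrightarrow> e \<in> wsp P"
  by (simp add: wsp_def cmat.span_base)

lemma wsp_iff: "X \<in> wsp P \<longleftrightarrow> X \<in> L \<and> (\<forall>e\<in>E. coef X e \<noteq> 0 \<longrightarrow> P (weight e))"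
proof
  assume "X \<in> wsp P"
  thus "X \<in> L \<and> (\<forall>e\<in>E. coef X e \<noteq> 0 \<longrightarrow> P (weight e))"
    unfolding wsp_def
  proof (rule cmat.span_induct)
    show "cmat.subspace {X. X \<in> L \<and> (\<forall>e\<in>E. coef X e \<noteq> 0 \<longrightarrow> P (weight e))}"
      unfolding cmat.subspace_def using L_subspace
      by (auto simp: coef_add coef_scale coef_zero cmat.subspace_0 cmat.subspace_add
          cmat.subspace_scale)
  qed (auto simp: E_L coef_basis split: if_splits)
next
  assume *: "X \<in> L \<and> (\<forall>e\<in>E. coef X e \<noteq> 0 \<longrightarrow> P (weight e))"
  have "coef X e *\<^sub>C e \<in> wsp P" if "e \<in> E" for e
    using * that wsp_base[of e P] wsp_subspace[of P]
    by (cases "coef X e = 0") (simp_all add: cmat.subspace_0 cmat.subspace_scale)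
  hence "(\<Sum>e\<in>E. coef X e *\<^sub>C e) \<in> wsp P"
    by (rule cmat.subspace_sum[OF wsp_subspace])
  thus "X \<in> wsp P" using * coef_expansion by simp
qed

lemma wsp_L: "X \<in> wsp P \<Longrightarrow> X \<in> L"
  by (simp add: wsp_iff)

lemma wsp_mono: "X \<in> wsp P \<Longrightarrow> (\<And>e. e \<in> E \<Longrightarrow> P (weight e) \<Longrightarrow> Q (weight e)) \<Longrightarrow> X \<in> wsp Q"
  by (auto simp: wsp_iff)

lemma wsp_cong: "(\<And>e. e \<in> E \<Longrightarrow> P (weight e) \<longleftrightarrow> Q (weight e)) \<Longrightarrow> wsp P = wsp Q"
  by (auto simp: wsp_iff)

lemma wsp_disjoint:
  assumes "X \<in> wsp P" "X \<in> wsp Q" "\<And>e. e \<in> E \<Longrightarrow> P (weight e) \<Longrightarrow> Q (weight e) \<Longrightarrow> False"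
  shows "X = 0"
proof -
  have "coef X e = 0" if "e \<in> E" for e using assms that by (auto simp: wsp_iff)
  thus ?thesis using coef_expansion[of X] assms(1) by (simp add: wsp_iff)
qed

lemma wsp_span_Un: "cmat.span (wsp P \<union> wsp Q) = wsp (\<lambda>\<alpha>. P \<alpha> \<or> Q \<alpha>)"
proof
  show "cmat.span (wsp P \<union> wsp Q) \<subseteq> wsp (\<lambda>\<alpha>. P \<alpha> \<or> Q \<alpha>)"
    by (rule cmat.span_minimal[OF _ wsp_subspace]) (auto elim!: wsp_mono)
  show "wsp (\<lambda>\<alpha>. P \<alpha> \<or> Q \<alpha>) \<subseteq> cmat.span (wsp P \<union> wsp Q)"
    unfolding wsp_def[of "\<lambda>\<alpha>. P \<alpha> \<or> Q \<alpha>"]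
    by (rule cmat.span_minimal) (auto intro!: cmat.span_base wsp_base)
qed

text \<open>The projection onto \<open>wsp P\<close> along the sum of the other weight spaces.\<close>

definition pr :: "((complex^'n^'n \<Rightarrow> complex) \<Rightarrow> bool) \<Rightarrow> complex^'n^'n \<Rightarrow> complex^'n^'n"
  where "pr P X = (\<Sum>e\<in>{e\<in>E. P (weight e)}. coef X e *\<^sub>C e)"

lemma pr_wsp: "pr P X \<in> wsp P"
  unfolding pr_def wsp_def by (intro cmat.span_sum cmat.span_scale cmat.span_base) simp

lemma coef_pr: "e \<in> E \<Longrightarrow> coef (pr P X) e = (if P (weight e) then coef X e else 0)"
proof -
  assume e: "e \<in> E"
  have "coef (pr P X) e = (\<Sum>f\<in>{e\<in>E. P (weight e)}. coef (coef X f *\<^sub>C f) e)"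
    unfolding pr_def using E_span
    by (subst cmat.representation_sum[OF E_independent]) (auto intro: cmat.span_scale cmat.span_base)
  also have "\<dots> = (\<Sum>f\<in>{e\<in>E. P (weight e)}. if f = e then coef X f else 0)"
    by (intro sum.cong refl) (auto simp: coef_scale E_L coef_basis)
  also have "\<dots> = (if P (weight e) then coef X e else 0)"
    using e E_finite by (simp add: sum.delta)
  finally show ?thesis .
qed

lemma pr_complement: "X \<in> L \<Longrightarrow> X - pr P X \<in> wsp (\<lambda>\<alpha>. \<not> P \<alpha>)"
  using L_subspace pr_wsp[of P X]
  by (auto simp: wsp_iff coef_diff coef_pr cmat.subspace_diff)

lemma pr_unique: "X \<in> wsp P \<Longrightarrow> Y - X \<in> wsp (\<lambda>\<alpha>. \<not> P \<alpha>) \<Longrightarrow> Y \<in> L \<Longrightarrow> pr P Y = X"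
proof -
  assume X: "X \<in> wsp P" "Y - X \<in> wsp (\<lambda>\<alpha>. \<not> P \<alpha>)" and Y: "Y \<in> L"
  have "pr P Y - X \<in> wsp P"
    using X(1) pr_wsp wsp_subspace by (simp add: cmat.subspace_diff)
  moreover have "(Y - X) - (Y - pr P Y) \<in> wsp (\<lambda>\<alpha>. \<not> P \<alpha>)"
    using X(2) pr_complement[OF Y] wsp_subspace by (blast intro: cmat.subspace_diff)
  hence "pr P Y - X \<in> wsp (\<lambda>\<alpha>. \<not> P \<alpha>)" by simp
  ultimately have "pr P Y - X = 0" by (rule wsp_disjoint) auto
  thus ?thesis by simp
qed

lemma eigenspace_eq_wsp:
  assumes "S \<subseteq> h"
  shows "{X \<in> L. \<forall>Y\<in>S. lie_bracket Y X = f Y *\<^sub>C X} = wsp (\<lambda>\<alpha>. \<forall>Y\<in>S. \<alpha> Y = f Y)" (is "?A = ?B")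
proof
  show "?A \<subseteq> ?B"
  proof
    fix X assume X: "X \<in> ?A"
    have "weight e Y = f Y" if "e \<in> E" "coef X e \<noteq> 0" "Y \<in> S" for e Y
      using eigenbasis_support[OF E_finite E_independent clinear_lie_bracket,
          of Y "\<lambda>e. weight e Y" X "f Y" e] X that assms E_span weight by auto
    thus "X \<in> ?B" using X by (auto simp: wsp_iff)
  qed
  show "?B \<subseteq> ?A"
    unfolding wsp_def
  proof (rule cmat.span_minimal)
    show "cmat.subspace ?A"
      using L_subspace by (auto simp: cmat.subspace_def lie_bracket_linear
          cmat.scale_right_distrib mult.commute)
    show "{e \<in> E. \<forall>Y\<in>S. weight e Y = f Y} \<subseteq> ?A"
      using assms by (auto simp: E_L weight subsetD)
  qed
qed

lemma h_eq_wsp: "h = wsp (\<lambda>\<alpha>. \<alpha> = (\<lambda>_. 0))"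
proof -
  have "h = {X \<in> L. \<forall>Y\<in>h. lie_bracket Y X = 0 *\<^sub>C X}"
    using h_L h_commute h_maximal by auto
  also have "\<dots> = wsp (\<lambda>\<alpha>. \<forall>Y\<in>h. \<alpha> Y = 0)" by (rule eigenspace_eq_wsp) simp
  also have "\<dots> = wsp (\<lambda>\<alpha>. \<alpha> = (\<lambda>_. 0))"
    by (rule wsp_cong) (use weight_outside in auto)
  finally show ?thesis .
qed

lemma h_iff: "X \<in> h \<longleftrightarrow> X \<in> wsp (\<lambda>\<alpha>. \<alpha> = (\<lambda>_. 0))"
  by (rule arg_cong[OF h_eq_wsp, of "\<lambda>S. X \<in> S"])

lemma root_space_eq_wsp:
  assumes "\<And>Y. Y \<notin> h \<Longrightarrow> \<alpha> Y = 0"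
  shows "root_space L h \<alpha> = wsp (\<lambda>\<beta>. \<beta> = \<alpha>)"
proof -
  have "root_space L h \<alpha> = wsp (\<lambda>\<beta>. \<forall>Y\<in>h. \<beta> Y = \<alpha> Y)"
    unfolding root_space_def by (rule eigenspace_eq_wsp) simp
  also have "\<dots> = wsp (\<lambda>\<beta>. \<beta> = \<alpha>)"
  proof (rule wsp_cong)
    fix e assume "e \<in> E"
    show "(\<forall>Y\<in>h. weight e Y = \<alpha> Y) \<longleftrightarrow> weight e = \<alpha>"
    proof
      assume *: "\<forall>Y\<in>h. weight e Y = \<alpha> Y"
      show "weight e = \<alpha>"
      proof
        fix Y show "weight e Y = \<alpha> Y"
          using * assms weight_outside by (cases "Y \<in> h") auto
      qed
    qed simp
  qed
  finally show ?thesis .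
qed

lemma wsp_nonzero: "X \<in> wsp P \<Longrightarrow> X \<noteq> 0 \<Longrightarrow> \<exists>e\<in>E. P (weight e)"
  using wsp_disjoint[of X P P] by blast

lemma roots_eq: "roots L h = weight ` E - {\<lambda>_. 0}"
proof (intro set_eqI iffI)
  fix \<alpha> assume \<alpha>: "\<alpha> \<in> roots L h"
  hence out: "\<And>Y. Y \<notin> h \<Longrightarrow> \<alpha> Y = 0" and nz: "\<alpha> \<noteq> (\<lambda>_. 0)" and rs: "root_space L h \<alpha> \<noteq> {0}"
    by (auto simp: roots_def)
  have eq: "root_space L h \<alpha> = wsp (\<lambda>\<beta>. \<beta> = \<alpha>)" by (rule root_space_eq_wsp) (rule out)
  have "0 \<in> root_space L h \<alpha>"
    unfolding eq by (rule cmat.subspace_0[OF wsp_subspace])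
  with rs obtain X where "X \<in> wsp (\<lambda>\<beta>. \<beta> = \<alpha>)" "X \<noteq> 0"
    unfolding eq by blast
  from wsp_nonzero[OF this] show "\<alpha> \<in> weight ` E - {\<lambda>_. 0}"
    using nz by auto
next
  fix \<alpha> assume "\<alpha> \<in> weight ` E - {\<lambda>_. 0}"
  then obtain e where e: "e \<in> E" "\<alpha> = weight e" "weight e \<noteq> (\<lambda>_. 0)" by auto
  then obtain Y where Y: "weight e Y \<noteq> 0" by auto
  hence "Y \<in> h" using weight_outside by blast
  moreover have "e \<in> root_space L h \<alpha>"
    using e wsp_base weight_outside by (subst root_space_eq_wsp) auto
  ultimately show "\<alpha> \<in> roots L h"
    unfolding roots_def using e Y weight_outside E_nonzero[OF e(1)] by blast
qed

lemma root_obtain_basis: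
  assumes "\<alpha> \<in> roots L h"
  obtains e where "e \<in> E" "weight e = \<alpha>" "\<alpha> \<noteq> (\<lambda>_. 0)"
  using assms unfolding roots_eq by auto

lemma wsp_bracket:
  assumes R: "\<And>\<alpha> \<beta>. P \<alpha> \<Longrightarrow> Q \<beta> \<Longrightarrow> R (\<lambda>Y. \<alpha> Y + \<beta> Y)"
    and X: "X \<in> wsp P" and Y: "Y \<in> wsp Q"
  shows "lie_bracket X Y \<in> wsp R"
proof -
  have basis: "lie_bracket e f \<in> wsp R" if e: "e \<in> E" "P (weight e)" and f: "f \<in> E" "Q (weight f)" for e f
  proof -
    let ?g = "\<lambda>Y. weight e Y + weight f Y"
    have "lie_bracket Y (lie_bracket e f) = ?g Y *\<^sub>C lie_bracket e f" if "Y \<in> h" for Y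
      unfolding lie_bracket_jacobi[of Y e f] weight[OF e(1) that] weight[OF f(1) that]
      by (simp add: lie_bracket_linear cmat.scale_left_distrib)
    hence "lie_bracket e f \<in> root_space L h ?g"
      unfolding root_space_def using e f E_L L_bracket by auto
    moreover have "root_space L h ?g = wsp (\<lambda>\<beta>. \<beta> = ?g)"
      by (rule root_space_eq_wsp) (simp add: weight_outside)
    ultimately have "lie_bracket e f \<in> wsp (\<lambda>\<beta>. \<beta> = ?g)" by simp
    thus ?thesis by (rule wsp_mono) (use R[OF e(2) f(2)] in simp)
  qed
  have "lie_bracket e Y \<in> wsp R" if "e \<in> E" "P (weight e)" for e
    by (rule span_induct_clinear[OF Y[unfolded wsp_def] clinear_lie_bracket wsp_subspace])
      (use basis that in auto)
  thus ?thesis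
    by (intro span_induct_clinear[OF X[unfolded wsp_def] clinear_lie_bracket_left wsp_subspace]) auto
qed

end

section \<open>The Killing form\<close>

context cartan_pair begin

abbreviation B where "B \<equiv> killing_form L"

lemma ad_L: "X \<in> L \<Longrightarrow> lie_bracket X ` L \<subseteq> L"
  using L_bracket by blast

lemma ad_ad_L: "X \<in> L \<Longrightarrow> Y \<in> L \<Longrightarrow> (\<lambda>Z. lie_bracket X (lie_bracket Y Z)) ` L \<subseteq> L"
  using L_bracket by blast

lemma clinear_ad_ad: "clinear (\<lambda>Z. lie_bracket X (lie_bracket Y Z))"
  by (rule clinearI) (simp_all add: lie_bracket_linear)

lemma killing_sym: "X \<in> L \<Longrightarrow> Y \<in> L \<Longrightarrow> B X Y = B Y X"
  unfolding killing_form_def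
  by (rule trace_on_commute[OF L_subspace clinear_lie_bracket ad_L clinear_lie_bracket ad_L])

lemma killing_add_left: "X \<in> L \<Longrightarrow> Y \<in> L \<Longrightarrow> Z \<in> L \<Longrightarrow> B (X + Y) Z = B X Z + B Y Z"
  unfolding killing_form_def lie_bracket_linear
  by (rule trace_on_add[OF L_subspace ad_ad_L ad_ad_L])

lemma killing_scale_left: "X \<in> L \<Longrightarrow> Z \<in> L \<Longrightarrow> B (c *\<^sub>C X) Z = c * B X Z"
  unfolding killing_form_def lie_bracket_linear
  by (rule trace_on_scale[OF L_subspace ad_ad_L])

lemma killing_add_right: "X \<in> L \<Longrightarrow> Y \<in> L \<Longrightarrow> Z \<in> L \<Longrightarrow> B X (Y + Z) = B X Y + B X Z"
  using killing_add_left[of Y Z X] killing_sym L_subspace by (simp add: cmat.subspace_add)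

lemma killing_scale_right: "X \<in> L \<Longrightarrow> Z \<in> L \<Longrightarrow> B X (c *\<^sub>C Z) = c * B X Z"
  using killing_scale_left[of Z X c] killing_sym L_subspace by (simp add: cmat.subspace_scale)

lemma killing_zero_left: "Z \<in> L \<Longrightarrow> B 0 Z = 0"
  using killing_scale_left[of 0 Z 0] L_subspace by (simp add: cmat.subspace_0)

lemma killing_zero_right: "Z \<in> L \<Longrightarrow> B Z 0 = 0"
  using killing_scale_right[of Z 0 0] L_subspace by (simp add: cmat.subspace_0)

lemma killing_diff_left: "X \<in> L \<Longrightarrow> Y \<in> L \<Longrightarrow> Z \<in> L \<Longrightarrow> B (X - Y) Z = B X Z - B Y Z"
  using killing_add_left[of "X - Y" Y Z] L_subspace by (simp add: cmat.subspace_diff)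

lemma killing_diff_right: "X \<in> L \<Longrightarrow> Y \<in> L \<Longrightarrow> Z \<in> L \<Longrightarrow> B X (Y - Z) = B X Y - B X Z"
  using killing_add_right[of X "Y - Z" Z] L_subspace by (simp add: cmat.subspace_diff)

lemma killing_invariant:
  assumes X: "X \<in> L" and Y: "Y \<in> L" and Z: "Z \<in> L"
  shows "B (lie_bracket X Y) Z = B X (lie_bracket Y Z)"
proof -
  let ?xyz = "\<lambda>W. lie_bracket X (lie_bracket Y (lie_bracket Z W))"
  let ?yxz = "\<lambda>W. lie_bracket Y (lie_bracket X (lie_bracket Z W))"
  let ?xzy = "\<lambda>W. lie_bracket X (lie_bracket Z (lie_bracket Y W))"
  have into: "?xyz ` L \<subseteq> L" "?yxz ` L \<subseteq> L" "?xzy ` L \<subseteq> L"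
    using X Y Z L_bracket by auto
  have "B (lie_bracket X Y) Z = trace_on L (\<lambda>W. ?xyz W - ?yxz W)"
    unfolding killing_form_def
    by (rule arg_cong[of _ _ "trace_on L"]) (simp add: lie_bracket_jacobi[of X Y])
  also have "\<dots> = trace_on L ?xyz - trace_on L ?yxz"
    by (rule trace_on_diff[OF L_subspace into(1,2)])
  also have "trace_on L ?yxz = trace_on L ?xzy"
    using trace_on_commute[OF L_subspace clinear_lie_bracket ad_L[OF Y] clinear_ad_ad ad_ad_L[OF X Z]] .
  also have "trace_on L ?xyz - trace_on L ?xzy = trace_on L (\<lambda>W. ?xyz W - ?xzy W)"
    by (rule trace_on_diff[OF L_subspace into(1,3), symmetric])
  also have "\<dots> = B X (lie_bracket Y Z)"
    unfolding killing_form_def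
    by (rule arg_cong[of _ _ "trace_on L"]) (simp add: lie_bracket_jacobi[of Y Z] lie_bracket_linear)
  finally show ?thesis .
qed

lemma killing_on_cartan:
  assumes "X \<in> h" "Y \<in> h"
  shows "B X Y = (\<Sum>e\<in>E. weight e X * weight e Y)"
  unfolding killing_form_def
  by (rule trace_on_eigenbasis[OF E_finite E_independent E_span clinear_ad_ad])
    (use assms in \<open>simp add: weight lie_bracket_linear mult.commute\<close>)

text \<open>On the string of weights through a given one in direction \<open>\<beta>\<close>, the element \<open>[x, y]\<close> acts as
  a commutator and so has trace \<open>0\<close>. This gives a linear relation between the weight and \<open>\<beta>\<close>
  with rational coefficients.\<close>

lemma weight_on_commutator_real:
  assumes x: "x \<in> wsp (\<lambda>\<alpha>. \<alpha> = \<beta>)" and y: "y \<in> wsp (\<lambda>\<alpha>. \<alpha> = (\<lambda>Y. - \<beta> Y))" and e0: "e0 \<in> E"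
  shows "\<exists>q::real. weight e0 (lie_bracket x y) = of_real q * \<beta> (lie_bracket x y)"
proof -
  define H where "H = lie_bracket x y"
  have H: "H \<in> h" unfolding H_def by (rule h_iff[THEN iffD2], rule wsp_bracket[OF _ x y]) auto
  define P where "P \<alpha> \<longleftrightarrow> (\<exists>k::int. \<alpha> H = weight e0 H + of_int k * \<beta> H)" for \<alpha> :: "complex^'n^'n \<Rightarrow> complex"
  let ?F = "{e \<in> E. P (weight e)}"
  have xP: "lie_bracket x ` wsp P \<subseteq> wsp P"
  proof (rule image_subsetI, rule wsp_bracket[OF _ x])
    fix \<alpha> \<gamma> :: "complex^'n^'n \<Rightarrow> complex" assume "\<alpha> = \<beta>" "P \<gamma>"
    then obtain k :: int where "\<gamma> H = weight e0 H + of_int k * \<beta> H" unfolding P_def by blast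
    thus "P (\<lambda>Y. \<alpha> Y + \<gamma> Y)"
      unfolding P_def \<open>\<alpha> = \<beta>\<close> by (intro exI[of _ "k + 1"]) (simp add: algebra_simps)
  qed
  have yP: "lie_bracket y ` wsp P \<subseteq> wsp P"
  proof (rule image_subsetI, rule wsp_bracket[OF _ y])
    fix \<alpha> \<gamma> :: "complex^'n^'n \<Rightarrow> complex" assume "\<alpha> = (\<lambda>Y. - \<beta> Y)" "P \<gamma>"
    then obtain k :: int where "\<gamma> H = weight e0 H + of_int k * \<beta> H" unfolding P_def by blast
    thus "P (\<lambda>Y. \<alpha> Y + \<gamma> Y)"
      unfolding P_def \<open>\<alpha> = (\<lambda>Y. - \<beta> Y)\<close>
      by (intro exI[of _ "k - 1"]) (simp add: algebra_simps)
  qed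
  have "trace_on (wsp P) (lie_bracket H)
      = trace_on (wsp P) (\<lambda>Z. lie_bracket x (lie_bracket y Z) - lie_bracket y (lie_bracket x Z))"
    unfolding H_def by (rule arg_cong[of _ _ "trace_on (wsp P)"]) (simp add: lie_bracket_jacobi[of x y])
  also have "\<dots> = trace_on (wsp P) (\<lambda>Z. lie_bracket x (lie_bracket y Z))
      - trace_on (wsp P) (\<lambda>Z. lie_bracket y (lie_bracket x Z))"
    by (rule trace_on_diff[OF wsp_subspace]) (use xP yP in auto)
  also have "\<dots> = 0"
    using trace_on_commute[OF wsp_subspace clinear_lie_bracket xP clinear_lie_bracket yP] by simp
  finally have tr0: "trace_on (wsp P) (lie_bracket H) = 0" .
  have fin: "finite ?F" using E_finite by simp
  have "trace_on (wsp P) (lie_bracket H) = (\<Sum>e\<in>?F. weight e H)"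
  proof (rule trace_on_eigenbasis[OF fin _ _ clinear_lie_bracket])
    show "cmat.independent ?F" by (rule cmat.independent_mono[OF E_independent]) blast
    show "cmat.span ?F = wsp P" by (simp add: wsp_def)
  qed (use H weight in auto)
  hence sum0: "(\<Sum>e\<in>?F. weight e H) = 0" using tr0 by simp
  have "\<forall>e\<in>?F. \<exists>k::int. weight e H = weight e0 H + of_int k * \<beta> H" unfolding P_def by blast
  from bchoice[OF this] obtain k :: "complex^'n^'n \<Rightarrow> int" where
    k: "\<forall>e\<in>?F. weight e H = weight e0 H + of_int (k e) * \<beta> H" ..
  have "(\<Sum>e\<in>?F. weight e H) = (\<Sum>e\<in>?F. weight e0 H + of_int (k e) * \<beta> H)"
    using k by (intro sum.cong refl) blast
  also have "\<dots> = of_nat (card ?F) * weight e0 H + of_int (\<Sum>e\<in>?F. k e) * \<beta> H"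
    by (simp add: sum.distrib flip: sum_distrib_right)
  finally have eq: "of_nat (card ?F) * weight e0 H = - (of_int (\<Sum>e\<in>?F. k e) * \<beta> H)"
    using sum0 by (simp add: eq_neg_iff_add_eq_0)
  have "P (weight e0)" unfolding P_def by (intro exI[of _ 0]) simp
  hence "card ?F \<noteq> 0" using e0 fin by auto
  hence "weight e0 H = of_real (- of_int (\<Sum>e\<in>?F. k e) / of_nat (card ?F)) * \<beta> H"
    using eq by (simp add: field_simps)
  thus ?thesis unfolding H_def by blast
qed

lemma center_trivial:
  assumes "X \<in> L" "\<And>Y. Y \<in> L \<Longrightarrow> lie_bracket X Y = 0"
  shows "X = 0"
proof -
  let ?Z = "{X \<in> L. \<forall>Y\<in>L. lie_bracket X Y = 0}"
  have "cmat.subspace ?Z"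
    using L_subspace by (auto simp: cmat.subspace_def lie_bracket_linear)
  moreover have "lie_bracket X Y \<in> ?Z" if "X \<in> L" "Y \<in> ?Z" for X Y
  proof -
    have "lie_bracket X Y = 0" using that lie_bracket_anti[of X Y] by simp
    thus ?thesis using L_subspace by (simp add: cmat.subspace_0 lie_bracket_linear)
  qed
  ultimately have "lie_ideal ?Z L" unfolding lie_ideal_def by blast
  moreover have "?Z \<noteq> L" using L_nonabelian by blast
  ultimately have "?Z = {0}" using L_ideal by blast
  thus ?thesis using assms by blast
qed

lemma cartan_zero:
  assumes H: "H \<in> h" and w: "\<And>e. e \<in> E \<Longrightarrow> weight e H = 0"
  shows "H = 0"
proof (rule center_trivial[OF h_L[OF H]])
  fix Y assume "Y \<in> L"
  hence "Y \<in> cmat.span E" using E_span by simp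
  hence "lie_bracket H Y \<in> {0}"
    by (rule span_induct_clinear[OF _ clinear_lie_bracket])
      (use weight[OF _ H] w in auto)
  thus "lie_bracket H Y = 0" by simp
qed

text \<open>If the Killing form vanished, all commutators of opposite root vectors would vanish, and the
  root vectors alone would span an ideal that meets the Cartan subalgebra in \<open>0\<close>.\<close>

lemma killing_nonzero: "\<exists>X\<in>L. \<exists>Y\<in>L. B X Y \<noteq> 0"
proof (rule ccontr)
  assume "\<not> ?thesis"
  hence B0: "\<And>X Y. X \<in> L \<Longrightarrow> Y \<in> L \<Longrightarrow> B X Y = 0" by blast
  have opp: "lie_bracket x y = 0"
    if x: "x \<in> wsp (\<lambda>\<alpha>. \<alpha> = \<beta>)" and y: "y \<in> wsp (\<lambda>\<alpha>. \<alpha> = (\<lambda>Y. - \<beta> Y))" for x y \<beta>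
  proof (cases "x = 0")
    case False
    let ?H = "lie_bracket x y"
    have H: "?H \<in> h" by (rule h_iff[THEN iffD2], rule wsp_bracket[OF _ x y]) auto
    have "\<forall>e\<in>E. \<exists>q::real. weight e ?H = of_real q * \<beta> ?H"
      using weight_on_commutator_real[OF x y] by blast
    then obtain q :: "complex^'n^'n \<Rightarrow> real" where q: "\<forall>e\<in>E. weight e ?H = of_real (q e) * \<beta> ?H" by metis
    obtain e1 where e1: "e1 \<in> E" "weight e1 = \<beta>" using wsp_nonzero[OF x False] by blast
    have "0 = (\<Sum>e\<in>E. weight e ?H * weight e ?H)"
      using killing_on_cartan[OF H H] B0[OF h_L[OF H] h_L[OF H]] by simp
    also have "\<dots> = (\<Sum>e\<in>E. of_real ((q e)\<^sup>2) * (\<beta> ?H)\<^sup>2)"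
      by (intro sum.cong refl) (use q in \<open>simp add: power2_eq_square\<close>)
    also have "\<dots> = of_real (\<Sum>e\<in>E. (q e)\<^sup>2) * (\<beta> ?H)\<^sup>2"
      by (simp add: sum_distrib_right)
    finally have "of_real (\<Sum>e\<in>E. (q e)\<^sup>2) * (\<beta> ?H)\<^sup>2 = 0" by (rule sym)
    hence "(\<Sum>e\<in>E. (q e)\<^sup>2) = 0 \<or> \<beta> ?H = 0"
      unfolding mult_eq_0_iff of_real_eq_0_iff by simp
    hence "(\<forall>e\<in>E. q e = 0) \<or> \<beta> ?H = 0"
      using sum_nonneg_eq_0_iff[OF E_finite, of "\<lambda>e. (q e)\<^sup>2"] by auto
    hence "\<And>e. e \<in> E \<Longrightarrow> weight e ?H = 0" using q by auto
    thus ?thesis by (rule cartan_zero[OF H])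
  qed (simp add: lie_bracket_linear)
  let ?N = "wsp (\<lambda>\<alpha>. \<alpha> \<noteq> (\<lambda>_. 0))"
  have "lie_bracket X Y \<in> ?N" if X: "X \<in> L" and Y: "Y \<in> ?N" for X Y
  proof -
    have basis: "lie_bracket e f \<in> ?N" if e: "e \<in> E" and f: "f \<in> E" "weight f \<noteq> (\<lambda>_. 0)" for e f
    proof (cases "weight e = (\<lambda>Y. - weight f Y)")
      case True
      hence "lie_bracket f e = 0"
        by (intro opp[of f "weight f" e]) (use e f in \<open>auto intro!: wsp_base\<close>)
      hence "lie_bracket e f = 0" using lie_bracket_anti[of e f] by simp
      thus ?thesis by (simp add: cmat.subspace_0[OF wsp_subspace])
    next
      case False
      show ?thesis
      proof (rule wsp_bracket[of "\<lambda>\<alpha>. \<alpha> = weight e" "\<lambda>\<alpha>. \<alpha> = weight f"])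
        fix \<alpha> \<beta> assume ab: "\<alpha> = weight e" "\<beta> = weight f"
        show "(\<lambda>Y. \<alpha> Y + \<beta> Y) \<noteq> (\<lambda>_. 0)"
        proof
          assume "(\<lambda>Y. \<alpha> Y + \<beta> Y) = (\<lambda>_. 0)"
          hence "\<alpha> Y = - \<beta> Y" for Y by (simp add: fun_eq_iff eq_neg_iff_add_eq_0)
          thus False using False ab by (simp add: fun_eq_iff)
        qed
      qed (use e f in \<open>auto intro!: wsp_base\<close>)
    qed
    have eY: "lie_bracket e Y \<in> ?N" if "e \<in> E" for e
      by (rule span_induct_clinear[OF Y[unfolded wsp_def] clinear_lie_bracket wsp_subspace])
        (use basis that in auto)
    have "X \<in> cmat.span E" using X E_span by simp
    thus ?thesis
      by (rule span_induct_clinear[OF _ clinear_lie_bracket_left wsp_subspace, where B = E])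
        (rule eY)
  qed
  moreover have "?N \<subseteq> L" using wsp_L by blast
  ultimately have "lie_ideal ?N L"
    unfolding lie_ideal_def using wsp_subspace by blast
  hence "?N = {0} \<or> ?N = L" by (rule L_ideal)
  thus False
  proof
    assume N: "?N = {0}"
    have "weight e = (\<lambda>_. 0)" if "e \<in> E" for e
      using wsp_base[OF that, of "\<lambda>\<alpha>. \<alpha> \<noteq> (\<lambda>_. 0)"] E_nonzero[OF that] N by blast
    hence "e \<in> h" if "e \<in> E" for e
      by (intro h_iff[THEN iffD2] wsp_base that) (use that in blast)
    hence "E \<subseteq> h" by blast
    hence "L \<subseteq> h" using cmat.span_minimal[OF _ h_subspace] E_span by blast
    thus False using L_nonabelian h_commute by blast
  next
    assume N: "?N = L"
    have h0: "X = 0" if "X \<in> h" for X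
    proof (rule wsp_disjoint)
      show "X \<in> wsp (\<lambda>\<alpha>. \<alpha> = (\<lambda>_. 0))" using that h_iff by blast
      show "X \<in> ?N" using that N h_L by blast
    qed auto
    have "lie_bracket Y X = 0" if "Y \<in> h" for X Y
      unfolding h0[OF that] by (simp add: lie_bracket_linear)
    hence "L \<subseteq> h" using h_maximal by blast
    thus False using L_nonabelian h_commute by blast
  qed
qed

text \<open>By invariance the radical is an ideal, so simplicity leaves only \<open>0\<close> and the whole algebra.\<close>

theorem killing_nondegenerate:
  assumes "X \<in> L" "\<And>Y. Y \<in> L \<Longrightarrow> B X Y = 0"
  shows "X = 0"
proof -
  let ?R = "{X \<in> L. \<forall>Y\<in>L. B X Y = 0}"
  have "cmat.subspace ?R"
    using L_subspace
    by (auto simp: cmat.subspace_def killing_add_left killing_scale_left killing_zero_left)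
  moreover have "lie_bracket X Y \<in> ?R" if "X \<in> L" "Y \<in> ?R" for X Y
  proof -
    have "B (lie_bracket X Y) Z = 0" if Z: "Z \<in> L" for Z
    proof -
      have "B (lie_bracket X Y) Z = B Z (lie_bracket X Y)"
        using \<open>X \<in> L\<close> \<open>Y \<in> ?R\<close> Z by (intro killing_sym L_bracket) auto
      also have "\<dots> = B (lie_bracket Z X) Y"
        using \<open>X \<in> L\<close> \<open>Y \<in> ?R\<close> Z by (intro killing_invariant[symmetric]) auto
      also have "\<dots> = B Y (lie_bracket Z X)"
        using \<open>X \<in> L\<close> \<open>Y \<in> ?R\<close> Z by (intro killing_sym L_bracket) auto
      also have "\<dots> = 0" using \<open>X \<in> L\<close> \<open>Y \<in> ?R\<close> Z L_bracket by auto
      finally show ?thesis .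
    qed
    thus ?thesis using that L_bracket by auto
  qed
  ultimately have "lie_ideal ?R L" unfolding lie_ideal_def by blast
  moreover have "?R \<noteq> L" using killing_nonzero by blast
  ultimately have "?R = {0}" using L_ideal by blast
  thus ?thesis using assms by blast
qed

lemma wsp_orthogonal:
  assumes PQ: "\<And>\<alpha> \<beta>. P \<alpha> \<Longrightarrow> Q \<beta> \<Longrightarrow> \<alpha> \<noteq> (\<lambda>Y. - \<beta> Y)"
    and X: "X \<in> wsp P" and Y: "Y \<in> wsp Q"
  shows "B X Y = 0"
proof -
  have basis: "B e f = 0" if e: "e \<in> E" "P (weight e)" and f: "f \<in> E" "Q (weight f)" for e f
  proof -
    obtain H where neq: "weight e H \<noteq> - weight f H" using PQ[OF e(2) f(2)] by blast
    hence H: "H \<in> h" using weight_outside by (metis neg_equal_0_iff_equal)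
    have eH: "lie_bracket e H = (- weight e H) *\<^sub>C e"
      using lie_bracket_anti[of e H] weight[OF e(1) H] by (simp add: cmat.scale_minus_left)
    have "- weight e H * B e f = B (lie_bracket e H) f"
      unfolding eH by (rule killing_scale_left[symmetric]) (use E_L e f in auto)
    also have "\<dots> = B e (lie_bracket H f)"
      using E_L e f h_L H by (intro killing_invariant) auto
    also have "\<dots> = weight f H * B e f"
      using weight[OF f(1) H] E_L e f by (simp add: killing_scale_right)
    finally show ?thesis using neq by (metis minus_minus mult_right_cancel)
  qed
  have eY: "Y \<in> L \<and> B e Y = 0" if e: "e \<in> E" "P (weight e)" for e
    using Y unfolding wsp_def
  proof (rule cmat.span_induct)
    show "cmat.subspace {Y. Y \<in> L \<and> B e Y = 0}"
      using L_subspace E_L[OF e(1)] by (auto simp: cmat.subspace_def killing_add_right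
          killing_scale_right killing_zero_right)
  qed (use basis e E_L in auto)
  have "X \<in> L \<and> B X Y = 0"
    using X unfolding wsp_def
  proof (rule cmat.span_induct)
    show "cmat.subspace {X. X \<in> L \<and> B X Y = 0}"
      using L_subspace wsp_L[OF Y] by (auto simp: cmat.subspace_def killing_add_left
          killing_scale_left killing_zero_left)
  qed (use eY E_L in auto)
  thus ?thesis by simp
qed

text \<open>Weight spaces pair nontrivially with opposite ones only, so the orthogonal complement of a sum
  of weight spaces omits exactly the opposite weights.\<close>

lemma wsp_perp:
  assumes X: "X \<in> L" and orth: "\<And>Y. Y \<in> wsp P \<Longrightarrow> B X Y = 0"
  shows "X \<in> wsp (\<lambda>\<alpha>. \<not> P (\<lambda>Y. - \<alpha> Y))"
proof -
  let ?O = "\<lambda>\<alpha>. P (\<lambda>Y. - \<alpha> Y)"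
  have X2: "pr ?O X \<in> wsp ?O" and X1: "X - pr ?O X \<in> wsp (\<lambda>\<alpha>. \<not> ?O \<alpha>)"
    using pr_wsp pr_complement[OF X] by blast+
  have "pr ?O X = 0"
  proof (rule killing_nondegenerate)
    show "pr ?O X \<in> L" using X2 by (rule wsp_L)
    fix Y assume Y: "Y \<in> L"
    have Y2: "pr P Y \<in> wsp P" and Y1: "Y - pr P Y \<in> wsp (\<lambda>\<alpha>. \<not> P \<alpha>)"
      using pr_wsp pr_complement[OF Y] by blast+
    have "B (pr ?O X) (Y - pr P Y) = 0"
      by (rule wsp_orthogonal[OF _ X2 Y1]) auto
    moreover have "B (X - pr ?O X) (pr P Y) = 0"
      by (rule wsp_orthogonal[OF _ X1 Y2]) auto
    hence "B (pr ?O X) (pr P Y) = 0"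
      using orth[OF Y2] X wsp_L[OF X2] wsp_L[OF Y2] by (simp add: killing_diff_left)
    ultimately show "B (pr ?O X) Y = 0"
      using Y wsp_L[OF X2] wsp_L[OF Y2] by (simp add: killing_diff_right)
  qed
  thus ?thesis using X1 by simp
qed

lemma cartan_nondegenerate:
  assumes H: "H \<in> h" and "\<And>H'. H' \<in> h \<Longrightarrow> B H H' = 0"
  shows "H = 0"
proof -
  have "H \<in> wsp (\<lambda>\<alpha>. \<not> (\<lambda>Y. - \<alpha> Y) = (\<lambda>_. 0))"
    by (rule wsp_perp[OF h_L[OF H]]) (use assms(2) h_iff in blast)
  moreover have "H \<in> wsp (\<lambda>\<alpha>. \<alpha> = (\<lambda>_. 0))" using H h_iff by blast
  ultimately show ?thesis by (rule wsp_disjoint) auto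
qed

text \<open>The element dual to a root \<open>\<beta>\<close> is a commutator \<open>[x, y]\<close> of opposite root vectors with
  \<open>B x y = 1\<close>. So every weight takes a real multiple of \<open>\<beta> t\<close> on it, and \<open>\<beta> t = 0\<close> would make it
  central.\<close>

lemma root_dual:
  assumes \<beta>: "\<beta> \<in> roots L h"
  obtains t where "t \<in> h" "\<And>H. H \<in> h \<Longrightarrow> B t H = \<beta> H"
    "\<And>e. e \<in> E \<Longrightarrow> \<exists>q::real. weight e t = of_real q * \<beta> t" "\<beta> t \<noteq> 0"
proof -
  obtain x where x: "x \<in> E" "weight x = \<beta>" and \<beta>0: "\<beta> \<noteq> (\<lambda>_. 0)" using root_obtain_basis[OF \<beta>] .
  have xw: "x \<in> wsp (\<lambda>\<alpha>. \<alpha> = \<beta>)" using x by (simp add: wsp_base)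
  have "\<exists>y\<in>wsp (\<lambda>\<alpha>. \<alpha> = (\<lambda>Y. - \<beta> Y)). B x y \<noteq> 0"
  proof (rule ccontr)
    assume "\<not> ?thesis"
    hence "x \<in> wsp (\<lambda>\<alpha>. \<not> (\<lambda>Y. - \<alpha> Y) = (\<lambda>Y. - \<beta> Y))"
      by (intro wsp_perp E_L[OF x(1)]) blast
    hence "x = 0" using xw by (rule wsp_disjoint) (auto simp: fun_eq_iff)
    thus False using E_nonzero[OF x(1)] by simp
  qed
  then obtain y0 where y0: "y0 \<in> wsp (\<lambda>\<alpha>. \<alpha> = (\<lambda>Y. - \<beta> Y))" "B x y0 \<noteq> 0" by blast
  define y where "y = (1 / B x y0) *\<^sub>C y0"
  have y: "y \<in> wsp (\<lambda>\<alpha>. \<alpha> = (\<lambda>Y. - \<beta> Y))"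
    unfolding y_def using y0(1) wsp_subspace by (simp add: cmat.subspace_scale)
  have Bxy: "B x y = 1"
    unfolding y_def using y0 E_L[OF x(1)] wsp_L[OF y0(1)] by (simp add: killing_scale_right)
  define t where "t = lie_bracket x y"
  have t: "t \<in> h" unfolding t_def by (rule h_iff[THEN iffD2], rule wsp_bracket[OF _ xw y]) auto
  have dual: "B t H = \<beta> H" if H: "H \<in> h" for H
  proof -
    have "wsp (\<lambda>\<alpha>. \<alpha> = (\<lambda>Y. - \<beta> Y)) = root_space L h (\<lambda>Y. - \<beta> Y)"
      by (rule root_space_eq_wsp[symmetric]) (use weight_outside x in auto)
    hence "lie_bracket H y = (- \<beta> H) *\<^sub>C y" using y H by (simp add: root_space_def)
    hence "lie_bracket y H = \<beta> H *\<^sub>C y"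
      using lie_bracket_anti[of y H] by (simp add: cmat.scale_minus_left)
    thus ?thesis
      unfolding t_def using killing_invariant[OF E_L[OF x(1)] wsp_L[OF y] h_L[OF H]] Bxy
        E_L[OF x(1)] wsp_L[OF y] by (simp add: killing_scale_right)
  qed
  have real: "\<exists>q::real. weight e t = of_real q * \<beta> t" if "e \<in> E" for e
    unfolding t_def by (rule weight_on_commutator_real[OF xw y that])
  have "\<beta> t \<noteq> 0"
  proof
    assume "\<beta> t = 0"
    hence "t = 0" using real by (intro cartan_zero[OF t]) auto
    hence "\<beta> H = 0" for H
      using dual[of H] killing_zero_left[OF h_L, of H] weight_outside[of H x] x(2)
      by (cases "H \<in> h") auto
    thus False using \<beta>0 by auto
  qed
  thus ?thesis using that t dual real by blast
qed

end

section \<open>Coroots and the Weyl group\<close>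

context cartan_pair begin

lemma coroot_properties:
  assumes \<alpha>: "\<alpha> \<in> roots L h"
  obtains \<kappa> where "coroot L h \<alpha> \<in> h" "\<alpha> (coroot L h \<alpha>) = 2"
    "\<And>H. H \<in> h \<Longrightarrow> B (coroot L h \<alpha>) H = \<kappa> * \<alpha> H"
    "\<And>e. e \<in> E \<Longrightarrow> weight e (coroot L h \<alpha>) \<in> \<real>"
proof -
  obtain t where t: "t \<in> h" "\<And>H. H \<in> h \<Longrightarrow> B t H = \<alpha> H"
    "\<And>e. e \<in> E \<Longrightarrow> \<exists>q::real. weight e t = of_real q * \<alpha> t" "\<alpha> t \<noteq> 0"
    using root_dual[OF \<alpha>] by metis
  have "(THE t. t \<in> h \<and> (\<forall>Y\<in>h. B t Y = \<alpha> Y)) = t"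
  proof (rule the_equality)
    fix u assume u: "u \<in> h \<and> (\<forall>Y\<in>h. B u Y = \<alpha> Y)"
    have "u - t = 0"
    proof (rule cartan_nondegenerate)
      show "u - t \<in> h" using u t(1) h_subspace by (simp add: cmat.subspace_diff)
      show "B (u - t) H = 0" if "H \<in> h" for H
        using u t(1) t(2)[OF that] that h_L by (simp add: killing_diff_left)
    qed
    thus "u = t" by simp
  qed (use t in simp)
  hence c: "coroot L h \<alpha> = (2 / \<alpha> t) *\<^sub>C t"
    by (simp add: coroot_def Let_def)
  obtain e where e: "e \<in> E" "weight e = \<alpha>" using root_obtain_basis[OF \<alpha>] .
  show ?thesis
  proof (rule that)
    show "coroot L h \<alpha> \<in> h" unfolding c by (rule cmat.subspace_scale[OF h_subspace t(1)])
    show "\<alpha> (coroot L h \<alpha>) = 2"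
      using weight_scale[OF e(1) t(1)] e(2) t(4) by (simp add: c)
    show "B (coroot L h \<alpha>) H = (2 / \<alpha> t) * \<alpha> H" if "H \<in> h" for H
      unfolding c using that t h_L by (simp add: killing_scale_left)
    show "weight e (coroot L h \<alpha>) \<in> \<real>" if "e \<in> E" for e
    proof -
      obtain q :: real where "weight e t = of_real q * \<alpha> t" using t(3)[OF \<open>e \<in> E\<close>] by blast
      hence "weight e (coroot L h \<alpha>) = of_real (2 * q)"
        unfolding c using weight_scale[OF that t(1)] t(4) by simp
      thus ?thesis by (metis Reals_of_real)
    qed
  qed
qed

lemma real_cartan_real:
  assumes "X \<in> real_cartan L h"
  shows "X \<in> h \<and> (\<forall>e\<in>E. weight e X \<in> \<real>)"
  using assms unfolding real_cartan_def
proof (rule span_induct)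
  show "X \<in> h \<and> (\<forall>e\<in>E. weight e X \<in> \<real>)" if "X \<in> coroot L h ` roots L h" for X
    using that coroot_properties by (metis imageE)
  have "weight e 0 = 0" if "e \<in> E" for e
    using weight_scale[OF that cmat.subspace_0[OF h_subspace], of 0] by simp
  thus "subspace {X. X \<in> h \<and> (\<forall>e\<in>E. weight e X \<in> \<real>)}"
    using h_subspace
    by (auto simp: subspace_def scaleR_eq_cscale weight_add weight_scale cmat.subspace_0
        cmat.subspace_add cmat.subspace_scale)
qed

text \<open>The weights are real on coroots, so reflections are unitary for the Hermitian form
  below as well as orthogonal for the Killing form.\<close>

definition herm :: "complex^'n^'n \<Rightarrow> complex^'n^'n \<Rightarrow> complex"
  where "herm X Y = (\<Sum>e\<in>E. weight e X * cnj (weight e Y))"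

lemma weight_diff_scale:
  "e \<in> E \<Longrightarrow> X \<in> h \<Longrightarrow> Y \<in> h \<Longrightarrow> weight e (X - c *\<^sub>C Y) = weight e X - c * weight e Y"
proof -
  assume *: "e \<in> E" "X \<in> h" "Y \<in> h"
  hence "(- c) *\<^sub>C Y \<in> h" using cmat.subspace_scale[OF h_subspace] by blast
  from weight_add[OF *(1,2) this] weight_scale[OF *(1,3), of "- c"] show ?thesis
    by (simp add: cmat.scale_minus_left)
qed

lemma herm_definite: "X \<in> h \<Longrightarrow> herm X X = 0 \<Longrightarrow> X = 0"
proof (rule cartan_zero)
  fix e assume X: "herm X X = 0" and e: "e \<in> E"
  have "herm X X = of_real (\<Sum>e\<in>E. (cmod (weight e X))\<^sup>2)"
    unfolding herm_def of_real_sum complex_norm_square ..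
  hence "(\<Sum>e\<in>E. (cmod (weight e X))\<^sup>2) = 0" using X by (metis of_real_eq_0_iff)
  thus "weight e X = 0"
    using sum_nonneg_eq_0_iff[OF E_finite, of "\<lambda>e. (cmod (weight e X))\<^sup>2"] e by simp
qed

lemma weyl_group_properties:
  assumes "w \<in> weyl_group L h"
  shows "(\<forall>X\<in>h. w X \<in> h \<and> (\<forall>c. w (c *\<^sub>C X) = c *\<^sub>C w X) \<and>
    (\<forall>Y\<in>h. w (X + Y) = w X + w Y \<and> B (w X) (w Y) = B X Y \<and> herm (w X) (w Y) = herm X Y))"
  using assms
proof (induction rule: weyl_group.induct)
  case (2 w \<alpha>)
  define c where "c = coroot L h \<alpha>"
  obtain \<kappa> where c: "c \<in> h" "\<alpha> c = 2" "\<And>H. H \<in> h \<Longrightarrow> B c H = \<kappa> * \<alpha> H"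
    "\<And>e. e \<in> E \<Longrightarrow> weight e c \<in> \<real>"
    unfolding c_def using coroot_properties[OF 2(2)] by metis
  obtain e where e: "e \<in> E" "weight e = \<alpha>" using root_obtain_basis[OF 2(2)] .
  define R where "R Y = Y - \<alpha> Y *\<^sub>C c" for Y
  have R_h: "R X \<in> h" if "X \<in> h" for X
    unfolding R_def using that c(1) h_subspace by (simp add: cmat.subspace_diff cmat.subspace_scale)
  have R_scale: "R (a *\<^sub>C X) = a *\<^sub>C R X" if "X \<in> h" for a X
    unfolding R_def using weight_scale[OF e(1) that] e(2) by (simp add: cmat.scale_right_diff_distrib)
  have R_add: "R (X + Y) = R X + R Y" if "X \<in> h" "Y \<in> h" for X Y
    unfolding R_def using weight_add[OF e(1) that] e(2) by (simp add: cmat.scale_left_distrib)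
  have R_B: "B (R X) (R Y) = B X Y" if X: "X \<in> h" and Y: "Y \<in> h" for X Y
  proof -
    have Xc: "B X c = \<kappa> * \<alpha> X" using killing_sym c(1,3) h_L X by simp
    have "\<alpha> Y *\<^sub>C c \<in> L" "\<alpha> X *\<^sub>C c \<in> L" "X \<in> L" "Y \<in> L" "c \<in> L" "X - \<alpha> X *\<^sub>C c \<in> L"
      using h_L[OF c(1)] h_L[OF X] h_L[OF Y] L_subspace
      by (simp_all add: cmat.subspace_scale cmat.subspace_diff)
    thus ?thesis
      unfolding R_def using c(2) c(3)[OF c(1)] c(3)[OF Y] Xc
      by (simp add: killing_diff_left killing_diff_right killing_scale_left killing_scale_right
          algebra_simps)
  qed
  have cnj_c: "cnj (weight e c) = weight e c" if "e \<in> E" for e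
    using c(4)[OF that] by (simp add: Reals_cnj_iff)
  have Xc: "(\<Sum>e\<in>E. weight e X * weight e c) = \<kappa> * \<alpha> X" if X: "X \<in> h" for X
    using killing_on_cartan[OF c(1) X] c(3)[OF X] by (simp add: mult.commute)
  have \<kappa>: "cnj \<kappa> = \<kappa>"
  proof -
    have "\<kappa> * 2 = (\<Sum>e\<in>E. weight e c * weight e c)" using Xc[OF c(1)] c(2) by simp
    moreover have "cnj (\<Sum>e\<in>E. weight e c * weight e c) = (\<Sum>e\<in>E. weight e c * weight e c)"
      by (simp add: cnj_c)
    ultimately have "cnj (\<kappa> * 2) = \<kappa> * 2" by simp
    thus ?thesis by simp
  qed
  have R_herm: "herm (R X) (R Y) = herm X Y" if X: "X \<in> h" and Y: "Y \<in> h" for X Y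
  proof -
    have "herm (R X) (R Y) = (\<Sum>e\<in>E. weight e X * cnj (weight e Y)
        - cnj (\<alpha> Y) * (weight e X * weight e c) - \<alpha> X * cnj (weight e Y * weight e c)
        + \<alpha> X * cnj (\<alpha> Y) * (weight e c * weight e c))"
      unfolding herm_def R_def
      by (intro sum.cong refl)
        (simp add: weight_diff_scale X Y c(1) cnj_c algebra_simps)
    also have "\<dots> = herm X Y - cnj (\<alpha> Y) * (\<Sum>e\<in>E. weight e X * weight e c)
        - \<alpha> X * cnj (\<Sum>e\<in>E. weight e Y * weight e c)
        + \<alpha> X * cnj (\<alpha> Y) * (\<Sum>e\<in>E. weight e c * weight e c)"
      unfolding herm_def by (simp add: sum.distrib sum_subtractf sum_distrib_left)
    also have "\<dots> = herm X Y"
      unfolding Xc[OF X] Xc[OF Y] Xc[OF c(1)] by (simp add: \<kappa> c(2))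
    finally show ?thesis .
  qed
  have "(\<lambda>Y. Y - \<alpha> Y *\<^sub>C coroot L h \<alpha>) \<circ> w = (\<lambda>X. R (w X))"
    by (simp add: fun_eq_iff R_def c_def)
  thus ?case
    using "2.IH" by (simp add: R_h R_scale R_add R_B R_herm)
qed simp

end

text \<open>A Weyl group element is unitary, so its generalized eigenvectors for the eigenvalue \<open>1\<close> are fixed
  vectors. Hence the Cartan subalgebra splits into the fixed space and its orthogonal complement.\<close>

locale weyl_element = cartan_pair L h for L h :: "(complex^'n^'n) set" +
  fixes s :: "complex^'n^'n \<Rightarrow> complex^'n^'n"
  assumes s: "s \<in> weyl_group L h"
begin

lemma s_h: "X \<in> h \<Longrightarrow> s X \<in> h"
  and s_scale: "X \<in> h \<Longrightarrow> s (c *\<^sub>C X) = c *\<^sub>C s X"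
  and s_add: "X \<in> h \<Longrightarrow> Y \<in> h \<Longrightarrow> s (X + Y) = s X + s Y"
  and s_killing: "X \<in> h \<Longrightarrow> Y \<in> h \<Longrightarrow> B (s X) (s Y) = B X Y"
  and s_herm: "X \<in> h \<Longrightarrow> Y \<in> h \<Longrightarrow> herm (s X) (s Y) = herm X Y"
  using weyl_group_properties[OF s] by blast+

lemma s_0: "s 0 = 0"
  using s_scale[of 0 0] cmat.subspace_0[OF h_subspace] by simp

lemma s_diff: "X \<in> h \<Longrightarrow> Y \<in> h \<Longrightarrow> s (X - Y) = s X - s Y"
  using s_add[of "X - Y" Y] h_subspace by (simp add: cmat.subspace_diff)

definition fixed :: "(complex^'n^'n) set" where "fixed = {x \<in> h. s x = x}"

definition perp :: "(complex^'n^'n) set" where "perp = {x \<in> h. \<forall>y\<in>fixed. B x y = 0}"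

text \<open>The image of \<open>1 - s\<close> lies in \<open>perp\<close> and is a complement of the fixed space, which shows that
  \<open>perp\<close> is a complement as well.\<close>

definition moved :: "(complex^'n^'n) set" where "moved = (\<lambda>x. x - s x) ` h"

lemma fixed_subspace: "cmat.subspace fixed"
  unfolding fixed_def using h_subspace by (auto simp: cmat.subspace_def s_0 s_add s_scale)

lemma fixed_h: "X \<in> fixed \<Longrightarrow> X \<in> h" and perp_h: "X \<in> perp \<Longrightarrow> X \<in> h"
  by (simp_all add: fixed_def perp_def)

lemma perp_subspace: "cmat.subspace perp"
  unfolding perp_def using h_subspace h_L fixed_h
  by (auto simp: cmat.subspace_def killing_add_left killing_scale_left killing_zero_left)

lemma moved_subspace: "cmat.subspace moved"
proof (rule cmat.subspaceI)
  have "0 \<in> h" by (rule cmat.subspace_0[OF h_subspace])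
  thus "0 \<in> moved" unfolding moved_def by (rule image_eqI[rotated]) (simp add: s_0)
next
  fix x y assume "x \<in> moved" "y \<in> moved"
  then obtain a b where ab: "a \<in> h" "x = a - s a" "b \<in> h" "y = b - s b"
    unfolding moved_def by (elim imageE)
  have "a + b \<in> h" using ab by (simp add: cmat.subspace_add[OF h_subspace])
  thus "x + y \<in> moved"
    unfolding moved_def by (rule image_eqI[rotated]) (simp add: ab s_add)
next
  fix c x assume "x \<in> moved"
  then obtain a where a: "a \<in> h" "x = a - s a" unfolding moved_def by (elim imageE)
  have "c *\<^sub>C a \<in> h" by (rule cmat.subspace_scale[OF h_subspace a(1)])
  thus "c *\<^sub>C x \<in> moved"
    unfolding moved_def
    by (rule image_eqI[rotated]) (simp add: a s_scale cmat.scale_right_diff_distrib)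
qed

lemma moved_h: "X \<in> moved \<Longrightarrow> X \<in> h"
  unfolding moved_def using s_h h_subspace by (auto simp: cmat.subspace_diff)

lemma herm_diff_left: "X \<in> h \<Longrightarrow> Y \<in> h \<Longrightarrow> Z \<in> h \<Longrightarrow> herm (X - Y) Z = herm X Z - herm Y Z"
  using weight_diff_scale[of _ X Y 1]
  by (simp add: herm_def left_diff_distrib sum_subtractf)

text \<open>For \<open>X = x - s x\<close> with \<open>s X = X\<close>, unitarity gives \<open>herm X X = herm x X - herm (s x) (s X) = 0\<close>.\<close>

lemma moved_fixed: "X \<in> moved \<Longrightarrow> X \<in> fixed \<Longrightarrow> X = 0"
proof -
  assume "X \<in> moved" and f: "X \<in> fixed"
  then obtain x where x: "x \<in> h" "X = x - s x" unfolding moved_def by (elim imageE)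
  have X: "X \<in> h" using f by (rule fixed_h)
  have "herm X X = herm x X - herm (s x) X" using x X s_h by (simp add: herm_diff_left)
  also have "herm (s x) X = herm (s x) (s X)" using f by (simp add: fixed_def)
  also have "\<dots> = herm x X" by (rule s_herm[OF x(1) X])
  finally show "X = 0" using herm_definite[OF X] by simp
qed

lemma one_minus_s_surj:
  assumes V: "cmat.subspace V" "V \<subseteq> h" and into: "\<And>x. x \<in> V \<Longrightarrow> x - s x \<in> V"
    and disj: "\<And>x. x \<in> V \<Longrightarrow> x \<in> fixed \<Longrightarrow> x = 0"
  shows "(\<lambda>x. x - s x) ` V = V"
proof (rule injective_endo_imp_surjective[OF V(1)])
  show "x - s x = 0 \<Longrightarrow> x = 0" if "x \<in> V" for x
    using disj[OF that] that V(2) by (auto simp: fixed_def)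
  fix x assume "x \<in> V"
  hence x: "x \<in> h" using V by blast
  show "x + y - s (x + y) = x - s x + (y - s y)" if "y \<in> V" for y
    using s_add[OF x] that V by (simp add: subset_iff)
  show "c *\<^sub>C x - s (c *\<^sub>C x) = c *\<^sub>C (x - s x)" for c
    by (simp add: s_scale[OF x] cmat.scale_right_diff_distrib)
qed (rule into)

lemma moved_perp: "X \<in> moved \<Longrightarrow> X \<in> perp"
proof -
  assume m: "X \<in> moved"
  then obtain x where x: "x \<in> h" "X = x - s x" unfolding moved_def by (elim imageE)
  have "B X y = 0" if y: "y \<in> fixed" for y
  proof -
    have yh: "y \<in> h" using y by (rule fixed_h)
    have "B X y = B x y - B (s x) y" using x yh s_h h_L by (simp add: killing_diff_left)
    also have "B (s x) y = B (s x) (s y)" using y by (simp add: fixed_def)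
    also have "\<dots> = B x y" by (rule s_killing[OF x(1) yh])
    finally show ?thesis by simp
  qed
  thus "X \<in> perp" unfolding perp_def using moved_h[OF m] by blast
qed

text \<open>The map \<open>1 - s\<close> is injective, so also surjective, on its own image. Subtracting from \<open>x\<close> an element
  of the image with the same value under \<open>1 - s\<close> leaves a fixed vector.\<close>

lemma moved_fixed_decomposition:
  assumes "x \<in> h"
  obtains a f where "a \<in> moved" "f \<in> fixed" "x = a + f"
proof -
  have "(\<lambda>x. x - s x) ` moved = moved"
  proof (rule one_minus_s_surj[OF moved_subspace])
    show "moved \<subseteq> h" using moved_h by blast
    show "x - s x \<in> moved" if "x \<in> moved" for x using moved_h[OF that] by (simp add: moved_def)
  qed (rule moved_fixed)
  moreover have "x - s x \<in> moved" using assms by (simp add: moved_def)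
  ultimately obtain a where a: "a \<in> moved" "x - s x = a - s a" by blast
  have "x - a \<in> fixed"
    unfolding fixed_def using a assms moved_h[OF a(1)] h_subspace
    by (simp add: cmat.subspace_diff s_diff algebra_simps)
  thus ?thesis using that[OF a(1)] by simp
qed

lemma perp_fixed:
  assumes "X \<in> perp" "X \<in> fixed"
  shows "X = 0"
proof (rule cartan_nondegenerate[OF perp_h[OF assms(1)]])
  fix H assume "H \<in> h"
  then obtain a f where af: "a \<in> moved" "f \<in> fixed" "H = a + f" by (rule moved_fixed_decomposition)
  have L: "X \<in> L" "a \<in> L" "f \<in> L" using assms perp_h moved_h[OF af(1)] fixed_h[OF af(2)] h_L by blast+
  have "B X a = 0" using moved_perp[OF af(1)] assms(2) killing_sym[OF L(1,2)] by (simp add: perp_def)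
  moreover have "B X f = 0" using assms(1) af(2) by (simp add: perp_def)
  ultimately show "B X H = 0" using L by (simp add: af(3) killing_add_right)
qed

lemma perp_fixed_decomposition:
  assumes "x \<in> h"
  obtains a f where "a \<in> perp" "f \<in> fixed" "x = a + f"
  using moved_fixed_decomposition[OF assms] moved_perp by metis

text \<open>\<open>1 - s\<close> is invertible on \<open>perp\<close>, so the description that defines the Cayley transform has a unique
  solution.\<close>

lemma cayley_h:
  assumes x: "x \<in> perp"
  shows "cayley s perp x \<in> h"
proof -
  have into: "x - s x \<in> perp" if "x \<in> perp" for x
    using moved_perp perp_h[OF that] by (simp add: moved_def)
  have "(\<lambda>x. x - s x) ` perp = perp"
    by (rule one_minus_s_surj[OF perp_subspace _ into perp_fixed]) (use perp_h in auto)
  then obtain y where y: "y \<in> perp" "x = y - s y" using x by blast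
  have "cayley s perp x = y + s y"
    unfolding cayley_def
  proof (rule the_equality)
    fix z assume "\<exists>y\<in>perp. x = y - s y \<and> z = y + s y"
    then obtain y' where y': "y' \<in> perp" "x = y' - s y'" "z = y' + s y'" by blast
    have "y' - y \<in> fixed"
      unfolding fixed_def using y y' perp_h h_subspace
      by (simp add: cmat.subspace_diff s_diff algebra_simps)
    moreover have "y' - y \<in> perp" using y y' perp_subspace by (simp add: cmat.subspace_diff)
    ultimately have "y' - y = 0" using perp_fixed by blast
    thus "z = y + s y" using y' by simp
  qed (use y in blast)
  thus ?thesis using perp_h[OF y(1)] s_h h_subspace by (simp add: cmat.subspace_add)
qed

end

section \<open>Borel subalgebras, nilradicals and the r-matrix\<close>

context cartan_pair begin

lemma weight_opposite:
  assumes e: "e \<in> E"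
  obtains f where "f \<in> E" "weight f = (\<lambda>Y. - weight e Y)"
proof -
  have "\<exists>f\<in>E. weight f = (\<lambda>Y. - weight e Y)"
  proof (rule ccontr)
    assume "\<not> ?thesis"
    hence none: "\<And>f. f \<in> E \<Longrightarrow> weight f \<noteq> (\<lambda>Y. - weight e Y)" by blast
    have "Y = 0" if "Y \<in> wsp (\<lambda>\<alpha>. \<alpha> = (\<lambda>Y. - weight e Y))" for Y
      by (rule wsp_disjoint[OF that that]) (use none in blast)
    hence "e \<in> wsp (\<lambda>\<alpha>. \<not> (\<lambda>Y. - \<alpha> Y) = (\<lambda>Y. - weight e Y))"
      by (intro wsp_perp E_L[OF e]) (use killing_zero_right[OF E_L[OF e]] in blast)
    moreover have "e \<in> wsp (\<lambda>\<alpha>. \<alpha> = weight e)" using e by (simp add: wsp_base)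
    ultimately have "e = 0" by (rule wsp_disjoint) auto
    thus False using E_nonzero[OF e] by simp
  qed
  thus ?thesis using that by blast
qed

lemma coef_ad: "X \<in> L \<Longrightarrow> Y \<in> h \<Longrightarrow> e \<in> E \<Longrightarrow> coef (lie_bracket Y X) e = weight e Y * coef X e"
proof -
  assume X: "X \<in> L" and Y: "Y \<in> h" and e: "e \<in> E"
  have "lie_bracket Y X = (\<Sum>f\<in>E. coef X f *\<^sub>C lie_bracket Y f)"
    using clinear_sum[OF clinear_lie_bracket, of Y "\<lambda>f. coef X f *\<^sub>C f" E] coef_expansion[OF X]
    by (simp add: lie_bracket_linear)
  also have "\<dots> = (\<Sum>f\<in>E. (weight f Y * coef X f) *\<^sub>C f)"
    by (intro sum.cong refl) (simp add: weight Y mult.commute)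
  finally have eq: "lie_bracket Y X = \<dots>" .
  have "coef (lie_bracket Y X) e = (\<Sum>f\<in>E. coef ((weight f Y * coef X f) *\<^sub>C f) e)"
    unfolding eq
    by (subst cmat.representation_sum[OF E_independent]) (auto intro: cmat.span_scale cmat.span_base)
  also have "\<dots> = (\<Sum>f\<in>E. if f = e then weight f Y * coef X f else 0)"
    by (intro sum.cong refl) (auto simp: coef_scale E_L coef_basis)
  also have "\<dots> = weight e Y * coef X e" using E_finite e by simp
  finally show ?thesis .
qed

lemma pr_add: "X \<in> L \<Longrightarrow> Y \<in> L \<Longrightarrow> pr P (X + Y) = pr P X + pr P Y"
  unfolding pr_def by (simp add: coef_add cmat.scale_left_distrib sum.distrib)

lemma pr_inside: "X \<in> wsp P \<Longrightarrow> pr P X = X"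
  by (rule pr_unique) (auto simp: wsp_L cmat.subspace_0[OF wsp_subspace])

lemma pr_outside: "X \<in> wsp Q \<Longrightarrow> (\<And>e. e \<in> E \<Longrightarrow> Q (weight e) \<Longrightarrow> \<not> P (weight e)) \<Longrightarrow> pr P X = 0"
  by (rule pr_unique) (auto simp: wsp_L cmat.subspace_0[OF wsp_subspace] elim!: wsp_mono)

lemma pr_subset: "X \<in> wsp Q \<Longrightarrow> pr P X \<in> wsp Q"
  using wsp_L[OF pr_wsp[of P X]] by (auto simp: wsp_iff coef_pr)

text \<open>The bracket with an element of the Cartan subalgebra, corrected by a scalar, removes one
  weight from a vector while staying in the subspace; what remains in the end is the component.\<close>

lemma component_in_stable_subspace:
  assumes S: "cmat.subspace S" "S \<subseteq> L" and stable: "\<And>Y X. Y \<in> h \<Longrightarrow> X \<in> S \<Longrightarrow> lie_bracket Y X \<in> S"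
    and X: "X \<in> S"
  shows "pr (\<lambda>\<beta>. \<beta> = \<alpha>) X \<in> S"
proof -
  define W where "W X = weight ` {e \<in> E. coef X e \<noteq> 0} - {\<alpha>}" for X
  have finW: "finite (W X)" for X unfolding W_def using E_finite by simp
  \<comment> \<open>\<open>W X\<close> collects the weights of \<open>X\<close> that still have to be removed\<close>
  show ?thesis
    using X
  proof (induction "card (W X)" arbitrary: X rule: less_induct)
    case less
    have XL: "X \<in> L" using less.prems S by blast
    show ?case
    proof (cases "W X = {}")
      case True
      hence "X \<in> wsp (\<lambda>\<beta>. \<beta> = \<alpha>)" using XL by (auto simp: wsp_iff W_def)
      thus ?thesis using less.prems by (simp add: pr_inside)
    next
      case False
      then obtain f where f: "f \<in> E" "coef X f \<noteq> 0" "weight f \<noteq> \<alpha>" unfolding W_def by blast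
      then obtain Y where Y: "weight f Y \<noteq> \<alpha> Y" by blast
      show ?thesis
      proof (cases "Y \<in> h")
        case False
        \<comment> \<open>here \<open>\<alpha>\<close> is not the weight of any vector\<close>
        hence "weight e \<noteq> \<alpha>" for e using Y weight_outside[of Y] by metis
        hence "pr (\<lambda>\<beta>. \<beta> = \<alpha>) X = 0" by (simp add: pr_def)
        thus ?thesis using S(1) by (simp add: cmat.subspace_0)
      next
        case True
        define X' where "X' = lie_bracket Y X - weight f Y *\<^sub>C X"
        have X': "X' \<in> S"
          unfolding X'_def using S(1) stable[OF True less.prems] less.prems
          by (simp add: cmat.subspace_diff cmat.subspace_scale)
        have coef': "coef X' e = (weight e Y - weight f Y) * coef X e" if "e \<in> E" for e
          unfolding X'_def using XL L_bracket[OF h_L[OF True] XL] L_subspace that True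
          by (simp add: coef_diff coef_scale coef_ad cmat.subspace_scale left_diff_distrib)
        have "W X' \<subseteq> W X - {weight f}"
          unfolding W_def by (auto simp: coef')
        moreover have "weight f \<in> W X" unfolding W_def using f by blast
        ultimately have "W X' \<subset> W X" by blast
        hence "pr (\<lambda>\<beta>. \<beta> = \<alpha>) X' \<in> S"
          using less.hyps[OF psubset_card_mono[OF finW]] X' by blast
        moreover have "pr (\<lambda>\<beta>. \<beta> = \<alpha>) X' = (\<alpha> Y - weight f Y) *\<^sub>C pr (\<lambda>\<beta>. \<beta> = \<alpha>) X"
          unfolding pr_def cmat.scale_sum_right by (intro sum.cong refl) (auto simp: coef')
        ultimately have "(1 / (\<alpha> Y - weight f Y)) *\<^sub>C ((\<alpha> Y - weight f Y) *\<^sub>C pr (\<lambda>\<beta>. \<beta> = \<alpha>) X) \<in> S"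
          using S(1) by (simp add: cmat.subspace_scale del: cmat.scale_scale)
        thus ?thesis using Y by simp
      qed
    qed
  qed
qed

lemma positive_weights_bounded_below:
  obtains \<epsilon> :: real where "\<epsilon> > 0" "\<And>e. e \<in> E \<Longrightarrow> Re (weight e z) > 0 \<Longrightarrow> Re (weight e z) \<ge> \<epsilon>"
proof -
  let ?A = "insert 1 ((\<lambda>e. Re (weight e z)) ` {e \<in> E. Re (weight e z) > 0})"
  have fin: "finite ?A" using E_finite by simp
  have "Min ?A \<in> ?A" by (rule Min_in[OF fin]) simp
  hence "Min ?A > 0" by auto
  moreover have "Re (weight e z) \<ge> Min ?A" if "e \<in> E" "Re (weight e z) > 0" for e
    by (rule Min_le[OF fin]) (use that in blast)
  ultimately show ?thesis using that by blast
qed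

lemma high_level_trivial:
  obtains C :: real where "\<And>c X. c \<ge> C \<Longrightarrow> X \<in> wsp (\<lambda>\<alpha>. Re (\<alpha> z) \<ge> c) \<Longrightarrow> X = 0"
proof -
  let ?A = "insert 0 ((\<lambda>e. Re (weight e z)) ` E)"
  have fin: "finite ?A" using E_finite by simp
  have le: "Re (weight e z) \<le> Max ?A" if "e \<in> E" for e
    by (rule Max_ge[OF fin]) (use that in blast)
  have "X = 0" if "c \<ge> Max ?A + 1" "X \<in> wsp (\<lambda>\<alpha>. Re (\<alpha> z) \<ge> c)" for c X
    using that(2,2) by (rule wsp_disjoint) (use le that(1) in force)
  thus ?thesis using that by blast
qed

lemma low_level_everything:
  obtains D :: real where "\<And>X. X \<in> L \<Longrightarrow> X \<in> wsp (\<lambda>\<alpha>. Re (\<alpha> z) \<ge> D)"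
proof -
  let ?A = "insert 0 ((\<lambda>e. Re (weight e z)) ` E)"
  have fin: "finite ?A" using E_finite by simp
  have "Min ?A \<le> Re (weight e z)" if "e \<in> E" for e
    by (rule Min_le[OF fin]) (use that in blast)
  thus ?thesis using that[of "Min ?A"] by (simp add: wsp_iff)
qed

lemma ad_raises_level:
  assumes "X \<in> wsp (\<lambda>\<alpha>. Re (\<alpha> z) \<ge> c)" "Y \<in> wsp (\<lambda>\<alpha>. Re (\<alpha> z) \<ge> d)"
  shows "lie_bracket X Y \<in> wsp (\<lambda>\<alpha>. Re (\<alpha> z) \<ge> c + d)"
  by (rule wsp_bracket[OF _ assms]) simp

text \<open>Bracketing with an element of positive level raises the level by at least a fixed amount, and the
  levels of the finitely many weights are bounded.\<close>

lemma ad_nilpotent: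
  assumes Z: "Z \<in> wsp (\<lambda>\<alpha>. Re (\<alpha> z) > 0)" and X: "X \<in> L"
  obtains m where "(lie_bracket Z ^^ m) X = 0"
proof -
  obtain \<epsilon> where \<epsilon>: "\<epsilon> > 0" "\<And>e. e \<in> E \<Longrightarrow> Re (weight e z) > 0 \<Longrightarrow> Re (weight e z) \<ge> \<epsilon>"
    using positive_weights_bounded_below[of z] by metis
  obtain C where C: "\<And>c X. c \<ge> C \<Longrightarrow> X \<in> wsp (\<lambda>\<alpha>. Re (\<alpha> z) \<ge> c) \<Longrightarrow> X = 0"
    using high_level_trivial[of z] by metis
  obtain D where D: "\<And>X. X \<in> L \<Longrightarrow> X \<in> wsp (\<lambda>\<alpha>. Re (\<alpha> z) \<ge> D)"
    using low_level_everything[of z] by metis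
  have Z': "Z \<in> wsp (\<lambda>\<alpha>. Re (\<alpha> z) \<ge> \<epsilon>)" by (rule wsp_mono[OF Z]) (rule \<epsilon>(2))
  have level: "(lie_bracket Z ^^ m) X \<in> wsp (\<lambda>\<alpha>. Re (\<alpha> z) \<ge> D + m * \<epsilon>)" for m
  proof (induction m)
    case (Suc m)
    have "lie_bracket Z ((lie_bracket Z ^^ m) X) \<in> wsp (\<lambda>\<alpha>. Re (\<alpha> z) \<ge> \<epsilon> + (D + m * \<epsilon>))"
      by (rule ad_raises_level[OF Z' Suc])
    thus ?case by (simp add: algebra_simps)
  qed (use D[OF X] in simp)
  obtain m :: nat where "(C - D) / \<epsilon> \<le> real m" using real_arch_simple by blast
  hence "C \<le> D + m * \<epsilon>" using \<epsilon>(1) by (simp add: field_simps)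
  hence "(lie_bracket Z ^^ m) X = 0" using level by (rule C)
  thus ?thesis by (rule that)
qed

text \<open>An ideal of the Borel subalgebra contains the Cartan components of its elements; a nonzero
  such component acts invertibly on some root space of the Borel subalgebra, which then
  survives in the whole lower central series.\<close>

lemma nilradical_borel:
  assumes regular: "\<And>e. e \<in> E \<Longrightarrow> weight e \<noteq> (\<lambda>_. 0) \<Longrightarrow> Re (weight e z) \<noteq> 0"
  shows "nilradical (wsp (\<lambda>\<alpha>. \<alpha> = (\<lambda>_. 0) \<or> Re (\<alpha> z) > 0)) = wsp (\<lambda>\<alpha>. Re (\<alpha> z) > 0)"
    (is "nilradical ?b = ?u")
proof
  have ub: "?u \<subseteq> ?b" by (auto elim!: wsp_mono)
  have hb: "h \<subseteq> ?b"
  proof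
    fix X assume "X \<in> h"
    hence "X \<in> wsp (\<lambda>\<alpha>. \<alpha> = (\<lambda>_. 0))" using h_iff by blast
    thus "X \<in> ?b" by (rule wsp_mono) blast
  qed
  show "?u \<subseteq> nilradical ?b"
  proof -
    obtain \<epsilon> where \<epsilon>: "\<epsilon> > 0" "\<And>e. e \<in> E \<Longrightarrow> Re (weight e z) > 0 \<Longrightarrow> Re (weight e z) \<ge> \<epsilon>"
      using positive_weights_bounded_below[of z] by metis
    obtain C where C: "\<And>c X. c \<ge> C \<Longrightarrow> X \<in> wsp (\<lambda>\<alpha>. Re (\<alpha> z) \<ge> c) \<Longrightarrow> X = 0"
      using high_level_trivial[of z] by metis
    have u': "?u \<subseteq> wsp (\<lambda>\<alpha>. Re (\<alpha> z) \<ge> \<epsilon>)" using \<epsilon>(2) by (auto elim!: wsp_mono)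
    have level: "lower_central ?u m \<subseteq> wsp (\<lambda>\<alpha>. Re (\<alpha> z) \<ge> \<epsilon> + m * \<epsilon>)" for m
    proof (induction m)
      case (Suc m)
      have "lie_bracket X Y \<in> wsp (\<lambda>\<alpha>. Re (\<alpha> z) \<ge> \<epsilon> + Suc m * \<epsilon>)"
        if "X \<in> ?u" "Y \<in> lower_central ?u m" for X Y
      proof -
        have "lie_bracket X Y \<in> wsp (\<lambda>\<alpha>. Re (\<alpha> z) \<ge> \<epsilon> + (\<epsilon> + m * \<epsilon>))"
          using that u' Suc by (intro ad_raises_level) blast+
        thus ?thesis by (simp add: algebra_simps)
      qed
      thus ?case unfolding lower_central.simps
        by (intro cmat.span_minimal wsp_subspace) blast
    qed (use u' in simp)
    obtain m :: nat where "C / \<epsilon> \<le> real m" using real_arch_simple by blast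
    hence "C \<le> \<epsilon> + Suc m * \<epsilon>" using \<epsilon>(1) by (simp add: field_simps)
    hence "lower_central ?u (Suc m) \<subseteq> {0}" using level[of "Suc m"] C by blast
    moreover have "0 \<in> lower_central ?u (Suc m)" by (simp add: cmat.span_zero)
    ultimately have "nilpotent_lie_algebra ?u" unfolding nilpotent_lie_algebra_def by blast
    moreover have "lie_ideal ?u ?b"
    proof -
      have "lie_bracket X Y \<in> ?u" if "X \<in> ?b" "Y \<in> ?u" for X Y
        by (rule wsp_bracket[OF _ that]) auto
      thus ?thesis unfolding lie_ideal_def using ub wsp_subspace by blast
    qed
    ultimately have "?u \<subseteq> \<Union>{I. lie_ideal I ?b \<and> nilpotent_lie_algebra I}" by blast
    thus ?thesis unfolding nilradical_def using cmat.span_superset by (rule order_trans)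
  qed
  show "nilradical ?b \<subseteq> ?u"
    unfolding nilradical_def
  proof (rule cmat.span_minimal[OF _ wsp_subspace], rule Union_least)
    fix I assume "I \<in> {I. lie_ideal I ?b \<and> nilpotent_lie_algebra I}"
    hence Ib: "I \<subseteq> ?b" and I: "cmat.subspace I" and ideal: "\<And>X Y. X \<in> ?b \<Longrightarrow> Y \<in> I \<Longrightarrow> lie_bracket X Y \<in> I"
      and nil: "nilpotent_lie_algebra I"
      by (auto simp: lie_ideal_def)
    show "I \<subseteq> ?u"
    proof
      fix Z assume Z: "Z \<in> I"
      define H where "H = pr (\<lambda>\<alpha>. \<alpha> = (\<lambda>_. 0)) Z"
      have Hh: "H \<in> h" unfolding H_def using pr_wsp h_iff by blast
      have HI: "H \<in> I"
        unfolding H_def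
      proof (rule component_in_stable_subspace[OF I _ _ Z])
        show "I \<subseteq> L" using Ib wsp_L by blast
        show "lie_bracket Y X \<in> I" if "Y \<in> h" "X \<in> I" for Y X using that ideal hb by blast
      qed
      have "H = 0"
      proof (rule ccontr)
        assume "H \<noteq> 0"
        then obtain e where e: "e \<in> E" "weight e H \<noteq> 0" using cartan_zero[OF Hh] by blast
        hence "weight e \<noteq> (\<lambda>_. 0)" by auto
        hence nz: "Re (weight e z) \<noteq> 0" by (rule regular[OF e(1)])
        have "\<exists>f\<in>E. weight f H \<noteq> 0 \<and> Re (weight f z) > 0"
        proof (cases "Re (weight e z) > 0")
          case False
          obtain f where "f \<in> E" "weight f = (\<lambda>Y. - weight e Y)" using weight_opposite[OF e(1)] .
          thus ?thesis using e nz False by (intro bexI[of _ f]) auto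
        qed (use e in blast)
        then obtain f where f: "f \<in> E" "weight f H \<noteq> 0" "Re (weight f z) > 0" by blast
        have Hf: "f = (1 / weight f H) *\<^sub>C lie_bracket H f"
          using weight[OF f(1) Hh] f(2) by simp
        have "f \<in> ?b" using f by (auto intro: wsp_base)
        hence "lie_bracket f H \<in> I" using HI by (rule ideal)
        hence "(- 1 / weight f H) *\<^sub>C lie_bracket f H \<in> I" by (rule cmat.subspace_scale[OF I])
        moreover have "(- 1 / weight f H) *\<^sub>C lie_bracket f H = f"
          using Hf lie_bracket_anti[of H f]
          by (simp add: cmat.scale_minus_right cmat.scale_minus_left)
        ultimately have fI: "f \<in> I" by simp
        have "f \<in> lower_central I m" for m
        proof (induction m)
          case (Suc m)
          have "lie_bracket H f \<in> lower_central I (Suc m)"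
            unfolding lower_central.simps using HI Suc by (intro cmat.span_base) blast
          hence "(1 / weight f H) *\<^sub>C lie_bracket H f \<in> lower_central I (Suc m)"
            unfolding lower_central.simps by (rule cmat.span_scale)
          thus ?case using Hf by simp
        qed (use fI in simp)
        thus False using nil E_nonzero[OF f(1)] unfolding nilpotent_lie_algebra_def by blast
      qed
      have Zb: "Z \<in> ?b" using Z Ib by blast
      have "Re (weight e z) > 0" if "e \<in> E" "coef Z e \<noteq> 0" for e
      proof -
        have "coef H e = 0" unfolding \<open>H = 0\<close> by (rule coef_zero)
        hence "weight e \<noteq> (\<lambda>_. 0)" unfolding H_def using that by (auto simp: coef_pr)
        thus ?thesis using Zb that by (auto simp: wsp_iff)
      qed
      thus "Z \<in> ?u" using Zb by (auto simp: wsp_iff)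
    qed
  qed
qed

lemma span_h_root_spaces:
  assumes A: "\<And>\<alpha>. \<alpha> \<in> A \<Longrightarrow> f \<alpha> \<in> weight ` E \<and> f \<alpha> \<noteq> (\<lambda>_. 0)"
  shows "cmat.span (h \<union> (\<Union>\<alpha>\<in>A. root_space L h (f \<alpha>))) = wsp (\<lambda>\<beta>. \<beta> = (\<lambda>_. 0) \<or> \<beta> \<in> f ` A)"
    (is "cmat.span ?S = wsp ?P")
proof
  have rs: "root_space L h (f \<alpha>) = wsp (\<lambda>\<beta>. \<beta> = f \<alpha>)" if "\<alpha> \<in> A" for \<alpha>
    by (rule root_space_eq_wsp) (use A[OF that] weight_outside in auto)
  show "cmat.span ?S \<subseteq> wsp ?P"
  proof (rule cmat.span_minimal[OF _ wsp_subspace], rule Un_least, rule_tac[2] UN_least)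
    show "h \<subseteq> wsp ?P"
    proof
      fix X assume "X \<in> h"
      hence "X \<in> wsp (\<lambda>\<alpha>. \<alpha> = (\<lambda>_. 0))" using h_iff by blast
      thus "X \<in> wsp ?P" by (rule wsp_mono) blast
    qed
    show "root_space L h (f \<alpha>) \<subseteq> wsp ?P" if "\<alpha> \<in> A" for \<alpha>
      unfolding rs[OF that] using that by (auto elim!: wsp_mono)
  qed
  show "wsp ?P \<subseteq> cmat.span ?S"
    unfolding wsp_def
  proof (rule cmat.span_mono, rule subsetI)
    fix e assume e: "e \<in> {e \<in> E. ?P (weight e)}"
    show "e \<in> ?S"
    proof (cases "weight e = (\<lambda>_. 0)")
      case True
      hence "e \<in> wsp (\<lambda>\<alpha>. \<alpha> = (\<lambda>_. 0))" using e by (auto intro: wsp_base)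
      thus ?thesis using h_iff by blast
    next
      case False
      then obtain \<alpha> where \<alpha>: "\<alpha> \<in> A" "weight e = f \<alpha>" using e by blast
      have "e \<in> root_space L h (f \<alpha>)"
        unfolding rs[OF \<alpha>(1)] using e \<alpha> by (auto intro: wsp_base)
      thus ?thesis using \<alpha>(1) by blast
    qed
  qed
qed

lemma positive_borel_eq:
  "positive_borel L h z = wsp (\<lambda>\<alpha>. \<alpha> = (\<lambda>_. 0) \<or> Re (\<alpha> z) > 0)"
proof -
  have "positive_borel L h z = wsp (\<lambda>\<beta>. \<beta> = (\<lambda>_. 0) \<or> \<beta> \<in> (\<lambda>\<alpha>. \<alpha>) ` positive_roots L h z)"
    unfolding positive_borel_def
    by (rule span_h_root_spaces) (auto simp: positive_roots_def roots_eq)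
  also have "\<dots> = wsp (\<lambda>\<alpha>. \<alpha> = (\<lambda>_. 0) \<or> Re (\<alpha> z) > 0)"
    by (rule wsp_cong) (auto simp: positive_roots_def roots_eq)
  finally show ?thesis .
qed

lemma negative_borel_eq:
  "negative_borel L h z = wsp (\<lambda>\<alpha>. \<alpha> = (\<lambda>_. 0) \<or> Re (\<alpha> z) < 0)"
proof -
  let ?f = "\<lambda>\<alpha> Y. - \<alpha> Y :: complex"
  have opp: "?f \<alpha> \<in> weight ` E \<and> ?f \<alpha> \<noteq> (\<lambda>_. 0)" if \<alpha>: "\<alpha> \<in> roots L h" for \<alpha>
  proof -
    obtain e where e: "e \<in> E" "weight e = \<alpha>" "\<alpha> \<noteq> (\<lambda>_. 0)" using root_obtain_basis[OF \<alpha>] .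
    obtain f where f: "f \<in> E" "weight f = (\<lambda>Y. - weight e Y)" using weight_opposite[OF e(1)] .
    have "?f \<alpha> = weight f" using e f by simp
    moreover have "?f \<alpha> \<noteq> (\<lambda>_. 0)" using e(3) by (auto simp: fun_eq_iff)
    ultimately show ?thesis using f(1) by blast
  qed
  have "negative_borel L h z = wsp (\<lambda>\<beta>. \<beta> = (\<lambda>_. 0) \<or> \<beta> \<in> ?f ` positive_roots L h z)"
    unfolding negative_borel_def
    by (rule span_h_root_spaces) (use opp in \<open>auto simp: positive_roots_def\<close>)
  also have "\<dots> = wsp (\<lambda>\<alpha>. \<alpha> = (\<lambda>_. 0) \<or> Re (\<alpha> z) < 0)"
  proof (rule wsp_cong)
    fix e assume e: "e \<in> E"
    have "weight e \<in> ?f ` positive_roots L h z" if neg: "Re (weight e z) < 0"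
    proof -
      have "weight e \<in> roots L h" using e neg unfolding roots_eq by auto
      hence "?f (weight e) \<in> roots L h" using opp[of "weight e"] roots_eq by blast
      hence "?f (weight e) \<in> positive_roots L h z" using neg by (simp add: positive_roots_def)
      thus ?thesis by (intro image_eqI[of _ ?f "?f (weight e)"]) simp_all
    qed
    thus "(weight e = (\<lambda>_. 0) \<or> weight e \<in> ?f ` positive_roots L h z)
        \<longleftrightarrow> (weight e = (\<lambda>_. 0) \<or> Re (weight e z) < 0)"
      by (auto simp: positive_roots_def)
  qed
  finally show ?thesis .
qed

lemma weight_minus: "e \<in> E \<Longrightarrow> z \<in> h \<Longrightarrow> weight e (- z) = - weight e z"
  using weight_scale[of e z "- 1"] by (simp add: cmat.scale_minus_left)

lemma nilradical_positive_borel: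
  assumes "\<And>e. e \<in> E \<Longrightarrow> weight e \<noteq> (\<lambda>_. 0) \<Longrightarrow> Re (weight e z) \<noteq> 0"
  shows "nilradical (positive_borel L h z) = wsp (\<lambda>\<alpha>. Re (\<alpha> z) > 0)"
  unfolding positive_borel_eq by (rule nilradical_borel[OF assms])

lemma nilradical_negative_borel:
  assumes z: "z \<in> h" and regular: "\<And>e. e \<in> E \<Longrightarrow> weight e \<noteq> (\<lambda>_. 0) \<Longrightarrow> Re (weight e z) \<noteq> 0"
  shows "nilradical (negative_borel L h z) = wsp (\<lambda>\<alpha>. Re (\<alpha> z) < 0)"
proof -
  have "negative_borel L h z = wsp (\<lambda>\<alpha>. \<alpha> = (\<lambda>_. 0) \<or> Re (\<alpha> (- z)) > 0)"
    unfolding negative_borel_eq by (rule wsp_cong) (simp add: weight_minus z)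
  moreover have "nilradical (wsp (\<lambda>\<alpha>. \<alpha> = (\<lambda>_. 0) \<or> Re (\<alpha> (- z)) > 0)) = wsp (\<lambda>\<alpha>. Re (\<alpha> (- z)) > 0)"
    by (rule nilradical_borel) (use regular weight_minus z in auto)
  moreover have "wsp (\<lambda>\<alpha>. Re (\<alpha> (- z)) > 0) = wsp (\<lambda>\<alpha>. Re (\<alpha> z) < 0)"
    by (rule wsp_cong) (simp add: weight_minus z)
  ultimately show ?thesis by simp
qed

lemma grade_nilradical_eq:
  assumes z: "z \<in> h" and real: "\<And>e. e \<in> E \<Longrightarrow> weight e z \<in> \<real>"
  shows "grade_nilradical L z = wsp (\<lambda>\<alpha>. Re (\<alpha> z) < 0)"
proof -
  have g: "grade L z m = wsp (\<lambda>\<alpha>. \<alpha> z = of_real m)" for m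
  proof -
    have "grade L z m = {X \<in> L. \<forall>Y\<in>{z}. lie_bracket Y X = of_real m *\<^sub>C X}"
      by (simp add: grade_def scaleR_eq_cscale)
    also have "\<dots> = wsp (\<lambda>\<alpha>. \<forall>Y\<in>{z}. \<alpha> Y = of_real m)"
      by (rule eigenspace_eq_wsp) (use z in simp)
    finally show ?thesis by simp
  qed
  show ?thesis
  proof
    show "grade_nilradical L z \<subseteq> wsp (\<lambda>\<alpha>. Re (\<alpha> z) < 0)"
      unfolding grade_nilradical_def
    proof (rule cmat.span_minimal[OF _ wsp_subspace], rule UN_least)
      fix m :: real assume "m \<in> {..<0}"
      thus "grade L z m \<subseteq> wsp (\<lambda>\<alpha>. Re (\<alpha> z) < 0)" unfolding g by (auto elim!: wsp_mono)
    qed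
    show "wsp (\<lambda>\<alpha>. Re (\<alpha> z) < 0) \<subseteq> grade_nilradical L z"
      unfolding wsp_def grade_nilradical_def
    proof (rule cmat.span_mono, rule subsetI)
      fix e assume e: "e \<in> {e \<in> E. Re (weight e z) < 0}"
      have "weight e z = of_real (Re (weight e z))" using real e by (simp add: of_real_Re)
      hence "e \<in> grade L z (Re (weight e z))" unfolding g using e by (intro wsp_base) auto
      thus "e \<in> (\<Union>m\<in>{..<0}. grade L z m)" using e by blast
    qed
  qed
qed

end

text \<open>A Weyl group element together with an element \<open>z\<close> of an open Weyl chamber, which determines the
  Borel subalgebras.\<close>

locale regular_weyl_element = weyl_element L h s
  for L h :: "(complex^'n^'n) set" and s :: "complex^'n^'n \<Rightarrow> complex^'n^'n" +
  fixes z :: "complex^'n^'n"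
  assumes z: "z \<in> h" and regular: "\<And>e. e \<in> E \<Longrightarrow> weight e \<noteq> (\<lambda>_. 0) \<Longrightarrow> Re (weight e z) \<noteq> 0"
begin

lemma weight_zero_iff: "e \<in> E \<Longrightarrow> weight e = (\<lambda>_. 0) \<longleftrightarrow> Re (weight e z) = 0"
  using regular by auto

abbreviation "neg \<equiv> \<lambda>\<alpha>. Re (\<alpha> z) < 0"
abbreviation "pos \<equiv> \<lambda>\<alpha>. Re (\<alpha> z) > 0"
abbreviation "nul \<equiv> \<lambda>\<alpha>. \<alpha> = (\<lambda>_. 0 :: complex)"

definition r :: "complex^'n^'n \<Rightarrow> complex^'n^'n"
  where "r = r_matrix L h s (nilradical (negative_borel L h z)) (nilradical (positive_borel L h z))"

lemma span_perp_fixed: "cmat.span (perp \<union> fixed) = wsp nul"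
proof
  have "perp \<union> fixed \<subseteq> wsp nul" using perp_h fixed_h h_iff by blast
  thus "cmat.span (perp \<union> fixed) \<subseteq> wsp nul" by (rule cmat.span_minimal[OF _ wsp_subspace])
  show "wsp nul \<subseteq> cmat.span (perp \<union> fixed)"
  proof
    fix X assume "X \<in> wsp nul"
    hence "X \<in> h" using h_iff by blast
    then obtain a f where "a \<in> perp" "f \<in> fixed" "X = a + f" by (rule perp_fixed_decomposition)
    thus "X \<in> cmat.span (perp \<union> fixed)" by (simp add: cmat.span_add cmat.span_base)
  qed
qed

lemma span_wsp_perp_fixed: "cmat.span (wsp P \<union> perp \<union> fixed) = wsp (\<lambda>\<alpha>. P \<alpha> \<or> nul \<alpha>)"
proof -
  have "cmat.span (wsp P \<union> (perp \<union> fixed)) = cmat.span (wsp P \<union> wsp nul)"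
    unfolding cmat.span_Un[of "wsp P"] span_perp_fixed
      cmat.span_eq_iff[THEN iffD2, OF wsp_subspace] ..
  thus ?thesis by (simp add: wsp_span_Un Un_assoc)
qed

lemma projection_wsp:
  assumes "X \<in> L"
  shows "projection (wsp P) (wsp (\<lambda>\<alpha>. \<not> P \<alpha>)) X = pr P X"
  unfolding projection_def
proof (rule the_equality)
  show "pr P X \<in> wsp P \<and> X - pr P X \<in> wsp (\<lambda>\<alpha>. \<not> P \<alpha>)"
    using pr_wsp pr_complement[OF assms] by blast
qed (use pr_unique assms in blast)

text \<open>Projecting to \<open>perp\<close> factors through the projection to the Cartan subalgebra, so the Cayley term
  of \<open>r\<close> does not see root vectors.\<close>

lemma projection_perp:
  assumes X: "X \<in> L"
  shows "projection perp (cmat.span (wsp neg \<union> wsp pos \<union> fixed)) X = projection perp fixed (pr nul X)"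
    (is "projection perp ?S X = _")
proof -
  let ?nn = "\<lambda>\<alpha>. \<not> nul \<alpha>"
  have S: "?S = {x + y |x y. x \<in> wsp ?nn \<and> y \<in> fixed}"
  proof -
    have "cmat.span (wsp neg \<union> wsp pos) = wsp ?nn"
      unfolding wsp_span_Un by (rule wsp_cong) (auto simp: weight_zero_iff)
    thus ?thesis
      unfolding cmat.span_Un[of "wsp neg \<union> wsp pos"]
      by (simp add: cmat.span_eq_iff[THEN iffD2, OF fixed_subspace])
  qed
  have "X - a \<in> ?S \<longleftrightarrow> pr nul X - a \<in> fixed" if a: "a \<in> perp" for a
  proof
    assume "X - a \<in> ?S"
    then obtain u f where uf: "X - a = u + f" "u \<in> wsp ?nn" "f \<in> fixed" unfolding S by blast
    have eq: "pr nul X - a - f = u - (X - pr nul X)" using uf(1) by (simp add: algebra_simps)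
    have "pr nul X - a - f \<in> wsp ?nn"
      unfolding eq using uf(2) pr_complement[OF X] by (rule cmat.subspace_diff[OF wsp_subspace])
    moreover have "pr nul X - a - f \<in> wsp nul"
    proof -
      have "a \<in> wsp nul" "f \<in> wsp nul" using perp_h[OF a] fixed_h[OF uf(3)] h_iff by blast+
      thus ?thesis using pr_wsp wsp_subspace by (simp add: cmat.subspace_diff)
    qed
    ultimately have "pr nul X - a - f = 0" by (rule wsp_disjoint) blast
    thus "pr nul X - a \<in> fixed" using uf(3) by simp
  next
    assume f: "pr nul X - a \<in> fixed"
    have "X - a = (X - pr nul X) + (pr nul X - a)" by simp
    thus "X - a \<in> ?S" unfolding S using f pr_complement[OF X, of nul] by blast
  qed
  hence "(\<lambda>a. a \<in> perp \<and> X - a \<in> ?S) = (\<lambda>a. a \<in> perp \<and> pr nul X - a \<in> fixed)" by blast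
  thus ?thesis unfolding projection_def by simp
qed

lemma projection_perp_in_perp:
  assumes "H \<in> h"
  shows "projection perp fixed H \<in> perp"
proof -
  obtain a f where af: "a \<in> perp" "f \<in> fixed" "H = a + f" using perp_fixed_decomposition[OF assms] .
  have "projection perp fixed H = a"
    unfolding projection_def
  proof (rule the_equality)
    fix b assume b: "b \<in> perp \<and> H - b \<in> fixed"
    have "b - a \<in> perp" using b af(1) perp_subspace by (simp add: cmat.subspace_diff)
    moreover have "f - (H - b) \<in> fixed"
      using af(2) b fixed_subspace by (blast intro: cmat.subspace_diff)
    hence "b - a \<in> fixed" by (simp add: af(3))
    ultimately have "b - a = 0" by (rule perp_fixed)
    thus "b = a" by simp
  qed (use af in simp)
  thus ?thesis using af(1) by simp
qed

lemma r_eq: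
  assumes X: "X \<in> L"
  shows "r X = pr neg X - pr pos X + cayley s perp (projection perp fixed (pr nul X))"
proof -
  have k: "nilradical (negative_borel L h z) = wsp neg" "nilradical (positive_borel L h z) = wsp pos"
    using nilradical_negative_borel[OF z regular] nilradical_positive_borel[OF regular] by simp_all
  have c: "wsp (\<lambda>\<alpha>. pos \<alpha> \<or> nul \<alpha>) = wsp (\<lambda>\<alpha>. \<not> neg \<alpha>)" "wsp (\<lambda>\<alpha>. neg \<alpha> \<or> nul \<alpha>) = wsp (\<lambda>\<alpha>. \<not> pos \<alpha>)"
    by (safe elim!: wsp_mono) (auto simp: weight_zero_iff)
  show ?thesis
    unfolding r_def r_matrix_def Let_def k fixed_def[symmetric] perp_def[symmetric]
      span_wsp_perp_fixed c projection_wsp[OF X] projection_perp[OF X] ..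
qed

text \<open>Root vectors of negative roots only contribute to the first term of \<open>r\<close>.\<close>

lemma r_additive_on_negative:
  assumes X: "X \<in> L" and Z: "Z \<in> wsp neg"
  shows "r (X + Z) = r X + Z"
proof -
  have ZL: "Z \<in> L" using Z by (rule wsp_L)
  have "pr neg Z = Z" using Z by (rule pr_inside)
  moreover have "pr pos Z = 0" using Z by (rule pr_outside) simp
  moreover have "pr nul Z = 0" using Z by (rule pr_outside) auto
  ultimately show ?thesis
    using X ZL L_subspace by (simp add: r_eq pr_add cmat.subspace_add)
qed

lemma r_preserves:
  assumes X: "X \<in> wsp P" and P: "P (\<lambda>_. 0)"
  shows "r X \<in> wsp P"
proof -
  have "pr nul X \<in> h" using pr_wsp h_iff by blast
  hence "cayley s perp (projection perp fixed (pr nul X)) \<in> h"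
    by (intro cayley_h projection_perp_in_perp)
  hence "cayley s perp (projection perp fixed (pr nul X)) \<in> wsp nul" using h_iff by blast
  hence "cayley s perp (projection perp fixed (pr nul X)) \<in> wsp P" by (rule wsp_mono) (use P in simp)
  thus ?thesis
    unfolding r_eq[OF wsp_L[OF X]]
    using pr_subset[OF X] wsp_subspace by (simp add: cmat.subspace_add cmat.subspace_diff)
qed

end

section \<open>The Weyl chamber of a decomposition\<close>

context cartan_pair begin

lemma weight_sum:
  assumes "finite A" "e \<in> E" "\<And>j. j \<in> A \<Longrightarrow> u j \<in> h"
  shows "weight e (\<Sum>j\<in>A. u j) = (\<Sum>j\<in>A. weight e (u j))"
  using assms
proof (induction A rule: finite_induct)
  case empty
  thus ?case using weight_scale[OF _ cmat.subspace_0[OF h_subspace], of e 0] by simp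
next
  case (insert a A)
  have "(\<Sum>j\<in>A. u j) \<in> h" using insert by (intro cmat.subspace_sum[OF h_subspace]) simp
  thus ?case using insert by (simp add: weight_add)
qed

text \<open>The last \<open>\<eta> i\<close> on which a root does not vanish dominates the sum of the earlier ones, so it
  determines the sign of the root on \<open>\<eta>bar\<close>, and for \<open>i > 0\<close> also on \<open>\<eta>bar0\<close>. It exists because a
  root has the value \<open>2\<close> on its coroot, hence does not vanish on all \<open>V i\<close>.\<close>

lemma chamber_of_decomposition:
  fixes K M :: nat and \<iota> :: "nat \<Rightarrow> nat"
  assumes dec: "weyl_decomposition L h s K V"
    and \<eta>V: "\<forall>i\<le>K. \<eta> i \<in> V i"
    and \<eta>nz: "\<forall>i\<le>K. \<forall>\<alpha>\<in>roots L h. (\<exists>x\<in>V i. \<alpha> x \<noteq> 0) \<longrightarrow> \<alpha> (\<eta> i) \<noteq> 0"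
    and mono: "strict_mono_on {..M} \<iota>"
    and img: "\<iota> ` {..M} = {i. i \<le> K \<and> root_stratum L h K \<eta> i \<noteq> {}}"
    and dom: "\<forall>m\<le>M. \<forall>l<m. \<forall>\<alpha>\<in>root_stratum L h K \<eta> (\<iota> m).
           cmod (\<alpha> (\<eta> (\<iota> m))) > cmod (\<Sum>j\<in>{l..<m}. \<alpha> (\<eta> (\<iota> j)))"
    and bar: "\<eta>bar = (\<Sum>m\<le>M. \<eta> (\<iota> m))"
    and bar0: "\<eta>bar0 = (\<Sum>m | m \<le> M \<and> \<iota> m > 0. \<eta> (\<iota> m))"
  shows "\<eta>bar \<in> h" "\<eta>bar0 \<in> h"
    "\<And>e. e \<in> E \<Longrightarrow> weight e \<eta>bar0 \<in> \<real>"
    "\<And>e. e \<in> E \<Longrightarrow> weight e \<noteq> (\<lambda>_. 0) \<Longrightarrow> Re (weight e \<eta>bar) \<noteq> 0"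
    "\<And>e. e \<in> E \<Longrightarrow> Re (weight e \<eta>bar0) < 0 \<Longrightarrow> Re (weight e \<eta>bar) < 0"
proof -
  have \<iota>K: "\<iota> m \<le> K" if "m \<le> M" for m using img that by blast
  have V: "V i \<subseteq> real_cartan L h" if "i \<le> K" for i
    using dec[unfolded weyl_decomposition_def, THEN conjunct1] that by blast
  have \<eta>rc: "\<eta> i \<in> h \<and> (\<forall>e\<in>E. weight e (\<eta> i) \<in> \<real>)" if "i \<le> K" for i
    using \<eta>V V[OF that] that by (intro real_cartan_real) blast
  have \<eta>h: "\<eta> (\<iota> m) \<in> h" if "m \<le> M" for m using \<eta>rc[OF \<iota>K[OF that]] by blast
  show "\<eta>bar \<in> h" unfolding bar using \<eta>h by (intro cmat.subspace_sum[OF h_subspace]) simp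
  show "\<eta>bar0 \<in> h" unfolding bar0 using \<eta>h by (intro cmat.subspace_sum[OF h_subspace]) simp
  define a where "a e j = Re (weight e (\<eta> (\<iota> j)))" for e j
  have a: "weight e (\<eta> (\<iota> j)) = of_real (a e j)" if "e \<in> E" "j \<le> M" for e j
    unfolding a_def using \<eta>rc[OF \<iota>K[OF that(2)]] that(1) by (simp add: of_real_Re)
  have w: "weight e (\<Sum>j\<in>A. \<eta> (\<iota> j)) = of_real (\<Sum>j\<in>A. a e j)" if "e \<in> E" "A \<subseteq> {..M}" for e A
  proof -
    have fin: "finite A" by (rule finite_subset[OF that(2)]) simp
    have le: "j \<le> M" if "j \<in> A" for j using that \<open>A \<subseteq> {..M}\<close> by auto
    have "weight e (\<Sum>j\<in>A. \<eta> (\<iota> j)) = (\<Sum>j\<in>A. weight e (\<eta> (\<iota> j)))"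
      by (rule weight_sum[OF fin that(1)]) (rule \<eta>h[OF le])
    also have "\<dots> = (\<Sum>j\<in>A. of_real (a e j))"
      by (intro sum.cong refl) (rule a[OF that(1) le])
    finally show ?thesis by simp
  qed
  have wbar: "weight e \<eta>bar = of_real (\<Sum>j\<in>{0..M}. a e j)" if "e \<in> E" for e
    unfolding bar using w[OF that, of "{..M}"] by (simp add: atLeast0AtMost)
  have wbar0: "weight e \<eta>bar0 = of_real (\<Sum>j\<in>{j. j \<le> M \<and> \<iota> j > 0}. a e j)" if "e \<in> E" for e
    unfolding bar0 by (rule w[OF that]) blast
  show "weight e \<eta>bar0 \<in> \<real>" if "e \<in> E" for e unfolding wbar0[OF that] by (rule Reals_of_real)
  have key: "\<exists>m\<le>M. a e m \<noteq> 0 \<and> (\<forall>l\<le>m. \<bar>\<Sum>j\<in>{l..<m}. a e j\<bar> < \<bar>a e m\<bar>) \<and>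
      (\<forall>j\<le>M. \<iota> j > \<iota> m \<longrightarrow> a e j = 0)"
    if e: "e \<in> E" and nz: "weight e \<noteq> (\<lambda>_. 0)" for e
  proof -
    let ?\<alpha> = "weight e"
    have \<alpha>: "?\<alpha> \<in> roots L h" using e nz unfolding roots_eq by blast
    obtain \<kappa> where c: "coroot L h ?\<alpha> \<in> h" "?\<alpha> (coroot L h ?\<alpha>) = 2"
      using coroot_properties[OF \<alpha>] by metis
    have "coroot L h ?\<alpha> \<in> real_cartan L h"
      unfolding real_cartan_def using \<alpha> by (intro span_base imageI)
    moreover have "real_cartan L h = {\<Sum>i\<le>K. x i |x. \<forall>i\<le>K. x i \<in> V i}"
      using dec unfolding weyl_decomposition_def by blast
    ultimately obtain x where x: "coroot L h ?\<alpha> = (\<Sum>i\<le>K. x i)" "\<forall>i\<le>K. x i \<in> V i" by blast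
    have xh: "x i \<in> h" if "i \<le> K" for i using x(2) V[OF that] that real_cartan_real by blast
    have two: "(\<Sum>i\<le>K. ?\<alpha> (x i)) = 2"
      using weight_sum[OF finite_atMost e, of K x] xh c(2) x(1) by simp
    have "\<exists>i\<in>{..K}. ?\<alpha> (x i) \<noteq> 0"
    proof (rule ccontr)
      assume "\<not> ?thesis"
      hence "(\<Sum>i\<le>K. ?\<alpha> (x i)) = 0" by (intro sum.neutral) blast
      thus False using two by simp
    qed
    then obtain i where i: "i \<le> K" "?\<alpha> (x i) \<noteq> 0" by blast
    hence "?\<alpha> (\<eta> i) \<noteq> 0" using \<eta>nz \<alpha> x(2) by blast
    define I where "I = {i. i \<le> K \<and> ?\<alpha> (\<eta> i) \<noteq> 0}"
    have I: "finite I" "I \<noteq> {}" unfolding I_def using i \<open>?\<alpha> (\<eta> i) \<noteq> 0\<close> by auto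
    have I_iff: "j \<in> I \<longleftrightarrow> j \<le> K \<and> ?\<alpha> (\<eta> j) \<noteq> 0" for j by (simp add: I_def)
    have max: "Max I \<le> K" "?\<alpha> (\<eta> (Max I)) \<noteq> 0" using Max_in[OF I] I_iff by blast+
    have above: "?\<alpha> (\<eta> j) = 0" if "Max I < j" "j \<le> K" for j
    proof (rule ccontr)
      assume "?\<alpha> (\<eta> j) \<noteq> 0"
      hence "j \<in> I" using that I_iff by blast
      thus False using Max_ge[OF I(1)] that(1) by fastforce
    qed
    have str: "?\<alpha> \<in> root_stratum L h K \<eta> (Max I)"
      unfolding root_stratum_def using \<alpha> above max(2) by blast
    hence "Max I \<in> \<iota> ` {..M}" unfolding img using max(1) by blast
    then obtain m where m: "m \<le> M" "Max I = \<iota> m" by blast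
    have am: "a e m \<noteq> 0" using max(2) a[OF e m(1)] m(2) by auto
    have "\<bar>\<Sum>j\<in>{l..<m}. a e j\<bar> < \<bar>a e m\<bar>" if "l \<le> m" for l
    proof (cases "l = m")
      case False
      hence "l < m" using that by simp
      hence "cmod (?\<alpha> (\<eta> (\<iota> m))) > cmod (\<Sum>j\<in>{l..<m}. ?\<alpha> (\<eta> (\<iota> j)))"
        using dom m str by simp
      moreover have "(\<Sum>j\<in>{l..<m}. ?\<alpha> (\<eta> (\<iota> j))) = of_real (\<Sum>j\<in>{l..<m}. a e j)"
        unfolding of_real_sum using a[OF e] m(1) by (intro sum.cong refl) simp
      ultimately show ?thesis using a[OF e m(1)] by (simp del: of_real_sum)
    qed (use am in simp)
    moreover have "a e j = 0" if "j \<le> M" "\<iota> j > \<iota> m" for j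
      using above[of "\<iota> j"] that m \<iota>K a_def by simp
    ultimately show ?thesis using m am by blast
  qed
  have tail: "(\<Sum>j\<in>{l..M}. a e j) = a e m + (\<Sum>j\<in>{l..<m}. a e j)"
    if "l \<le> m" "m \<le> M" "\<forall>j\<le>M. \<iota> j > \<iota> m \<longrightarrow> a e j = 0" for e l m
  proof -
    have z: "a e j = 0" if "j \<in> {m<..M}" for j
      using strict_mono_onD[OF mono, of m j] \<open>m \<le> M\<close> that \<open>\<forall>j\<le>M. \<iota> j > \<iota> m \<longrightarrow> a e j = 0\<close> by auto
    have "{l..m} \<inter> {m<..M} = {}" by auto
    moreover have "{l..M} = {l..m} \<union> {m<..M}" using that by auto
    ultimately have "(\<Sum>j\<in>{l..M}. a e j) = (\<Sum>j\<in>{l..m}. a e j) + (\<Sum>j\<in>{m<..M}. a e j)"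
      by (simp add: sum.union_disjoint)
    also have "(\<Sum>j\<in>{m<..M}. a e j) = 0" using z by (rule sum.neutral[rule_format])
    also have "{l..m} = insert m {l..<m}" using that by auto
    finally show ?thesis by simp
  qed
  show "Re (weight e \<eta>bar) \<noteq> 0" if e: "e \<in> E" and nz: "weight e \<noteq> (\<lambda>_. 0)" for e
  proof -
    obtain m where m: "m \<le> M" "a e m \<noteq> 0" "\<forall>l\<le>m. \<bar>\<Sum>j\<in>{l..<m}. a e j\<bar> < \<bar>a e m\<bar>"
      "\<forall>j\<le>M. \<iota> j > \<iota> m \<longrightarrow> a e j = 0"
      using key[OF e nz] by blast
    have "\<bar>\<Sum>j\<in>{0..<m}. a e j\<bar> < \<bar>a e m\<bar>" using m(3) by blast
    thus ?thesis
      unfolding wbar[OF e] tail[of 0 m e, OF _ m(1,4), simplified] by simp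
  qed
  show "Re (weight e \<eta>bar) < 0" if e: "e \<in> E" and neg: "Re (weight e \<eta>bar0) < 0" for e
  proof -
    have "weight e \<noteq> (\<lambda>_. 0)" using neg by auto
    then obtain m where m: "m \<le> M" "a e m \<noteq> 0" "\<forall>l\<le>m. \<bar>\<Sum>j\<in>{l..<m}. a e j\<bar> < \<bar>a e m\<bar>"
      "\<forall>j\<le>M. \<iota> j > \<iota> m \<longrightarrow> a e j = 0"
      using key[OF e] by blast
    have sum0: "(\<Sum>j\<in>{j. j \<le> M \<and> \<iota> j > 0}. a e j) < 0" using neg wbar0[OF e] by simp
    have \<iota>m: "\<iota> m > 0"
    proof (rule ccontr)
      assume "\<not> \<iota> m > 0"
      hence "(\<Sum>j\<in>{j. j \<le> M \<and> \<iota> j > 0}. a e j) = 0" using m(4) by (intro sum.neutral) simp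
      thus False using sum0 by simp
    qed
    define l where "l = (if \<iota> 0 = 0 then 1 else 0 :: nat)"
    have lt: "\<iota> 0 < \<iota> j" if "0 < j" "j \<le> M" for j
      using strict_mono_onD[OF mono, of 0 j] that by simp
    have set: "{j. j \<le> M \<and> \<iota> j > 0} = {l..M}"
    proof (intro set_eqI)
      fix j
      show "j \<in> {j. j \<le> M \<and> \<iota> j > 0} \<longleftrightarrow> j \<in> {l..M}"
        using lt[of j] by (cases "j = 0") (auto simp: l_def)
    qed
    have lm: "l \<le> m" using \<iota>m by (cases "m = 0") (auto simp: l_def)
    have "a e m + (\<Sum>j\<in>{l..<m}. a e j) < 0"
      using sum0 unfolding set tail[OF lm m(1,4)] .
    moreover have "\<bar>\<Sum>j\<in>{l..<m}. a e j\<bar> < \<bar>a e m\<bar>" using m(3) lm by blast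
    ultimately have "a e m < 0" by linarith
    moreover have "\<bar>\<Sum>j\<in>{0..<m}. a e j\<bar> < \<bar>a e m\<bar>" using m(3) by blast
    moreover have "Re (weight e \<eta>bar) = a e m + (\<Sum>j\<in>{0..<m}. a e j)"
      unfolding wbar[OF e] using tail[of 0 m e, OF _ m(1,4)] by (simp del: of_real_sum)
    ultimately show ?thesis by linarith
  qed
qed

end

section \<open>The adjoint action\<close>

definition Ad :: "complex^'n^'n \<Rightarrow> complex^'n^'n \<Rightarrow> complex^'n^'n"
  where "Ad g X = g ** X ** matrix_inv g"

lemma matrix_groupD:
  assumes "matrix_group G"
  shows "A \<in> G \<Longrightarrow> invertible A" "mat 1 \<in> G" "A \<in> G \<Longrightarrow> C \<in> G \<Longrightarrow> A ** C \<in> G"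
    "A \<in> G \<Longrightarrow> matrix_inv A \<in> G"
  using assms unfolding matrix_group_def by blast+

lemma clinear_Ad: "clinear (Ad g)"
  by (rule clinearI)
    (simp_all add: Ad_def mmult.add_left mmult.add_right cscale_mult_left cscale_mult_right)

lemma Ad_inverse:
  assumes "invertible g"
  shows "Ad (matrix_inv g) (Ad g X) = X" "Ad g (Ad (matrix_inv g) X) = X"
proof -
  note i = matrix_inv_cancel[OF assms]
  note ii = matrix_inv_inv[OF assms]
  have "Ad (matrix_inv g) (Ad g X) = (matrix_inv g ** g) ** X ** (matrix_inv g ** g)"
    unfolding Ad_def ii by (simp only: matrix_mul_assoc)
  thus "Ad (matrix_inv g) (Ad g X) = X" by (simp add: i)
  have "Ad g (Ad (matrix_inv g) X) = (g ** matrix_inv g) ** X ** (g ** matrix_inv g)"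
    unfolding Ad_def ii by (simp only: matrix_mul_assoc)
  thus "Ad g (Ad (matrix_inv g) X) = X" by (simp add: i)
qed

lemma Ad_mult:
  assumes "invertible a" "invertible b"
  shows "Ad (a ** b) X = Ad a (Ad b X)"
  unfolding Ad_def matrix_inv_mult[OF assms] by (simp only: matrix_mul_assoc)

lemma Ad_bracket:
  assumes "invertible g"
  shows "Ad g (lie_bracket X Y) = lie_bracket (Ad g X) (Ad g Y)"
proof -
  note i = matrix_inv_cancel[OF assms]
  have m: "Ad g X ** Ad g Y = g ** (X ** Y) ** matrix_inv g" for X Y
  proof -
    have "Ad g X ** Ad g Y = g ** X ** (matrix_inv g ** g) ** Y ** matrix_inv g"
      unfolding Ad_def by (simp only: matrix_mul_assoc)
    thus ?thesis unfolding i(2) by (simp add: matrix_mul_assoc)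
  qed
  show ?thesis
    unfolding lie_bracket_def m by (simp add: Ad_def mmult.diff_left mmult.diff_right)
qed

lemma matrix_exp_Ad_group:
  assumes "invertible g"
  shows "matrix_exp (t *\<^sub>R Ad g X) = g ** matrix_exp (t *\<^sub>R X) ** matrix_inv g"
proof -
  have "t *\<^sub>R Ad g X = g ** (t *\<^sub>R X) ** matrix_inv g"
    unfolding Ad_def by (simp only: mmult.scaleR_left mmult.scaleR_right)
  thus ?thesis
    using matrix_exp_conj[OF matrix_inv_cancel(2,1)[OF assms]] by simp
qed

lemma Ad_lie_algebra:
  assumes "matrix_group G" "g \<in> G" "X \<in> lie_algebra G"
  shows "Ad g X \<in> lie_algebra G"
  unfolding lie_algebra_def
proof (intro CollectI allI)
  fix t :: real
  have "matrix_exp (t *\<^sub>R X) \<in> G" using assms(3) unfolding lie_algebra_def by blast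
  thus "matrix_exp (t *\<^sub>R Ad g X) \<in> G"
    unfolding matrix_exp_Ad_group[OF matrix_groupD(1)[OF assms(1,2)]]
    using assms(2) by (intro matrix_groupD[OF assms(1)])
qed

section \<open>Generated subgroups\<close>

lemma generated_subgroup:
  assumes G: "matrix_group G" and S: "S \<subseteq> G"
  shows "matrix_group (generated_subgroup G S)" "generated_subgroup G S \<subseteq> G"
    "S \<subseteq> generated_subgroup G S"
proof -
  let ?F = "{H. matrix_group H \<and> H \<subseteq> G \<and> S \<subseteq> H}"
  have "G \<in> ?F" using assms by simp
  thus sub: "generated_subgroup G S \<subseteq> G" unfolding generated_subgroup_def by (rule Inter_lower)
  show "S \<subseteq> generated_subgroup G S" unfolding generated_subgroup_def by (rule Inter_greatest) simp
  have el: "A \<in> H" if "A \<in> generated_subgroup G S" "H \<in> ?F" for A H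
    using that unfolding generated_subgroup_def by (rule InterD)
  show "matrix_group (generated_subgroup G S)"
    unfolding matrix_group_def
  proof (intro conjI ballI)
    fix A assume A: "A \<in> generated_subgroup G S"
    show "invertible A" using A sub matrix_groupD(1)[OF G] by blast
    show "matrix_inv A \<in> generated_subgroup G S"
      unfolding generated_subgroup_def[of G S]
    proof (rule InterI)
      fix H assume H: "H \<in> ?F"
      hence "matrix_group H" by simp
      thus "matrix_inv A \<in> H" using el[OF A H] by (rule matrix_groupD(4))
    qed
    fix C assume C: "C \<in> generated_subgroup G S"
    show "A ** C \<in> generated_subgroup G S"
      unfolding generated_subgroup_def[of G S]
    proof (rule InterI)
      fix H assume H: "H \<in> ?F"
      hence "matrix_group H" by simp
      thus "A ** C \<in> H" using el[OF A H] el[OF C H] by (rule matrix_groupD(3))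
    qed
  next
    show "mat 1 \<in> generated_subgroup G S"
      unfolding generated_subgroup_def[of G S]
      by (rule InterI) (use matrix_groupD(2) in blast)
  qed
qed

lemma generated_subgroup_induct:
  assumes "A \<in> generated_subgroup G S" "matrix_group H" "H \<subseteq> G" "S \<subseteq> H"
  shows "A \<in> H"
  using assms unfolding generated_subgroup_def by blast

section \<open>The parabolic subalgebra and the unipotent subgroup\<close>

text \<open>The element \<open>z0\<close> grades the parabolic subalgebra. It may vanish on roots, unlike the chamber element
  \<open>z\<close>; the last condition puts the Borel subalgebra of \<open>z\<close> inside the parabolic subalgebra of \<open>z0\<close>.\<close>

locale weyl_parabolic = regular_weyl_element L h s z
  for L h :: "(complex^'n^'n) set" and s :: "complex^'n^'n \<Rightarrow> complex^'n^'n" and z :: "complex^'n^'n" +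
  fixes G :: "(complex^'n^'n) set" and z0 :: "complex^'n^'n"
  assumes G: "matrix_group G" and L: "L = lie_algebra G"
    and z0: "z0 \<in> h" and z0_real: "\<And>e. e \<in> E \<Longrightarrow> weight e z0 \<in> \<real>"
    and z0_z: "\<And>e. e \<in> E \<Longrightarrow> Re (weight e z0) < 0 \<Longrightarrow> Re (weight e z) < 0"
begin

definition \<nn> :: "(complex^'n^'n) set" where "\<nn> = wsp (\<lambda>\<alpha>. Re (\<alpha> z0) < 0)"

definition \<pp> :: "(complex^'n^'n) set" where "\<pp> = wsp (\<lambda>\<alpha>. Re (\<alpha> z0) \<le> 0)"

definition N :: "(complex^'n^'n) set" where "N = subgroup_of_subalgebra G (grade_nilradical L z0)"

lemma nn_subspace: "cmat.subspace \<nn>" and pp_subspace: "cmat.subspace \<pp>"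
  by (simp_all add: \<nn>_def \<pp>_def wsp_subspace)

lemma nn_pp: "X \<in> \<nn> \<Longrightarrow> X \<in> \<pp>" and nn_neg: "X \<in> \<nn> \<Longrightarrow> X \<in> wsp neg"
  and pp_L: "X \<in> \<pp> \<Longrightarrow> X \<in> L" and nn_L: "X \<in> \<nn> \<Longrightarrow> X \<in> L"
  unfolding \<nn>_def \<pp>_def by (auto elim!: wsp_mono simp: z0_z dest: wsp_L)

lemma nn_pp_bracket: "Z \<in> \<nn> \<Longrightarrow> X \<in> \<pp> \<Longrightarrow> lie_bracket Z X \<in> \<nn>"
  unfolding \<nn>_def \<pp>_def by (rule wsp_bracket) auto

lemma pp_nn_orthogonal:
  assumes "X \<in> \<pp>" "Z \<in> \<nn>"
  shows "B X Z = 0" "B Z X = 0"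
proof -
  show "B X Z = 0"
    by (rule wsp_orthogonal[OF _ assms[unfolded \<nn>_def \<pp>_def]]) auto
  thus "B Z X = 0" using killing_sym[OF pp_L[OF assms(1)] nn_L[OF assms(2)]] by simp
qed

text \<open>Together with the previous lemma: \<open>\<pp>\<close> is the orthogonal complement of \<open>\<nn>\<close>.\<close>

lemma nn_perp:
  assumes "X \<in> L" "\<And>Z. Z \<in> \<nn> \<Longrightarrow> B Z X = 0"
  shows "X \<in> \<pp>"
proof -
  have "X \<in> wsp (\<lambda>\<alpha>. \<not> Re ((\<lambda>Y. - \<alpha> Y) z0) < 0)"
    by (rule wsp_perp[OF assms(1)])
      (use assms nn_L killing_sym[OF assms(1)] in \<open>simp flip: \<nn>_def\<close>)
  thus ?thesis unfolding \<pp>_def by (rule wsp_mono) simp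
qed

lemma exp_G: "X \<in> L \<Longrightarrow> matrix_exp (t *\<^sub>R X) \<in> G"
  unfolding L lie_algebra_def by blast

lemma N_eq: "N = generated_subgroup G (matrix_exp ` \<nn>)"
proof -
  have "grade_nilradical L z0 = \<nn>"
    unfolding \<nn>_def by (rule grade_nilradical_eq[OF z0]) (rule z0_real)
  thus ?thesis by (simp add: N_def subgroup_of_subalgebra_def)
qed

lemma exp_nn_G: "matrix_exp ` \<nn> \<subseteq> G"
  using exp_G[OF nn_L, of _ 1] by auto

lemma N_group: "matrix_group N" and N_G: "N \<subseteq> G" and exp_nn_N: "Z \<in> \<nn> \<Longrightarrow> matrix_exp Z \<in> N"
  unfolding N_eq using generated_subgroup[OF G exp_nn_G] by blast+

lemma Ad_exp_nn:
  assumes Z: "Z \<in> \<nn>" and X: "X \<in> \<pp>"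
  shows "Ad (matrix_exp Z) X - X \<in> \<nn>"
proof -
  have "Z \<in> wsp (\<lambda>\<alpha>. Re (\<alpha> (- z0)) > 0)"
    using Z unfolding \<nn>_def by (rule wsp_mono) (simp add: weight_minus z0)
  then obtain m where m: "(lie_bracket Z ^^ m) X = 0" using ad_nilpotent pp_L[OF X] by metis
  let ?u = "\<lambda>j. (1 / fact j) *\<^sub>R (lie_bracket Z ^^ j) X"
  have exp: "Ad (matrix_exp Z) X = (\<Sum>j<m. ?u j)"
    unfolding Ad_def matrix_inv_exp by (rule matrix_exp_Ad[OF m])
  have pow: "(lie_bracket Z ^^ j) X \<in> \<pp>" for j
    by (induction j) (use X nn_pp_bracket[OF Z] nn_pp in auto)
  have "?u (Suc j) \<in> \<nn>" for j
    unfolding scaleR_eq_cscale funpow.simps o_apply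
    by (intro cmat.subspace_scale[OF nn_subspace] nn_pp_bracket[OF Z] pow)
  hence sum: "(\<Sum>j<k. ?u (Suc j)) \<in> \<nn>" for k by (intro cmat.subspace_sum[OF nn_subspace])
  show ?thesis
  proof (cases m)
    case 0
    thus ?thesis using m exp cmat.subspace_0[OF nn_subspace] by simp
  next
    case (Suc k)
    have "Ad (matrix_exp Z) X - X = (\<Sum>j<k. ?u (Suc j))"
      unfolding exp Suc sum.lessThan_Suc_shift by (simp del: funpow.simps(2) fact_Suc)
    thus ?thesis using sum by simp
  qed
qed

text \<open>The elements that act on \<open>\<pp>\<close> modulo \<open>\<nn>\<close> as the identity form a group.\<close>

lemma Ad_N:
  assumes "g \<in> N" "X \<in> \<pp>"
  shows "Ad g X - X \<in> \<nn>"
proof -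
  define H where "H = {g \<in> G. \<forall>X\<in>\<pp>. Ad g X - X \<in> \<nn> \<and> Ad (matrix_inv g) X - X \<in> \<nn>}"
  have mult: "Ad (a ** c) X - X \<in> \<nn>"
    if a: "invertible a" "\<forall>X\<in>\<pp>. Ad a X - X \<in> \<nn>" and c: "invertible c" "\<forall>X\<in>\<pp>. Ad c X - X \<in> \<nn>"
      and X: "X \<in> \<pp>" for a c X
  proof -
    have cX: "Ad c X - X \<in> \<nn>" using c X by blast
    have "Ad c X \<in> \<pp>"
      using cmat.subspace_add[OF pp_subspace nn_pp[OF cX] X] by simp
    hence "Ad a (Ad c X) - Ad c X \<in> \<nn>" using a by blast
    from cmat.subspace_add[OF nn_subspace this cX] show ?thesis
      by (simp add: Ad_mult[OF a(1) c(1)])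
  qed
  have "matrix_group H"
    unfolding matrix_group_def
  proof (intro conjI ballI)
    fix a assume a: "a \<in> H"
    hence aG: "a \<in> G" by (simp add: H_def)
    show "invertible a" by (rule matrix_groupD(1)[OF G aG])
    show "matrix_inv a \<in> H"
      using a matrix_groupD(4)[OF G aG] matrix_inv_inv[OF matrix_groupD(1)[OF G aG]]
      by (simp add: H_def)
    fix c assume c: "c \<in> H"
    hence cG: "c \<in> G" by (simp add: H_def)
    note inv = matrix_groupD(1)[OF G]
    have "Ad (a ** c) X - X \<in> \<nn>" if "X \<in> \<pp>" for X
      using a c that by (intro mult inv aG cG) (simp_all add: H_def)
    moreover have "Ad (matrix_inv (a ** c)) X - X \<in> \<nn>" if "X \<in> \<pp>" for X
      unfolding matrix_inv_mult[OF inv[OF aG] inv[OF cG]]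
      using a c that by (intro mult inv matrix_groupD(4)[OF G] aG cG) (simp_all add: H_def)
    ultimately show "a ** c \<in> H"
      using matrix_groupD(3)[OF G aG cG] by (simp add: H_def)
  next
    have "matrix_inv (mat 1 :: complex^'n^'n) = mat 1" by (rule matrix_inv_eq) simp_all
    thus "mat 1 \<in> H"
      using matrix_groupD(2)[OF G] cmat.subspace_0[OF nn_subspace] by (simp add: H_def Ad_def)
  qed
  moreover have "H \<subseteq> G" by (auto simp: H_def)
  moreover have "matrix_exp ` \<nn> \<subseteq> H"
  proof (rule image_subsetI)
    fix Z assume Z: "Z \<in> \<nn>"
    have "(- 1) *\<^sub>C Z \<in> \<nn>" by (rule cmat.subspace_scale[OF nn_subspace Z])
    hence "- Z \<in> \<nn>" by (simp add: cmat.scale_minus_left)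
    thus "matrix_exp Z \<in> H"
      unfolding H_def using Z Ad_exp_nn exp_nn_G by (auto simp: matrix_inv_exp)
  qed
  ultimately have "g \<in> H"
    using assms(1) unfolding N_eq by (intro generated_subgroup_induct[of g G "matrix_exp ` \<nn>" H])
  thus ?thesis using assms(2) by (simp add: H_def)
qed

lemma Ad_L: "g \<in> G \<Longrightarrow> X \<in> L \<Longrightarrow> Ad g X \<in> L"
  using Ad_lie_algebra[OF G] L by simp

text \<open>\<open>ad (Ad g X)\<close> is conjugate to \<open>ad X\<close> by \<open>Ad g\<close>, and conjugation preserves traces.\<close>

lemma killing_Ad:
  assumes g: "g \<in> G" and X: "X \<in> L" and Y: "Y \<in> L"
  shows "B (Ad g X) (Ad g Y) = B X Y"
proof -
  have i: "invertible g" by (rule matrix_groupD(1)[OF G g])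
  let ?T = "\<lambda>Z. lie_bracket X (lie_bracket Y (Ad (matrix_inv g) Z))"
  have T: "clinear ?T"
    by (rule clinearI) (simp_all add: clinear_add[OF clinear_Ad] clinear_scale[OF clinear_Ad]
        lie_bracket_linear)
  have into: "Ad g ` L \<subseteq> L" "?T ` L \<subseteq> L"
    using Ad_L[OF g] Ad_L[OF matrix_groupD(4)[OF G g]] L_bracket X Y by auto
  have "B (Ad g X) (Ad g Y) = trace_on L (\<lambda>Z. Ad g (?T Z))"
    unfolding killing_form_def
    by (rule arg_cong[of _ _ "trace_on L"]) (simp add: fun_eq_iff Ad_bracket[OF i] Ad_inverse[OF i])
  also have "\<dots> = trace_on L (\<lambda>Z. ?T (Ad g Z))"
    by (rule trace_on_commute[OF L_subspace clinear_Ad into(1) T into(2)])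
  also have "\<dots> = B X Y"
    unfolding killing_form_def by (simp add: Ad_inverse[OF i])
  finally show ?thesis .
qed

text \<open>Here the choice of the r-matrix enters: on \<open>\<nn>\<close> it is the identity, it preserves
  \<open>\<pp>\<close>, and \<open>\<nn>\<close> is orthogonal to \<open>\<pp>\<close>. So \<open>\<langle>r X, Y\<rangle>\<close> for \<open>X\<close>, \<open>Y\<close> in \<open>\<pp>\<close> only depends on
  the classes modulo \<open>\<nn>\<close>.\<close>

lemma r_form_modulo_nn:
  assumes X: "X \<in> \<pp>" "X' - X \<in> \<nn>" and Y: "Y \<in> \<pp>" "Y' - Y \<in> \<nn>"
  shows "B (r X') Y' = B (r X) Y"
proof -
  define Z where "Z = X' - X"
  define W where "W = Y' - Y"
  have X': "X' = X + Z" and Y': "Y' = Y + W" by (simp_all add: Z_def W_def)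
  have Z: "Z \<in> \<nn>" and W: "W \<in> \<nn>" using X Y by (simp_all add: Z_def W_def)
  have rX': "r X' = r X + Z"
    unfolding X' by (rule r_additive_on_negative[OF pp_L[OF X(1)] nn_neg[OF Z]])
  have rX: "r X \<in> \<pp>" using X(1) unfolding \<pp>_def by (rule r_preserves) simp
  have "B (r X + Z) (Y + W) = B (r X) Y + B (r X) W + (B Z Y + B Z W)"
    using pp_L[OF rX] pp_L[OF Y(1)] nn_L[OF Z] nn_L[OF W] L_subspace
    by (simp add: killing_add_left killing_add_right cmat.subspace_add)
  also have "\<dots> = B (r X) Y"
    using pp_nn_orthogonal[OF rX W] pp_nn_orthogonal[OF Y(1) Z] pp_nn_orthogonal[OF nn_pp[OF Z] W]
    by simp
  finally show ?thesis unfolding rX' Y' .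
qed

end

section \<open>Gradients of invariant functions\<close>

text \<open>Differentiability along one-parameter subgroups, with a derivative that is linear over the ground
  field \<open>'k\<close>. This is all the regularity that gradients on \<open>N\<close> of a left \<open>N\<close>-invariant function need.\<close>

definition differentiable_at_identity ::
    "('k \<Rightarrow> complex) \<Rightarrow> (complex^'n^'n) set \<Rightarrow> (complex^'n^'n \<Rightarrow> 'k::real_normed_field) \<Rightarrow> bool"
  where "differentiable_at_identity emb L F \<longleftrightarrow>
    (\<exists>l. (\<forall>x y. l (x + y) = l x + l y) \<and> (\<forall>c x. l (emb c *\<^sub>C x) = c * l x) \<and>
      (\<forall>\<xi>\<in>L. ((\<lambda>t. F (matrix_exp (t *\<^sub>R \<xi>))) has_vector_derivative l \<xi>) (at 0)))"

text \<open>The ground field enters through an additive map \<open>\<phi>\<close> that turns the complex Killing form into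
  the form used to define gradients: the identity, or twice the real part.\<close>

locale parabolic_form = weyl_parabolic L h s z G z0
  for L h :: "(complex^'n^'n) set" and s :: "complex^'n^'n \<Rightarrow> complex^'n^'n" and z :: "complex^'n^'n"
    and G and z0 +
  fixes emb :: "'k::real_normed_field \<Rightarrow> complex" and \<phi> :: "complex \<Rightarrow> 'k"
  assumes \<phi>_diff: "\<phi> (a - c) = \<phi> a - \<phi> c"
    and \<phi>_faithful: "(\<And>c. \<phi> (c * w) = 0) \<Longrightarrow> w = 0"
    and \<phi>_represents: "\<lbrakk>\<And>x y. l (x + y) = l x + l y; \<And>c x. l (emb c *\<^sub>C x) = c * l x\<rbrakk>
      \<Longrightarrow> \<exists>Y\<in>L. \<forall>X\<in>L. \<phi> (B X Y) = l X"
begin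

lemma form_separates:
  assumes "cmat.subspace S" "S \<subseteq> L" "Y \<in> L" "\<And>X. X \<in> S \<Longrightarrow> \<phi> (B X Y) = 0" "X \<in> S"
  shows "B X Y = 0"
proof (rule \<phi>_faithful)
  fix c
  have "c *\<^sub>C X \<in> S" by (rule cmat.subspace_scale[OF assms(1,5)])
  hence "\<phi> (B (c *\<^sub>C X) Y) = 0" by (rule assms(4))
  thus "\<phi> (c * B X Y) = 0" using assms(2,3,5) by (simp add: killing_scale_left subset_iff)
qed

lemma gradient_unique:
  assumes X: "X \<in> L" and d: "\<And>\<xi>. \<xi> \<in> L \<Longrightarrow> ((\<lambda>t. f t \<xi>) has_vector_derivative \<phi> (B \<xi> X)) (at (0::real))"
  shows "(THE X. X \<in> L \<and> (\<forall>\<xi>\<in>L. ((\<lambda>t. f t \<xi>) has_vector_derivative \<phi> (B \<xi> X)) (at 0))) = X"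
proof (rule the_equality)
  fix Y assume Y: "Y \<in> L \<and> (\<forall>\<xi>\<in>L. ((\<lambda>t. f t \<xi>) has_vector_derivative \<phi> (B \<xi> Y)) (at 0))"
  hence YX: "Y - X \<in> L" using X L_subspace by (simp add: cmat.subspace_diff)
  have "\<phi> (B \<xi> (Y - X)) = 0" if \<xi>: "\<xi> \<in> L" for \<xi>
  proof -
    have "\<phi> (B \<xi> Y) = \<phi> (B \<xi> X)"
      using vector_derivative_unique_at[of "\<lambda>t. f t \<xi>" "\<phi> (B \<xi> Y)" 0] Y d[OF \<xi>] \<xi> by blast
    thus ?thesis using X Y \<xi> by (simp add: killing_diff_right \<phi>_diff)
  qed
  hence "B \<xi> (Y - X) = 0" if "\<xi> \<in> L" for \<xi>
    using form_separates[OF L_subspace _ YX _ that] by blast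
  hence "Y - X = 0"
    using killing_sym[OF YX] by (intro killing_nondegenerate[OF YX]) simp
  thus "Y = X" by simp
qed (use X d in blast)

text \<open>For a left \<open>N\<close>-invariant function both translates of \<open>g \<in> N\<close> can be moved to the identity;
  there the gradient is orthogonal to \<open>\<nn>\<close>.\<close>

lemma gradients_of_invariant:
  assumes inv: "\<And>g g'. g \<in> N \<Longrightarrow> g' \<in> G \<Longrightarrow> F (g ** g') = F g'"
    and diff: "differentiable_at_identity emb L F"
  obtains X where "X \<in> \<pp>"
    "\<And>g. g \<in> N \<Longrightarrow> right_gradient (\<lambda>X Y. \<phi> (B X Y)) L F g = X"
    "\<And>g. g \<in> N \<Longrightarrow> left_gradient (\<lambda>X Y. \<phi> (B X Y)) L F g = Ad g X"
proof -
  obtain l where l: "\<And>x y. l (x + y) = l x + l y" "\<And>c x. l (emb c *\<^sub>C x) = c * l x"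
    and d: "\<And>\<xi>. \<xi> \<in> L \<Longrightarrow> ((\<lambda>t. F (matrix_exp (t *\<^sub>R \<xi>))) has_vector_derivative l \<xi>) (at 0)"
    using diff unfolding differentiable_at_identity_def by blast
  obtain X where X: "X \<in> L" "\<forall>\<xi>\<in>L. \<phi> (B \<xi> X) = l \<xi>" using \<phi>_represents[of l] l by blast
  have lnn: "l Z = 0" if Z: "Z \<in> \<nn>" for Z
  proof -
    have "F (matrix_exp (t *\<^sub>R Z)) = F (mat 1)" for t
    proof -
      have "t *\<^sub>R Z \<in> \<nn>" unfolding scaleR_eq_cscale by (rule cmat.subspace_scale[OF nn_subspace Z])
      from inv[OF exp_nn_N[OF this] matrix_groupD(2)[OF G]] show ?thesis by simp
    qed
    hence "((\<lambda>t. F (matrix_exp (t *\<^sub>R Z))) has_vector_derivative 0) (at 0)" by simp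
    thus ?thesis using vector_derivative_unique_at[OF d[OF nn_L[OF Z]]] by blast
  qed
  have "X \<in> \<pp>"
  proof (rule nn_perp[OF X(1)])
    fix Z assume "Z \<in> \<nn>"
    thus "B Z X = 0"
      using form_separates[OF nn_subspace _ X(1), of Z] X(2) lnn nn_L by auto
  qed
  moreover have "right_gradient (\<lambda>X Y. \<phi> (B X Y)) L F g = X" if g: "g \<in> N" for g
    unfolding right_gradient_def
  proof (rule gradient_unique[OF X(1)])
    fix \<xi> assume \<xi>: "\<xi> \<in> L"
    have "F (g ** matrix_exp (t *\<^sub>R \<xi>)) = F (matrix_exp (t *\<^sub>R \<xi>))" for t
      by (rule inv[OF g exp_G[OF \<xi>]])
    thus "((\<lambda>t. F (g ** matrix_exp (t *\<^sub>R \<xi>))) has_vector_derivative \<phi> (B \<xi> X)) (at 0)"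
      using d[OF \<xi>] X(2) \<xi> by simp
  qed
  moreover have "left_gradient (\<lambda>X Y. \<phi> (B X Y)) L F g = Ad g X" if g: "g \<in> N" for g
    unfolding left_gradient_def
  proof (rule gradient_unique)
    have gG: "g \<in> G" using g N_G by blast
    have i: "invertible g" by (rule matrix_groupD(1)[OF G gG])
    show "Ad g X \<in> L" by (rule Ad_L[OF gG X(1)])
    fix \<xi> assume \<xi>: "\<xi> \<in> L"
    define \<zeta> where "\<zeta> = Ad (matrix_inv g) \<xi>"
    have \<zeta>: "\<zeta> \<in> L" unfolding \<zeta>_def by (rule Ad_L[OF matrix_groupD(4)[OF G gG] \<xi>])
    have \<xi>\<zeta>: "\<xi> = Ad g \<zeta>" unfolding \<zeta>_def by (simp add: Ad_inverse[OF i])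
    have "F (matrix_exp (t *\<^sub>R \<xi>) ** g) = F (matrix_exp (t *\<^sub>R \<zeta>))" for t
    proof -
      have "matrix_exp (t *\<^sub>R \<xi>) ** g = g ** matrix_exp (t *\<^sub>R \<zeta>) ** (matrix_inv g ** g)"
        unfolding \<xi>\<zeta> matrix_exp_Ad_group[OF i] by (simp only: matrix_mul_assoc)
      also have "\<dots> = g ** matrix_exp (t *\<^sub>R \<zeta>)" by (simp add: matrix_inv_cancel[OF i])
      finally show ?thesis using inv[OF g exp_G[OF \<zeta>]] by simp
    qed
    moreover have "\<phi> (B \<xi> (Ad g X)) = l \<zeta>"
      unfolding \<xi>\<zeta> killing_Ad[OF gG \<zeta> X(1)] using X(2) \<zeta> by blast
    ultimately show "((\<lambda>t. F (matrix_exp (t *\<^sub>R \<xi>) ** g)) has_vector_derivative \<phi> (B \<xi> (Ad g X))) (at 0)"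
      using d[OF \<zeta>] by simp
  qed
  ultimately show ?thesis by (rule that)
qed

lemma bracket_vanishes_on_N:
  assumes "\<And>g g'. g \<in> N \<Longrightarrow> g' \<in> G \<Longrightarrow> F (g ** g') = F g'" "differentiable_at_identity emb L F"
    and "\<And>g g'. g \<in> N \<Longrightarrow> g' \<in> G \<Longrightarrow> H (g ** g') = H g'" "differentiable_at_identity emb L H"
    and g: "g \<in> N"
  shows "group_bracket (\<lambda>X Y. \<phi> (B X Y)) L r F H g = 0"
proof -
  obtain X where X: "X \<in> \<pp>" "right_gradient (\<lambda>X Y. \<phi> (B X Y)) L F g = X"
    "left_gradient (\<lambda>X Y. \<phi> (B X Y)) L F g = Ad g X"
    using gradients_of_invariant[OF assms(1,2)] g by metis
  obtain Y where Y: "Y \<in> \<pp>" "right_gradient (\<lambda>X Y. \<phi> (B X Y)) L H g = Y"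
    "left_gradient (\<lambda>X Y. \<phi> (B X Y)) L H g = Ad g Y"
    using gradients_of_invariant[OF assms(3,4)] g by metis
  show ?thesis
    unfolding group_bracket_def X(2,3) Y(2,3)
      r_form_modulo_nn[OF X(1) Ad_N[OF g X(1)] Y(1) Ad_N[OF g Y(1)]] by simp
qed

end

section \<open>Smooth functions\<close>

text \<open>Constants, sums and products of smooth functions are smooth, so invariant functions form an algebra.\<close>

lemma times_differentiable_on_subset:
  "times_differentiable_on p U f \<Longrightarrow> V \<subseteq> U \<Longrightarrow> times_differentiable_on p V f"
proof (induction p arbitrary: f)
  case 0
  thus ?case by (auto intro: continuous_on_subset)
next
  case (Suc p)
  then obtain D where D: "\<forall>x\<in>U. (f has_derivative D x) (at x)"
    "\<forall>v. times_differentiable_on p U (\<lambda>x. D x v)" by auto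
  show ?case
    unfolding times_differentiable_on.simps
    by (rule exI[of _ D]) (use D Suc.IH Suc.prems(2) in blast)
qed

lemma times_differentiable_on_Suc_imp:
  "times_differentiable_on (Suc p) U f \<Longrightarrow> times_differentiable_on p U f"
proof (induction p arbitrary: f)
  case 0
  then obtain D where "\<forall>x\<in>U. (f has_derivative D x) (at x)" by auto
  hence "\<forall>x\<in>U. isCont f x" using has_derivative_continuous by blast
  thus ?case by (simp add: continuous_at_imp_continuous_on)
next
  case (Suc p)
  then obtain D where D: "\<forall>x\<in>U. (f has_derivative D x) (at x)"
    "\<forall>v. times_differentiable_on (Suc p) U (\<lambda>x. D x v)"
    unfolding times_differentiable_on.simps(2)[of "Suc p"] by blast
  show ?case
    unfolding times_differentiable_on.simps(2)[of p]
    by (rule exI[of _ D]) (use D Suc.IH in blast)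
qed

lemma times_differentiable_on_const: "times_differentiable_on p U (\<lambda>x. c)"
proof (induction p arbitrary: c)
  case (Suc p)
  show ?case
    unfolding times_differentiable_on.simps
    by (rule exI[of _ "\<lambda>_ _. 0"]) (use Suc in simp)
qed simp

lemma times_differentiable_on_add:
  "times_differentiable_on p U f \<Longrightarrow> times_differentiable_on p U g \<Longrightarrow>
    times_differentiable_on p U (\<lambda>x. f x + g x)"
proof (induction p arbitrary: f g)
  case 0
  thus ?case by (simp add: continuous_on_add)
next
  case (Suc p)
  obtain D where D: "\<forall>x\<in>U. (f has_derivative D x) (at x)"
    "\<forall>v. times_differentiable_on p U (\<lambda>x. D x v)" using Suc.prems(1) by auto
  obtain D' where D': "\<forall>x\<in>U. (g has_derivative D' x) (at x)"
    "\<forall>v. times_differentiable_on p U (\<lambda>x. D' x v)" using Suc.prems(2) by auto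
  show ?case
    unfolding times_differentiable_on.simps
    by (rule exI[of _ "\<lambda>x v. D x v + D' x v"])
      (use D D' Suc.IH in \<open>auto intro!: has_derivative_add\<close>)
qed

lemma times_differentiable_on_mult:
  fixes f g :: "'a::real_normed_vector \<Rightarrow> 'b::real_normed_algebra"
  shows "times_differentiable_on p U f \<Longrightarrow> times_differentiable_on p U g \<Longrightarrow>
    times_differentiable_on p U (\<lambda>x. f x * g x)"
proof (induction p arbitrary: f g)
  case 0
  thus ?case by (simp add: continuous_on_mult)
next
  case (Suc p)
  obtain D where D: "\<forall>x\<in>U. (f has_derivative D x) (at x)"
    "\<forall>v. times_differentiable_on p U (\<lambda>x. D x v)" using Suc.prems(1) by auto
  obtain D' where D': "\<forall>x\<in>U. (g has_derivative D' x) (at x)"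
    "\<forall>v. times_differentiable_on p U (\<lambda>x. D' x v)" using Suc.prems(2) by auto
  have f: "times_differentiable_on p U f" and g: "times_differentiable_on p U g"
    using Suc.prems times_differentiable_on_Suc_imp by blast+
  have "((\<lambda>x. f x * g x) has_derivative (\<lambda>v. f x * D' x v + D x v * g x)) (at x)" if "x \<in> U" for x
    using D D' that by (intro has_derivative_mult) auto
  moreover have "times_differentiable_on p U (\<lambda>x. f x * D' x v + D x v * g x)" for v
    using D(2) D'(2) f g Suc.IH by (intro times_differentiable_on_add) auto
  ultimately show ?case
    unfolding times_differentiable_on.simps
    by (intro exI[of _ "\<lambda>x v. f x * D' x v + D x v * g x"]) simp
qed

lemma smooth_on_cong: "smooth_on sc S f \<Longrightarrow> (\<And>y. y \<in> S \<Longrightarrow> f y = f' y) \<Longrightarrow> smooth_on sc S f'"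
  unfolding smooth_on_def by (metis IntD1)

lemma smooth_on_const: "smooth_on sc S (\<lambda>x. c)"
  unfolding smooth_on_def
proof
  fix x assume "x \<in> S"
  show "\<exists>U F. open U \<and> x \<in> U \<and> (\<forall>y\<in>S \<inter> U. F y = c) \<and> (\<forall>p. times_differentiable_on p U F) \<and>
      (\<forall>y\<in>U. \<exists>D. (F has_derivative D) (at y) \<and> (\<forall>c v. D (sc c v) = c * D v))"
    by (rule exI[of _ UNIV], rule exI[of _ "\<lambda>_. c"])
      (auto simp: times_differentiable_on_const intro!: exI[of _ "\<lambda>_. 0"])
qed

lemma smooth_on_combine:
  assumes f: "smooth_on sc S f" and g: "smooth_on sc S g"
  shows "smooth_on sc S (\<lambda>x. f x + g x)" "smooth_on sc S (\<lambda>x. f x * g x)"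
proof -
  have ex: "\<exists>U F. open U \<and> x \<in> U \<and> (\<forall>y\<in>S \<inter> U. F y = f y + g y) \<and> (\<forall>p. times_differentiable_on p U F) \<and>
      (\<forall>y\<in>U. \<exists>D. (F has_derivative D) (at y) \<and> (\<forall>c v. D (sc c v) = c * D v))"
    "\<exists>U F. open U \<and> x \<in> U \<and> (\<forall>y\<in>S \<inter> U. F y = f y * g y) \<and> (\<forall>p. times_differentiable_on p U F) \<and>
      (\<forall>y\<in>U. \<exists>D. (F has_derivative D) (at y) \<and> (\<forall>c v. D (sc c v) = c * D v))"
    if x: "x \<in> S" for x
  proof -
    obtain U F where U: "open U" "x \<in> U" "\<forall>y\<in>S \<inter> U. F y = f y" "\<forall>p. times_differentiable_on p U F"
      and D: "\<forall>y\<in>U. \<exists>D. (F has_derivative D) (at y) \<and> (\<forall>c v. D (sc c v) = c * D v)"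
      using f x unfolding smooth_on_def by metis
    obtain U' F' where U': "open U'" "x \<in> U'" "\<forall>y\<in>S \<inter> U'. F' y = g y" "\<forall>p. times_differentiable_on p U' F'"
      and D': "\<forall>y\<in>U'. \<exists>D. (F' has_derivative D) (at y) \<and> (\<forall>c v. D (sc c v) = c * D v)"
      using g x unfolding smooth_on_def by metis
    have td: "times_differentiable_on p (U \<inter> U') F" "times_differentiable_on p (U \<inter> U') F'" for p
      using U(4) U'(4) times_differentiable_on_subset by blast+
    note tda = times_differentiable_on_add[OF td] and tdm = times_differentiable_on_mult[OF td]
    have op: "open (U \<inter> U')" "x \<in> U \<inter> U'" using U U' by auto
    have "\<exists>D. ((\<lambda>x. F x + F' x) has_derivative D) (at y) \<and> (\<forall>c v. D (sc c v) = c * D v)"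
      "\<exists>D. ((\<lambda>x. F x * F' x) has_derivative D) (at y) \<and> (\<forall>c v. D (sc c v) = c * D v)"
      if "y \<in> U \<inter> U'" for y
    proof -
      obtain d where d: "(F has_derivative d) (at y)" "\<And>c v. d (sc c v) = c * d v"
        using D \<open>y \<in> U \<inter> U'\<close> by blast
      obtain d' where d': "(F' has_derivative d') (at y)" "\<And>c v. d' (sc c v) = c * d' v"
        using D' \<open>y \<in> U \<inter> U'\<close> by blast
      show "\<exists>D. ((\<lambda>x. F x + F' x) has_derivative D) (at y) \<and> (\<forall>c v. D (sc c v) = c * D v)"
        using has_derivative_add[OF d(1) d'(1)] d(2) d'(2)
        by (intro exI[of _ "\<lambda>v. d v + d' v"]) (simp add: distrib_left)
      show "\<exists>D. ((\<lambda>x. F x * F' x) has_derivative D) (at y) \<and> (\<forall>c v. D (sc c v) = c * D v)"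
        using has_derivative_mult[OF d(1) d'(1)] d(2) d'(2)
        by (intro exI[of _ "\<lambda>v. F y * d' v + d v * F' y"]) (simp add: algebra_simps)
    qed
    note lin = this
    show "\<exists>U F. open U \<and> x \<in> U \<and> (\<forall>y\<in>S \<inter> U. F y = f y + g y) \<and> (\<forall>p. times_differentiable_on p U F) \<and>
      (\<forall>y\<in>U. \<exists>D. (F has_derivative D) (at y) \<and> (\<forall>c v. D (sc c v) = c * D v))"
      by (rule exI[of _ "U \<inter> U'"], rule exI[of _ "\<lambda>x. F x + F' x"])
        (use op U(3) U'(3) tda lin(1) in simp)
    show "\<exists>U F. open U \<and> x \<in> U \<and> (\<forall>y\<in>S \<inter> U. F y = f y * g y) \<and> (\<forall>p. times_differentiable_on p U F) \<and>
      (\<forall>y\<in>U. \<exists>D. (F has_derivative D) (at y) \<and> (\<forall>c v. D (sc c v) = c * D v))"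
      by (rule exI[of _ "U \<inter> U'"], rule exI[of _ "\<lambda>x. F x * F' x"])
        (use op U(3) U'(3) tdm lin(2) in simp)
  qed
  show "smooth_on sc S (\<lambda>x. f x + g x)"
    unfolding smooth_on_def by (rule ballI) (rule ex(1))
  show "smooth_on sc S (\<lambda>x. f x * g x)"
    unfolding smooth_on_def by (rule ballI) (rule ex(2))
qed

lemma smooth_functions_const: "(\<lambda>x. c) \<in> smooth_functions M W"
  unfolding smooth_functions_def by (auto simp: smooth_on_const)

lemma smooth_functions_combine:
  assumes "\<phi> \<in> smooth_functions M W" "\<psi> \<in> smooth_functions M W"
  shows "(\<lambda>x. \<phi> x + \<psi> x) \<in> smooth_functions M W" "(\<lambda>x. \<phi> x * \<psi> x) \<in> smooth_functions M W"
  using assms unfolding smooth_functions_def by (auto intro: smooth_on_combine)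

lemma chart:
  assumes "smooth_manifold M" "(U, \<kappa>) \<in> atlas M"
  shows "U \<subseteq> topspace (mtop M)" "inj_on \<kappa> U"
proof -
  have "\<forall>(U, \<kappa>)\<in>atlas M. openin (mtop M) U \<and> open (\<kappa> ` U) \<and>
      homeomorphic_map (subtopology (mtop M) U) (top_of_set (\<kappa> ` U)) \<kappa>"
    using assms(1) unfolding smooth_manifold_def by (elim conjE)
  from bspec[OF this assms(2)] have op: "openin (mtop M) U" and
    hom: "homeomorphic_map (subtopology (mtop M) U) (top_of_set (\<kappa> ` U)) \<kappa>"
    by simp_all
  show U: "U \<subseteq> topspace (mtop M)" using op by (rule openin_subset)
  show "inj_on \<kappa> U"
    using homeomorphic_imp_injective_map[OF hom] U by (simp add: Int_absorb1)
qed

text \<open>Injectivity of charts ensures that smoothness on \<open>W\<close> only involves the values on \<open>W\<close>.\<close>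

lemma smooth_functions_cong:
  assumes M: "smooth_manifold M" and \<phi>: "\<phi> \<in> smooth_functions M W" and eq: "\<And>x. x \<in> W \<Longrightarrow> \<phi> x = \<psi> x"
  shows "\<psi> \<in> smooth_functions M W"
proof -
  have "smooth_on (*s) (\<kappa> ` (U \<inter> W)) (\<lambda>y. \<psi> (inv_into U \<kappa> y))" if at: "(U, \<kappa>) \<in> atlas M" for U \<kappa>
  proof (rule smooth_on_cong)
    show "smooth_on (*s) (\<kappa> ` (U \<inter> W)) (\<lambda>y. \<phi> (inv_into U \<kappa> y))"
      using \<phi> at unfolding smooth_functions_def by blast
    fix y assume "y \<in> \<kappa> ` (U \<inter> W)"
    then obtain x where "x \<in> U" "x \<in> W" "y = \<kappa> x" by blast
    thus "\<phi> (inv_into U \<kappa> y) = \<psi> (inv_into U \<kappa> y)"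
      using eq inv_into_f_f[OF chart(2)[OF M at]] by simp
  qed
  thus ?thesis unfolding smooth_functions_def by blast
qed

section \<open>Invariant functions of a Poisson action\<close>

text \<open>Along an orbit the value of a smooth function is differentiable at the identity: a local
  extension in the group variable can be differentiated along one-parameter groups.\<close>

lemma orbit_function_differentiable:
  fixes M :: "('m, 'k::{real_normed_field,euclidean_space}, 'd::finite) poisson_space"
    and emb :: "'k \<Rightarrow> complex" and G :: "(complex^'n^'n) set"
  assumes M: "smooth_manifold M" and act: "smooth_group_action emb G M act"
    and G: "mat 1 \<in> G" and \<phi>: "\<phi> \<in> smooth_functions M (topspace (mtop M))"
    and x: "x \<in> topspace (mtop M)"
    and stable: "\<And>g. g \<in> G \<Longrightarrow> act g x \<in> topspace (mtop M)"
  shows "differentiable_at_identity emb (lie_algebra G) (\<lambda>g. \<phi> (act g x))"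
proof -
  let ?T = "topspace (mtop M)"
  have "x \<in> \<Union>(fst ` atlas M)" using M x unfolding smooth_manifold_def by blast
  then obtain U \<kappa> where at: "(U, \<kappa>) \<in> atlas M" and xU: "x \<in> U" by auto
  let ?W = "{(g, x). g \<in> G \<and> x \<in> ?T \<and> act g x \<in> ?T}"
  let ?S = "{(g, \<kappa> x) |g x. (g, x) \<in> ?W \<and> x \<in> U}"
  let ?sc = "\<lambda>c (A, y). (emb c *\<^sub>C A, c *s y)"
  let ?f = "\<lambda>(g, y). (\<lambda>(g, x). \<phi> (act g x)) (g, inv_into U \<kappa> y)"
  have "\<forall>U. openin (mtop M) U \<longrightarrow> (\<forall>\<phi>\<in>smooth_functions M U.
      smooth_on_product emb M {(g, x). g \<in> G \<and> x \<in> ?T \<and> act g x \<in> U} (\<lambda>(g, x). \<phi> (act g x)))"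
    using act unfolding smooth_group_action_def by (elim conjE)
  hence "smooth_on_product emb M ?W (\<lambda>(g, x). \<phi> (act g x))" using \<phi> openin_topspace by blast
  hence sm: "smooth_on ?sc ?S ?f" using at unfolding smooth_on_product_def by blast
  have inS: "(g, \<kappa> x) \<in> ?S" if "g \<in> G" for g using that x xU stable by blast
  obtain V F where V: "open V" "(mat 1, \<kappa> x) \<in> V" and F: "\<forall>y\<in>?S \<inter> V. F y = ?f y"
    and D: "\<forall>y\<in>V. \<exists>D. (F has_derivative D) (at y) \<and> (\<forall>c v. D (?sc c v) = c * D v)"
    using bspec[OF sm[unfolded smooth_on_def] inS[OF G]] by (elim exE conjE)
  obtain d where d: "(F has_derivative d) (at (mat 1, \<kappa> x))" "\<forall>c v. d (?sc c v) = c * d v"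
    using bspec[OF D V(2)] by (elim exE conjE)
  have lin: "linear d" using d(1) by (rule has_derivative_linear)
  have "((\<lambda>t. \<phi> (act (matrix_exp (t *\<^sub>R \<xi>)) x)) has_vector_derivative d (\<xi>, 0)) (at 0)"
    if \<xi>: "\<xi> \<in> lie_algebra G" for \<xi>
  proof -
    define \<gamma> where "\<gamma> t = (matrix_exp (t *\<^sub>R \<xi>), \<kappa> x)" for t :: real
    have \<gamma>': "(\<gamma> has_vector_derivative (\<xi> ** matrix_exp (t *\<^sub>R \<xi>), 0)) (at t)" for t
      unfolding \<gamma>_def by (intro has_vector_derivative_Pair matrix_exp_has_derivative has_vector_derivative_const)
    have \<gamma>0: "\<gamma> 0 = (mat 1, \<kappa> x)" by (simp add: \<gamma>_def)
    have cont: "continuous_on UNIV \<gamma>"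
      using has_vector_derivative_continuous[OF \<gamma>'] by (simp add: continuous_at_imp_continuous_on)
    have op: "open (\<gamma> -` V)" by (rule open_vimage[OF V(1) cont])
    have "(\<gamma> has_derivative (\<lambda>h. h *\<^sub>R (\<xi>, 0))) (at 0)"
      using \<gamma>'[of 0] by (simp add: has_vector_derivative_def)
    hence "(F \<circ> \<gamma> has_derivative d \<circ> (\<lambda>h. h *\<^sub>R (\<xi>, 0))) (at 0)"
      by (rule diff_chain_at) (simp add: \<gamma>0 d(1))
    moreover have "d \<circ> (\<lambda>h. h *\<^sub>R (\<xi>, 0)) = (\<lambda>h. h *\<^sub>R d (\<xi>, 0))"
      unfolding o_def linear_scale[OF lin] ..
    ultimately have "(F \<circ> \<gamma> has_vector_derivative d (\<xi>, 0)) (at 0)"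
      by (simp add: has_vector_derivative_def)
    thus ?thesis
    proof (rule has_vector_derivative_transform_within_open[OF _ op])
      show "0 \<in> \<gamma> -` V" by (simp add: \<gamma>0 V(2))
      fix t assume t: "t \<in> \<gamma> -` V"
      have "matrix_exp (t *\<^sub>R \<xi>) \<in> G" using \<xi> unfolding lie_algebra_def by blast
      hence "\<gamma> t \<in> ?S \<inter> V" using inS t unfolding \<gamma>_def by blast
      hence "F (\<gamma> t) = ?f (\<gamma> t)" by (rule bspec[OF F])
      thus "(F \<circ> \<gamma>) t = \<phi> (act (matrix_exp (t *\<^sub>R \<xi>)) x)"
        by (simp add: \<gamma>_def inv_into_f_f[OF chart(2)[OF M at] xU])
    qed
  qed
  moreover have "d (\<xi> + \<zeta>, 0) = d (\<xi>, 0) + d (\<zeta>, 0)" for \<xi> \<zeta>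
    using linear_add[OF lin, of "(\<xi>, 0)" "(\<zeta>, 0)"] by simp
  moreover have "d (emb c *\<^sub>C \<xi>, 0) = c * d (\<xi>, 0)" for c \<xi>
    using d(2)[rule_format, of c "(\<xi>, 0)"] by simp
  ultimately show ?thesis
    unfolding differentiable_at_identity_def by (intro exI[of _ "\<lambda>\<xi>. d (\<xi>, 0)"]) blast
qed

text \<open>By the Poisson property of the action, the change of the bracket of two invariant functions
  along the subgroup is the group bracket of their restrictions to an orbit.\<close>

lemma admissible_criterion:
  fixes emb :: "'k::{real_normed_field,euclidean_space} \<Rightarrow> complex" and G N :: "(complex^'n^'n) set"
  assumes G: "matrix_group G" and N: "matrix_group N" "N \<subseteq> G"
    and vanish: "\<And>F H g. \<lbrakk>\<And>g g'. g \<in> N \<Longrightarrow> g' \<in> G \<Longrightarrow> F (g ** g') = F g';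
        differentiable_at_identity emb (lie_algebra G) F;
        \<And>g g'. g \<in> N \<Longrightarrow> g' \<in> G \<Longrightarrow> H (g ** g') = H g';
        differentiable_at_identity emb (lie_algebra G) H; g \<in> N\<rbrakk> \<Longrightarrow> brG F H g = 0"
  shows "admissible_subgroup emb G brG N TYPE(('m, 'k, 'd::finite) poisson_space)"
proof -
  have main: "poisson_subalgebra M (invariant_functions M act N)"
    if M: "poisson_manifold M" and pact: "poisson_group_action emb G brG M act"
    for M :: "('m, 'k, 'd) poisson_space" and act
  proof -
    let ?T = "topspace (mtop M)" and ?I = "invariant_functions M act N"
    have sm: "smooth_manifold M" using M unfolding poisson_manifold_def by (elim conjE)
    have act: "smooth_group_action emb G M act"
      using pact unfolding poisson_group_action_def by (elim conjE)
    have act_mult: "act (g ** g') x = act g (act g' x)" if "g \<in> G" "g' \<in> G" "x \<in> ?T" for g g' x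
      using act that unfolding smooth_group_action_def by blast
    have "continuous_map (prod_topology (top_of_set G) (mtop M)) (mtop M) (\<lambda>(g, x). act g x)"
      using act unfolding smooth_group_action_def by (elim conjE)
    hence act_T: "act g x \<in> ?T" if "g \<in> G" "x \<in> ?T" for g x
      using that by (auto simp: continuous_map_def Pi_iff)
    have inv: "\<phi> (act g x) = \<phi> x" if "\<phi> \<in> ?I" "g \<in> N" "x \<in> ?T" for \<phi> g x
      using that unfolding invariant_functions_def by blast
    have smooth: "\<phi> \<in> smooth_functions M ?T" if "\<phi> \<in> ?I" for \<phi>
      using that unfolding invariant_functions_def by blast
    have orbit_inv: "\<phi> (act (g ** g') x) = \<phi> (act g' x)"
      if "\<phi> \<in> ?I" "x \<in> ?T" "g \<in> N" "g' \<in> G" for \<phi> x g g'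
      using that N(2) act_mult[of g g' x] inv[OF that(1,3) act_T[OF that(4,2)]] by auto
    have orbit_diff: "differentiable_at_identity emb (lie_algebra G) (\<lambda>g. \<phi> (act g x))"
      if "\<phi> \<in> ?I" "x \<in> ?T" for \<phi> x
      by (rule orbit_function_differentiable[OF sm act matrix_groupD(2)[OF G] smooth[OF that(1)] that(2)])
        (rule act_T[OF _ that(2)])
    have bracket: "pbracket M \<phi> \<psi> \<in> ?I" if \<phi>: "\<phi> \<in> ?I" and \<psi>: "\<psi> \<in> ?I" for \<phi> \<psi>
    proof -
      note pm = M[unfolded poisson_manifold_def, THEN conjunct2, rule_format, OF openin_topspace
          smooth[OF \<phi>] smooth[OF \<psi>]]
      have sm_bracket: "pbracket M \<phi> \<psi> \<in> smooth_functions M ?T" using pm by (elim conjE)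
      have local: "pbracket M \<phi> \<psi> x = pbracket M \<phi>' \<psi>' x"
        if "\<phi>' \<in> smooth_functions M ?T" "\<psi>' \<in> smooth_functions M ?T"
          "\<And>x. x \<in> ?T \<Longrightarrow> \<phi> x = \<phi>' x \<and> \<psi> x = \<psi>' x" "x \<in> ?T" for \<phi>' \<psi>' x
        using pm that by blast
      have "pbracket M \<phi> \<psi> (act g x) = pbracket M \<phi> \<psi> x" if g: "g \<in> N" and x: "x \<in> ?T" for g x
      proof -
        have gG: "g \<in> G" using g N(2) by blast
        have "\<forall>U. openin (mtop M) U \<longrightarrow>
          (\<forall>\<phi>\<in>smooth_functions M U. \<forall>\<psi>\<in>smooth_functions M U.
            \<forall>g\<in>G. \<forall>x\<in>?T. act g x \<in> U \<longrightarrow>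
            product_bracket brG (pbracket M) (\<lambda>(g, x). \<phi> (act g x)) (\<lambda>(g, x). \<psi> (act g x)) (g, x)
              = pbracket M \<phi> \<psi> (act g x))"
          using pact unfolding poisson_group_action_def by (elim conjE)
        from this[rule_format, OF openin_topspace smooth[OF \<phi>] smooth[OF \<psi>] gG x act_T[OF gG x]]
        have "pbracket M \<phi> \<psi> (act g x) = brG (\<lambda>g. \<phi> (act g x)) (\<lambda>g. \<psi> (act g x)) g
            + pbracket M (\<lambda>x. \<phi> (act g x)) (\<lambda>x. \<psi> (act g x)) x"
          by (simp add: product_bracket_def)
        also have "brG (\<lambda>g. \<phi> (act g x)) (\<lambda>g. \<psi> (act g x)) g = 0"
          by (rule vanish[OF orbit_inv[OF \<phi> x] orbit_diff[OF \<phi> x] orbit_inv[OF \<psi> x]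
                orbit_diff[OF \<psi> x] g])
        also have "pbracket M (\<lambda>x. \<phi> (act g x)) (\<lambda>x. \<psi> (act g x)) x = pbracket M \<phi> \<psi> x"
        proof (rule local[symmetric])
          show "(\<lambda>x. \<phi> (act g x)) \<in> smooth_functions M ?T"
            by (rule smooth_functions_cong[OF sm smooth[OF \<phi>]]) (rule inv[OF \<phi> g, symmetric])
          show "(\<lambda>x. \<psi> (act g x)) \<in> smooth_functions M ?T"
            by (rule smooth_functions_cong[OF sm smooth[OF \<psi>]]) (rule inv[OF \<psi> g, symmetric])
        qed (use inv[OF \<phi> g] inv[OF \<psi> g] x in simp_all)
        finally show ?thesis by simp
      qed
      thus ?thesis using sm_bracket unfolding invariant_functions_def by blast
    qed
    have combine: "(\<lambda>x. \<phi> x + \<psi> x) \<in> ?I" "(\<lambda>x. \<phi> x * \<psi> x) \<in> ?I"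
      if "\<phi> \<in> ?I" "\<psi> \<in> ?I" for \<phi> \<psi>
      using that smooth_functions_combine[OF smooth[OF that(1)] smooth[OF that(2)]]
      unfolding invariant_functions_def by simp_all
    show ?thesis
      unfolding poisson_subalgebra_def
    proof (intro conjI allI ballI)
      show "?I \<subseteq> smooth_functions M ?T" using smooth by (rule subsetI)
      show "(\<lambda>x. c) \<in> ?I" for c
        unfolding invariant_functions_def by (simp add: smooth_functions_const)
      fix \<phi> \<psi> assume "\<phi> \<in> ?I" "\<psi> \<in> ?I"
      thus "(\<lambda>x. \<phi> x + \<psi> x) \<in> ?I" "(\<lambda>x. \<phi> x * \<psi> x) \<in> ?I" "pbracket M \<phi> \<psi> \<in> ?I"
        by (fact combine bracket)+
    qed
  qed
  show ?thesis
    unfolding admissible_subgroup_def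
    by (intro conjI allI impI) (rule N(1), rule N(2), rule main)
qed

section \<open>Admissibility over both ground fields\<close>

context weyl_parabolic begin

lemma complex_form: "parabolic_form L h s z G z0 id id"
proof
  fix l :: "complex^'n^'n \<Rightarrow> complex"
  assume l: "\<And>x y. l (x + y) = l x + l y" "\<And>c x. l (id c *\<^sub>C x) = c * l x"
  have "\<exists>Y\<in>L. \<forall>X\<in>L. B X Y = l X"
    by (rule bilinear_form_represents[OF L_subspace])
      (use l killing_sym killing_nondegenerate in \<open>auto simp: killing_add_left killing_add_right
        killing_scale_left killing_scale_right\<close>)
  thus "\<exists>Y\<in>L. \<forall>X\<in>L. id (B X Y) = l X" by simp
next
  fix w :: complex assume "\<And>c. id (c * w) = 0"
  from this[of 1] show "w = 0" by simp
qed simp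

text \<open>A real linear functional is the real part of a complex linear one.\<close>

lemma real_form: "parabolic_form L h s z G z0 complex_of_real (\<lambda>c. 2 * Re c)"
proof
  fix l :: "complex^'n^'n \<Rightarrow> real"
  assume l: "\<And>x y. l (x + y) = l x + l y" "\<And>c x. l (complex_of_real c *\<^sub>C x) = c * l x"
  define m where "m x = Complex (l x / 2) (- l (\<i> *\<^sub>C x) / 2)" for x
  have add: "m (x + y) = m x + m y" for x y
    by (simp add: m_def l(1) cmat.scale_right_distrib complex_eq_iff add_divide_distrib)
  have scale: "m (c *\<^sub>C x) = c * m x" for c x
  proof -
    have c: "c *\<^sub>C y = complex_of_real (Re c) *\<^sub>C y + complex_of_real (Im c) *\<^sub>C (\<i> *\<^sub>C y)" for y
    proof -
      have "c = complex_of_real (Re c) + complex_of_real (Im c) * \<i>"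
        by (simp add: complex_eq_iff)
      hence "c *\<^sub>C y = (complex_of_real (Re c) + complex_of_real (Im c) * \<i>) *\<^sub>C y" by simp
      thus ?thesis by (simp only: cmat.scale_left_distrib cmat.scale_scale)
    qed
    have ii: "l (\<i> *\<^sub>C (\<i> *\<^sub>C x)) = - l x" using l(2)[of "- 1" x] by simp
    have "l (c *\<^sub>C y) = Re c * l y + Im c * l (\<i> *\<^sub>C y)" for y
      by (subst c) (simp only: l)
    moreover have "\<i> *\<^sub>C (c *\<^sub>C x) = c *\<^sub>C (\<i> *\<^sub>C x)" by (simp add: mult.commute)
    ultimately show ?thesis
      by (simp add: m_def complex_eq_iff ii field_simps del: cmat.scale_scale)
  qed
  have "\<exists>Y\<in>L. \<forall>X\<in>L. B X Y = m X"
    by (rule bilinear_form_represents[OF L_subspace])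
      (use add scale killing_sym killing_nondegenerate in \<open>auto simp: killing_add_left
        killing_add_right killing_scale_left killing_scale_right\<close>)
  moreover have "2 * Re (m X) = l X" for X by (simp add: m_def)
  ultimately show "\<exists>Y\<in>L. \<forall>X\<in>L. 2 * Re (B X Y) = l X" by metis
next
  fix w :: complex assume *: "\<And>c. 2 * Re (c * w) = 0"
  show "w = 0" using *[of 1] *[of \<i>] by (simp add: complex_eq_iff)
qed simp

lemma N_admissible:
  "admissible_subgroup id G (group_bracket (killing_form L) L r) N
     TYPE(('m, complex, 'd::finite) poisson_space)"
  "admissible_subgroup complex_of_real G (group_bracket (real_killing_form L) L r) N
     TYPE(('m, real, 'd::finite) poisson_space)"
proof -
  interpret c: parabolic_form L h s z G z0 id id by (rule complex_form)
  interpret re: parabolic_form L h s z G z0 complex_of_real "\<lambda>c. 2 * Re c" by (rule real_form)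
  have ceq: "killing_form L = (\<lambda>X Y. id (killing_form L X Y))" by simp
  have req: "real_killing_form L = (\<lambda>X Y. 2 * Re (killing_form L X Y))"
    by (simp add: fun_eq_iff real_killing_form_def)
  show "admissible_subgroup id G (group_bracket (killing_form L) L r) N
      TYPE(('m, complex, 'd::finite) poisson_space)"
    by (rule admissible_criterion[OF G N_group N_G], subst ceq, rule c.bracket_vanishes_on_N)
      (simp_all add: L)
  show "admissible_subgroup complex_of_real G (group_bracket (real_killing_form L) L r) N
      TYPE(('m, real, 'd::finite) poisson_space)"
    unfolding req
    by (rule admissible_criterion[OF G N_group N_G], rule re.bracket_vanishes_on_N)
      (simp_all add: L)
qed

end

text \<open>The chamber element is \<open>\<eta>bar\<close> and the grading element of the parabolic subalgebra is \<open>\<eta>bar0\<close>.\<close>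

theorem lemma8:
  fixes G g h b bbar n k kbar N :: "(complex^'n^'n) set"
    and s r :: "complex^'n^'n \<Rightarrow> complex^'n^'n"
    and V :: "nat \<Rightarrow> (complex^'n^'n) set"
    and \<eta> :: "nat \<Rightarrow> complex^'n^'n"
    and \<eta>bar \<eta>bar0 :: "complex^'n^'n"
    and K M :: nat
    and \<iota> :: "nat \<Rightarrow> nat"
  assumes "simple_algebraic_group G"
    and "g = lie_algebra G"
    and "cartan_subalgebra g h"
    and "s \<in> weyl_group g h"
    and "weyl_decomposition g h s K V"
    and "\<forall>i\<le>K. \<eta> i \<in> V i"
    and "\<forall>i\<le>K. \<forall>\<alpha>\<in>roots g h. (\<exists>x\<in>V i. \<alpha> x \<noteq> 0) \<longrightarrow> \<alpha> (\<eta> i) \<noteq> 0"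
    and "strict_mono_on {..M} \<iota>"
    and "\<iota> ` {..M} = {i. i \<le> K \<and> root_stratum g h K \<eta> i \<noteq> {}}"
    and "\<forall>m\<le>M. \<forall>l<m. \<forall>\<alpha>\<in>root_stratum g h K \<eta> (\<iota> m).
           cmod (\<alpha> (\<eta> (\<iota> m))) > cmod (\<Sum>j\<in>{l..<m}. \<alpha> (\<eta> (\<iota> j)))"
    and "\<eta>bar = (\<Sum>m\<le>M. \<eta> (\<iota> m))"
    and "\<eta>bar0 = (\<Sum>m | m \<le> M \<and> \<iota> m > 0. \<eta> (\<iota> m))"
    and "b = negative_borel g h \<eta>bar"
    and "bbar = positive_borel g h \<eta>bar"
    and "k = nilradical b"
    and "kbar = nilradical bbar"
    and "n = grade_nilradical g \<eta>bar0"
    and "N = subgroup_of_subalgebra G n"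
    and "r = r_matrix g h s k kbar"
  shows "admissible_subgroup id G (group_bracket (killing_form g) g r) N
           TYPE(('m, complex, 'd::finite) poisson_space)
       \<and> admissible_subgroup complex_of_real G (group_bracket (real_killing_form g) g r) N
           TYPE(('m, real, 'd::finite) poisson_space)"
proof -
  have G: "matrix_group G" and simple: "simple_lie_algebra g"
    using assms(1,2) by (simp_all add: simple_algebraic_group_def algebraic_group_def)
  interpret cartan_pair g h by unfold_locales (rule simple, rule assms(3))
  note chamber = chamber_of_decomposition[OF assms(5-12)]
  interpret weyl_parabolic g h s \<eta>bar G \<eta>bar0
    by unfold_locales (fact assms(4) chamber G assms(2))+
  have "r = local.r" unfolding r_def assms(19,15,16,13,14) ..
  moreover have "N = local.N" unfolding N_def assms(18,17) ..
  ultimately show ?thesis using N_admissible by simp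
qed

end
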